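(* Let $\mathcal{N}$ be a quaternionic manifold of dimension $4n+4$ and let $M$ be a (connected, orientable) real hypersurface in $\mathcal{N}$. For each open set $\mathcal{U}\subset\mathcal{N}$ carrying a local quaternionic triple $(\mathcal{I}_1,\mathcal{I}_2,\mathcal{I}_3)$ and meeting $M$, set $U=M\cap\mathcal{U}$, $Q_a=TU\cap\mathcal{I}_a(TU)$ and $I_a=\mathcal{I}_a|_{Q_a}$, $a=1,2,3$. Then the collection of all $\{(Q_a,I_a)\}_{a=1,2,3}$ on the sets $U$ is a quaternionic CR structure on $M$; in particular each $\{(Q_a,I_a)\}_{a=1,2,3}$ satisfies, for $Q=Q_1\cap Q_2\cap Q_3$, all $X,Y\in\Gamma(Q)$ and $a=1,2,3$, the integrability conditions $[X,Y]-[I_aX,I_aY]\in\Gamma(Q_a)$ and $I_a([X,Y]-[I_aX,I_aY])-[X,I_aY]-[I_aX,Y]\in\Gamma(Q)$.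
   Context: Everything is smooth; $(a,b,c)$ always denotes a cyclic permutation of $(1,2,3)$. Quaternionic manifold. A manifold $\mathcal{N}$ of dimension $4n+4$ with a $GL(n+1,\mathbb{H})\cdot\mathbb{H}^*$-structure admitting a torsion-free affine connection $\mathcal{D}$ preserving it. Equivalently, near each point there are almost complex structures $\mathcal{I}_1,\mathcal{I}_2,\mathcal{I}_3$ satisfying the quaternion relations (here called a local quaternionic triple), any two such triples being related on overlaps by an $SO(3)$-valued function, with $\mathcal{D}\mathcal{I}_a=\sum_b\gamma_{ab}\otimes\mathcal{I}_b$ for one-forms $\gamma_{ab}=-\gamma_{ba}$. Almost hyper CR structures. An almost CR structure is a corank one subbundle of the tangent bundle together with a complex structure on it. An almost hyper CR structure on a $(4n+3)$-manifold is a pair of almost CR structures $(Q_1,I_1)$, $(Q_2,I_2)$ such that $Q_1,Q_2$ are transversal to each other and $I_1I_2=-I_2I_1$ on $I_1(Q_1\cap Q_2)\cap I_2(Q_1\cap Q_2)$. A third almost CR structure $(Q_3,I_3)$ is determined by $Q_3=I_1(Q_1\cap Q_2)+I_2(Q_1\cap Q_2)$, $I_3=-I_2I_1$ on $I_1(Q_1\cap Q_2)$ and $I_3=I_1I_2$ on $I_2(Q_1\cap Q_2)$. The bundle $Q=Q_1\cap Q_2\cap Q_3$ has corank three. An admissible triple is a triple $(T_1,T_2,T_3)$ of vector fields transverse to $Q$ with $T_a\in\Gamma(Q_b\cap Q_c)$ and $I_aT_b=T_c$. Given one, extend $I_a$ to endomorphisms $\widetilde{I_a}$ of the tangent bundle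 by $\widetilde{I_a}T_a=0$; for an $S^2$-valued function $\mathbf v=(v_1,v_2,v_3)$ put $Q_{\mathbf v}=Q\oplus\{\sum x_aT_a:\sum x_av_a=0\}$ and $I_{\mathbf v}=(\sum v_a\widetilde{I_a})|_{Q_{\mathbf v}}$ (independent of the admissible triple). An almost hyper CR structure satisfying the two integrability conditions displayed in the claim is called a hyper CR structure. Quaternionic CR structure. A covering of $M$ by open sets $U$ carrying hyper CR structures such that for any two of them, $\{(Q_a,I_a)\}$ on $U$ and $\{(Q_a',I_a')\}$ on $U'$ with $U\cap U'\ne\emptyset$, there is a function $S:U\cap U'\to SO(3)$ with $Q'_{\mathbf v}=Q_{S\mathbf v}$, $I'_{\mathbf v}=I_{S\mathbf v}$ for all $\mathbf v\in S^2$. *)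

theory Defs
  imports "HOL-Analysis.Analysis" "HOL-Library.Function_Algebras"
begin

text \<open>
  Conventions. A tangent vector at a point of a manifold is the family of its coordinate
  expressions, one for each chart of the atlas around the point. Such families are functions
  from charts to the model space, which are made a real vector space pointwise so that
  \<^const>\<open>subspace\<close>, \<^const>\<open>span\<close>, \<^const>\<open>independent\<close> apply to them.

  The index set {1,2,3} is the type 3, i.e. the integers modulo 3 (so that 3 = 0): the
  cyclic permutations of (1,2,3) are exactly the triples (a, a+1, a+2).

  Objects on an open set are represented by total functions; their values elsewhere are
  irrelevant.
\<close>

instantiation "fun" :: (type, real_vector) real_vector
begin

definition scaleR_fun :: "real \<Rightarrow> ('a \<Rightarrow> 'b) \<Rightarrow> 'a \<Rightarrow> 'b" where
  "scaleR_fun r f = (\<lambda>x. r *\<^sub>R f x)"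

instance
  by standard (auto simp: scaleR_fun_def fun_eq_iff scaleR_add_right scaleR_add_left)

end

section \<open>Smooth manifolds\<close>

primrec Ck_on :: "'a::real_normed_vector set \<Rightarrow> nat \<Rightarrow> ('a \<Rightarrow> 'b::real_normed_vector) \<Rightarrow> bool" where
  "Ck_on S 0 f \<longleftrightarrow> continuous_on S f"
| "Ck_on S (Suc k) f \<longleftrightarrow>
     (\<forall>x\<in>S. f differentiable (at x)) \<and> (\<forall>v. Ck_on S k (\<lambda>x. frechet_derivative f (at x) v))"

text \<open>Only meant for open \<open>S\<close> (and finite-dimensional domain).\<close>

definition smooth_on :: "'a::real_normed_vector set \<Rightarrow> ('a \<Rightarrow> 'b::real_normed_vector) \<Rightarrow> bool" where
  "smooth_on S f \<longleftrightarrow> (\<forall>k. Ck_on S k f)"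

type_synonym ('p, 'e) chart = "'p set \<times> ('p \<Rightarrow> 'e)"

type_synonym ('p, 'e) tvec = "('p, 'e) chart \<Rightarrow> 'e"

type_synonym ('p, 'e) vfield = "'p \<Rightarrow> ('p, 'e) tvec"

type_synonym ('p, 'e) endo = "'p \<Rightarrow> ('p, 'e) tvec \<Rightarrow> ('p, 'e) tvec"

type_synonym ('p, 'e) distrib = "'p \<Rightarrow> ('p, 'e) tvec set"

datatype ('p, 'e) manifold = Manifold (mtop: "'p topology") (charts: "('p, 'e) chart set")

definition chart_inv :: "('p, 'e) chart \<Rightarrow> 'e \<Rightarrow> 'p" where
  "chart_inv c = inv_into (fst c) (snd c)"

definition smooth_manifold :: "('p, 'e::euclidean_space) manifold \<Rightarrow> bool" where
  "smooth_manifold M \<longleftrightarrow>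
     Hausdorff_space (mtop M) \<and> second_countable (mtop M) \<and>
     (\<Union>c\<in>charts M. fst c) = topspace (mtop M) \<and>
     (\<forall>c\<in>charts M. openin (mtop M) (fst c) \<and> open (snd c ` fst c) \<and>
        homeomorphic_map (subtopology (mtop M) (fst c)) (top_of_set (snd c ` fst c)) (snd c)) \<and>
     (\<forall>c\<in>charts M. \<forall>d\<in>charts M. smooth_on (snd c ` (fst c \<inter> fst d)) (snd d \<circ> chart_inv c))"

definition smooth_fun :: "('p, 'e::euclidean_space) manifold \<Rightarrow> 'p set \<Rightarrow> ('p \<Rightarrow> 'b::real_normed_vector) \<Rightarrow> bool" where
  "smooth_fun M W f \<longleftrightarrow> (\<forall>c\<in>charts M. smooth_on (snd c ` (fst c \<inter> W)) (f \<circ> chart_inv c))"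

definition smooth_map :: "('p, 'e::euclidean_space) manifold \<Rightarrow> ('q, 'f::euclidean_space) manifold \<Rightarrow> ('p \<Rightarrow> 'q) \<Rightarrow> bool" where
  "smooth_map M N f \<longleftrightarrow> continuous_map (mtop M) (mtop N) f \<and>
     (\<forall>c\<in>charts M. \<forall>d\<in>charts N. smooth_on (snd c ` (fst c \<inter> f -` fst d)) (snd d \<circ> f \<circ> chart_inv c))"

definition tangent_space :: "('p, 'e::euclidean_space) manifold \<Rightarrow> ('p, 'e) distrib" where
  "tangent_space M p = {v.
     (\<forall>c\<in>charts M. \<forall>d\<in>charts M. p \<in> fst c \<inter> fst d \<longrightarrow>
        v d = frechet_derivative (snd d \<circ> chart_inv c) (at (snd c p)) (v c)) \<and>
     (\<forall>c. c \<notin> charts M \<or> p \<notin> fst c \<longrightarrow> v c = 0)}"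

text \<open>An arbitrarily chosen chart around a point, used for notions not depending on the choice.\<close>

definition chart_at :: "('p, 'e) manifold \<Rightarrow> 'p \<Rightarrow> ('p, 'e) chart" where
  "chart_at M p = (SOME c. c \<in> charts M \<and> p \<in> fst c)"

definition pushforward ::
  "('p, 'e::euclidean_space) manifold \<Rightarrow> ('q, 'f::euclidean_space) manifold \<Rightarrow> ('p \<Rightarrow> 'q) \<Rightarrow> 'p \<Rightarrow>
   ('p, 'e) tvec \<Rightarrow> ('q, 'f) tvec" where
  "pushforward M N f p v = (\<lambda>d.
     if d \<in> charts N \<and> f p \<in> fst d
     then frechet_derivative (snd d \<circ> f \<circ> chart_inv (chart_at M p))
            (at (snd (chart_at M p) p)) (v (chart_at M p))
     else 0)"

definition dir_deriv :: "('p, 'e::euclidean_space) manifold \<Rightarrow> 'p \<Rightarrow> ('p, 'e) tvec \<Rightarrow> ('p \<Rightarrow> real) \<Rightarrow> real" where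
  "dir_deriv M p v f =
     frechet_derivative (f \<circ> chart_inv (chart_at M p)) (at (snd (chart_at M p) p)) (v (chart_at M p))"

definition local_rep :: "('p, 'e) chart \<Rightarrow> ('p, 'e) vfield \<Rightarrow> 'e \<Rightarrow> 'e" where
  "local_rep c X = (\<lambda>x. X (chart_inv c x) c)"

definition vector_fields :: "('p, 'e::euclidean_space) manifold \<Rightarrow> 'p set \<Rightarrow> ('p, 'e) vfield set" where
  "vector_fields M W = {X. (\<forall>p\<in>W. X p \<in> tangent_space M p) \<and>
     (\<forall>c\<in>charts M. smooth_on (snd c ` (fst c \<inter> W)) (local_rep c X))}"

text \<open>In coordinates, \<open>[X,Y]\<^sup>i = \<Sum>\<^sub>j (X\<^sup>j \<partial>\<^sub>j Y\<^sup>i - Y\<^sup>j \<partial>\<^sub>j X\<^sup>i)\<close>.\<close>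

definition lie_bracket :: "('p, 'e::euclidean_space) manifold \<Rightarrow> ('p, 'e) vfield \<Rightarrow> ('p, 'e) vfield \<Rightarrow> ('p, 'e) vfield" where
  "lie_bracket M X Y = (\<lambda>p c.
     if c \<in> charts M \<and> p \<in> fst c
     then frechet_derivative (local_rep c Y) (at (snd c p)) (X p c)
        - frechet_derivative (local_rep c X) (at (snd c p)) (Y p c)
     else 0)"

definition app :: "('p, 'e) endo \<Rightarrow> ('p, 'e) vfield \<Rightarrow> ('p, 'e) vfield" where
  "app J X = (\<lambda>p. J p (X p))"

definition linear_on :: "'a::real_vector set \<Rightarrow> ('a \<Rightarrow> 'b::real_vector) \<Rightarrow> bool" where
  "linear_on V f \<longleftrightarrow> (\<forall>u\<in>V. \<forall>v\<in>V. f (u + v) = f u + f v) \<and> (\<forall>r. \<forall>v\<in>V. f (r *\<^sub>R v) = r *\<^sub>R f v)"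

definition one_form :: "('p, 'e::euclidean_space) manifold \<Rightarrow> 'p set \<Rightarrow> ('p \<Rightarrow> ('p, 'e) tvec \<Rightarrow> real) \<Rightarrow> bool" where
  "one_form M U \<gamma> \<longleftrightarrow> (\<forall>p\<in>U. linear_on (tangent_space M p) (\<gamma> p)) \<and>
     (\<forall>W X. openin (mtop M) W \<and> W \<subseteq> U \<and> X \<in> vector_fields M W \<longrightarrow> smooth_fun M W (\<lambda>p. \<gamma> p (X p)))"

definition subbundle :: "('p, 'e::euclidean_space) manifold \<Rightarrow> 'p set \<Rightarrow> nat \<Rightarrow> ('p, 'e) distrib \<Rightarrow> bool" where
  "subbundle M U r Q \<longleftrightarrow>
     (\<forall>p\<in>U. \<exists>W X. openin (mtop M) W \<and> p \<in> W \<and> W \<subseteq> U \<and>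
        (\<forall>i<r. X i \<in> vector_fields M W) \<and>
        (\<forall>q\<in>W. inj_on (\<lambda>i. X i q) {..<r} \<and> independent ((\<lambda>i. X i q) ` {..<r}) \<and>
                span ((\<lambda>i. X i q) ` {..<r}) = Q q))"

definition sections :: "('p, 'e::euclidean_space) manifold \<Rightarrow> 'p set \<Rightarrow> ('p, 'e) distrib \<Rightarrow> ('p, 'e) vfield set" where
  "sections M W Q = {X \<in> vector_fields M W. \<forall>p\<in>W. X p \<in> Q p}"

text \<open>A complex structure on the vector bundle \<open>Q\<close> over \<open>U\<close>; smoothness means that smooth
  local sections are mapped to smooth local sections.\<close>

definition complex_structure_on ::
  "('p, 'e::euclidean_space) manifold \<Rightarrow> 'p set \<Rightarrow> ('p, 'e) distrib \<Rightarrow> ('p, 'e) endo \<Rightarrow> bool" where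
  "complex_structure_on M U Q J \<longleftrightarrow>
     (\<forall>p\<in>U. linear_on (Q p) (J p) \<and> (\<forall>v\<in>Q p. J p v \<in> Q p \<and> J p (J p v) = - v)) \<and>
     (\<forall>W X. openin (mtop M) W \<and> W \<subseteq> U \<and> X \<in> sections M W Q \<longrightarrow> app J X \<in> sections M W Q)"

section \<open>Quaternionic manifolds\<close>

text \<open>A covariant derivative \<open>D p v Y\<close> of a smooth vector field \<open>Y\<close> defined near \<open>p\<close> in the
  direction of a tangent vector \<open>v\<close> at \<open>p\<close>.\<close>

type_synonym ('p, 'e) covderiv = "'p \<Rightarrow> ('p, 'e) tvec \<Rightarrow> ('p, 'e) vfield \<Rightarrow> ('p, 'e) tvec"

definition affine_connection :: "('p, 'e::euclidean_space) manifold \<Rightarrow> ('p, 'e) covderiv \<Rightarrow> bool" where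
  "affine_connection N D \<longleftrightarrow> (\<forall>W. openin (mtop N) W \<longrightarrow>
     (\<forall>Y\<in>vector_fields N W.
        (\<forall>p\<in>W. linear_on (tangent_space N p) (\<lambda>v. D p v Y)) \<and>
        (\<forall>p\<in>W. \<forall>v\<in>tangent_space N p.
           D p v Y \<in> tangent_space N p \<and>
           (\<forall>Z\<in>vector_fields N W. D p v (Y + Z) = D p v Y + D p v Z) \<and>
           (\<forall>f. smooth_fun N W f \<longrightarrow>
              D p v (\<lambda>q. f q *\<^sub>R Y q) = dir_deriv N p v f *\<^sub>R Y p + f p *\<^sub>R D p v Y) \<and>
           (\<forall>Z\<in>vector_fields N W. (\<forall>q\<in>W. Y q = Z q) \<longrightarrow> D p v Y = D p v Z)) \<and>
        (\<forall>X\<in>vector_fields N W. (\<lambda>p. D p (X p) Y) \<in> vector_fields N W)))"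

definition torsion_free :: "('p, 'e::euclidean_space) manifold \<Rightarrow> ('p, 'e) covderiv \<Rightarrow> bool" where
  "torsion_free N D \<longleftrightarrow> (\<forall>W. openin (mtop N) W \<longrightarrow>
     (\<forall>X\<in>vector_fields N W. \<forall>Y\<in>vector_fields N W. \<forall>p\<in>W.
        D p (X p) Y - D p (Y p) X = lie_bracket N X Y p))"

definition local_quaternionic_triple ::
  "('p, 'e::euclidean_space) manifold \<Rightarrow> 'p set \<Rightarrow> (3 \<Rightarrow> ('p, 'e) endo) \<Rightarrow> bool" where
  "local_quaternionic_triple N U J \<longleftrightarrow> openin (mtop N) U \<and>
     (\<forall>a. complex_structure_on N U (tangent_space N) (J a)) \<and>
     (\<forall>a. \<forall>p\<in>U. \<forall>v\<in>tangent_space N p.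
        J a p (J (a + 1) p v) = J (a + 2) p v \<and> J (a + 1) p (J a p v) = - J (a + 2) p v)"

definition SO3_related ::
  "('p, 'e::euclidean_space) manifold \<Rightarrow> 'p set \<Rightarrow> (3 \<Rightarrow> ('p, 'e) endo) \<Rightarrow> 'p set \<Rightarrow> (3 \<Rightarrow> ('p, 'e) endo) \<Rightarrow> bool" where
  "SO3_related N U J U' J' \<longleftrightarrow>
     (\<exists>S :: 'p \<Rightarrow> real^3^3. smooth_fun N (U \<inter> U') S \<and>
        (\<forall>p\<in>U \<inter> U'. rotation_matrix (S p) \<and>
           (\<forall>a. \<forall>v\<in>tangent_space N p. J' a p v = (\<Sum>b\<in>UNIV. (S p $ b $ a) *\<^sub>R J b p v))))"

text \<open>\<open>D J\<^sub>a = \<Sum>\<^sub>b \<gamma>\<^sub>a\<^sub>b \<otimes> J\<^sub>b\<close> over \<open>U\<close>, where \<open>(D\<^sub>v J) Y = D\<^sub>v (J Y) - J (D\<^sub>v Y)\<close>.\<close>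

definition preserves_triple ::
  "('p, 'e::euclidean_space) manifold \<Rightarrow> ('p, 'e) covderiv \<Rightarrow> 'p set \<Rightarrow> (3 \<Rightarrow> ('p, 'e) endo) \<Rightarrow> bool" where
  "preserves_triple N D U J \<longleftrightarrow>
     (\<exists>\<gamma> :: 3 \<Rightarrow> 3 \<Rightarrow> 'p \<Rightarrow> ('p, 'e) tvec \<Rightarrow> real.
        (\<forall>a b. one_form N U (\<gamma> a b)) \<and>
        (\<forall>a b. \<forall>p\<in>U. \<forall>v\<in>tangent_space N p. \<gamma> a b p v = - \<gamma> b a p v) \<and>
        (\<forall>W Y. openin (mtop N) W \<and> W \<subseteq> U \<and> Y \<in> vector_fields N W \<longrightarrow>
           (\<forall>a. \<forall>p\<in>W. \<forall>v\<in>tangent_space N p.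
              D p v (app (J a) Y) - J a p (D p v Y) = (\<Sum>b\<in>UNIV. \<gamma> a b p v *\<^sub>R J b p (Y p)))))"

text \<open>The quaternionic structure is given by a family \<open>\<T>\<close> of local quaternionic triples
  whose domains cover the manifold.\<close>

definition quaternionic_manifold ::
  "('p, 'e::euclidean_space) manifold \<Rightarrow> ('p set \<times> (3 \<Rightarrow> ('p, 'e) endo)) set \<Rightarrow> bool" where
  "quaternionic_manifold N \<T> \<longleftrightarrow> smooth_manifold N \<and> (\<exists>n. DIM('e) = 4 * n + 4) \<and>
     (\<forall>(U, J)\<in>\<T>. local_quaternionic_triple N U J) \<and>
     (\<Union>(U, J)\<in>\<T>. U) = topspace (mtop N) \<and>
     (\<forall>(U, J)\<in>\<T>. \<forall>(U', J')\<in>\<T>. SO3_related N U J U' J') \<and>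
     (\<exists>D. affine_connection N D \<and> torsion_free N D \<and> (\<forall>(U, J)\<in>\<T>. preserves_triple N D U J))"

text \<open>All local quaternionic triples of the structure determined by \<open>\<T>\<close>, not only the members
  of \<open>\<T>\<close>.\<close>

definition compatible_triples ::
  "('p, 'e::euclidean_space) manifold \<Rightarrow> ('p set \<times> (3 \<Rightarrow> ('p, 'e) endo)) set \<Rightarrow>
   ('p set \<times> (3 \<Rightarrow> ('p, 'e) endo)) set" where
  "compatible_triples N \<T> = {(U, J). local_quaternionic_triple N U J \<and>
     (\<forall>(V, K)\<in>\<T>. SO3_related N V K U J)}"

section \<open>Real hypersurfaces\<close>

definition hypersurface :: "('p, 'f::euclidean_space) manifold \<Rightarrow> ('p, 'e::euclidean_space) manifold \<Rightarrow> bool" where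
  "hypersurface M N \<longleftrightarrow> smooth_manifold M \<and> DIM('e) = DIM('f) + 1 \<and>
     topspace (mtop M) \<subseteq> topspace (mtop N) \<and>
     mtop M = subtopology (mtop N) (topspace (mtop M)) \<and>
     smooth_map M N (\<lambda>x. x) \<and>
     (\<forall>p\<in>topspace (mtop M). inj_on (pushforward M N (\<lambda>x. x) p) (tangent_space M p))"

text \<open>Existence of an oriented atlas in the given smooth structure.\<close>

definition orientable :: "('p, real^'m) manifold \<Rightarrow> bool" where
  "orientable M \<longleftrightarrow> (\<exists>B. smooth_manifold (Manifold (mtop M) (charts M \<union> B)) \<and>
     (\<Union>c\<in>B. fst c) = topspace (mtop M) \<and>
     (\<forall>c\<in>B. \<forall>d\<in>B. \<forall>p\<in>fst c \<inter> fst d.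
        det (matrix (frechet_derivative (snd d \<circ> chart_inv c) (at (snd c p)))) > 0))"

section \<open>Hyper CR and quaternionic CR structures\<close>

definition almost_CR ::
  "('p, 'f::euclidean_space) manifold \<Rightarrow> 'p set \<Rightarrow> ('p, 'f) distrib \<Rightarrow> ('p, 'f) endo \<Rightarrow> bool" where
  "almost_CR M U Q I \<longleftrightarrow> (\<exists>r. DIM('f) = r + 1 \<and> subbundle M U r Q) \<and> complex_structure_on M U Q I"

definition almost_hyper_CR ::
  "('p, 'f::euclidean_space) manifold \<Rightarrow> 'p set \<Rightarrow> (3 \<Rightarrow> ('p, 'f) distrib) \<Rightarrow> (3 \<Rightarrow> ('p, 'f) endo) \<Rightarrow> bool" where
  "almost_hyper_CR M U Q I \<longleftrightarrow> (\<exists>n. DIM('f) = 4 * n + 3) \<and>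
     (\<forall>a. almost_CR M U (Q a) (I a)) \<and>
     (\<forall>p\<in>U. let H = Q 1 p \<inter> Q 2 p in
        {u + v | u v. u \<in> Q 1 p \<and> v \<in> Q 2 p} = tangent_space M p \<and>
        (\<forall>v\<in>I 1 p ` H \<inter> I 2 p ` H. I 1 p (I 2 p v) = - I 2 p (I 1 p v)) \<and>
        Q 3 p = {u + v | u v. u \<in> I 1 p ` H \<and> v \<in> I 2 p ` H} \<and>
        (\<forall>v\<in>I 1 p ` H. I 3 p v = - I 2 p (I 1 p v)) \<and>
        (\<forall>v\<in>I 2 p ` H. I 3 p v = I 1 p (I 2 p v)))"

definition Qint :: "(3 \<Rightarrow> ('p, 'f) distrib) \<Rightarrow> ('p, 'f) distrib" where
  "Qint Q p = Q 1 p \<inter> Q 2 p \<inter> Q 3 p"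

definition integrable_hyper_CR ::
  "('p, 'f::euclidean_space) manifold \<Rightarrow> 'p set \<Rightarrow> (3 \<Rightarrow> ('p, 'f) distrib) \<Rightarrow> (3 \<Rightarrow> ('p, 'f) endo) \<Rightarrow> bool" where
  "integrable_hyper_CR M U Q I \<longleftrightarrow>
     (\<forall>W. openin (mtop M) W \<and> W \<subseteq> U \<longrightarrow>
       (\<forall>X\<in>sections M W (Qint Q). \<forall>Y\<in>sections M W (Qint Q). \<forall>a.
          (let Z = lie_bracket M X Y - lie_bracket M (app (I a) X) (app (I a) Y) in
             Z \<in> sections M W (Q a) \<and>
             app (I a) Z - lie_bracket M X (app (I a) Y) - lie_bracket M (app (I a) X) Y
               \<in> sections M W (Qint Q))))"

definition hyper_CR ::
  "('p, 'f::euclidean_space) manifold \<Rightarrow> 'p set \<Rightarrow> (3 \<Rightarrow> ('p, 'f) distrib) \<Rightarrow> (3 \<Rightarrow> ('p, 'f) endo) \<Rightarrow> bool" where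
  "hyper_CR M U Q I \<longleftrightarrow> almost_hyper_CR M U Q I \<and> integrable_hyper_CR M U Q I"

definition admissible_triple ::
  "('p, 'f::euclidean_space) manifold \<Rightarrow> 'p set \<Rightarrow> (3 \<Rightarrow> ('p, 'f) distrib) \<Rightarrow> (3 \<Rightarrow> ('p, 'f) endo) \<Rightarrow>
   (3 \<Rightarrow> ('p, 'f) vfield) \<Rightarrow> bool" where
  "admissible_triple M W Q I T \<longleftrightarrow>
     (\<forall>a. T a \<in> vector_fields M W \<and>
        (\<forall>p\<in>W. T a p \<in> Q (a + 1) p \<inter> Q (a + 2) p \<and> T a p \<notin> Qint Q p \<and>
                I a p (T (a + 1) p) = T (a + 2) p))"

text \<open>An admissible triple defined in some neighbourhood of \<open>p\<close>. The two definitions using it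
  do not depend on the choice.\<close>

definition admissible_at ::
  "('p, 'f::euclidean_space) manifold \<Rightarrow> (3 \<Rightarrow> ('p, 'f) distrib) \<Rightarrow> (3 \<Rightarrow> ('p, 'f) endo) \<Rightarrow> 'p \<Rightarrow>
   (3 \<Rightarrow> ('p, 'f) vfield)" where
  "admissible_at M Q I p = (SOME T. \<exists>W. openin (mtop M) W \<and> p \<in> W \<and> admissible_triple M W Q I T)"

definition Q_vec ::
  "('p, 'f::euclidean_space) manifold \<Rightarrow> (3 \<Rightarrow> ('p, 'f) distrib) \<Rightarrow> (3 \<Rightarrow> ('p, 'f) endo) \<Rightarrow>
   real^3 \<Rightarrow> ('p, 'f) distrib" where
  "Q_vec M Q I v p = (let T = admissible_at M Q I p in
     {w + (\<Sum>a\<in>UNIV. (x $ a) *\<^sub>R T a p) | w x. w \<in> Qint Q p \<and> x \<bullet> v = 0})"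

text \<open>The extension of \<open>I\<close> from \<open>V\<close> to \<open>V \<oplus> \<real> t\<close> by \<open>t \<mapsto> 0\<close>.\<close>

definition extend_by_zero :: "'a::real_vector set \<Rightarrow> 'a \<Rightarrow> ('a \<Rightarrow> 'b) \<Rightarrow> 'a \<Rightarrow> 'b" where
  "extend_by_zero V t I w = I (THE u. u \<in> V \<and> (\<exists>r. w = u + r *\<^sub>R t))"

definition I_vec ::
  "('p, 'f::euclidean_space) manifold \<Rightarrow> (3 \<Rightarrow> ('p, 'f) distrib) \<Rightarrow> (3 \<Rightarrow> ('p, 'f) endo) \<Rightarrow>
   real^3 \<Rightarrow> ('p, 'f) endo" where
  "I_vec M Q I v p w = (let T = admissible_at M Q I p in
     (\<Sum>a\<in>UNIV. (v $ a) *\<^sub>R extend_by_zero (Q a p) (T a p) (I a p) w))"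

definition quaternionic_CR_structure ::
  "('p, 'f::euclidean_space) manifold \<Rightarrow>
   ('p set \<times> (3 \<Rightarrow> ('p, 'f) distrib) \<times> (3 \<Rightarrow> ('p, 'f) endo)) set \<Rightarrow> bool" where
  "quaternionic_CR_structure M \<C> \<longleftrightarrow>
     (\<forall>(U, Q, I)\<in>\<C>. openin (mtop M) U \<and> hyper_CR M U Q I) \<and>
     (\<Union>(U, Q, I)\<in>\<C>. U) = topspace (mtop M) \<and>
     (\<forall>(U, Q, I)\<in>\<C>. \<forall>(U', Q', I')\<in>\<C>. U \<inter> U' \<noteq> {} \<longrightarrow>
        (\<exists>S :: 'p \<Rightarrow> real^3^3. smooth_fun M (U \<inter> U') S \<and>
           (\<forall>p\<in>U \<inter> U'. rotation_matrix (S p) \<and>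
              (\<forall>v\<in>sphere 0 1.
                 Q_vec M Q' I' v p = Q_vec M Q I (S p *v v) p \<and>
                 (\<forall>w\<in>Q_vec M Q' I' v p. I_vec M Q' I' v p w = I_vec M Q I (S p *v v) p w)))))"

section \<open>The structure induced on a hypersurface\<close>

text \<open>Tangent vectors of \<open>M\<close> are identified with tangent vectors of \<open>N\<close> by the differential of
  the inclusion \<open>M \<rightarrow> N\<close>.\<close>

definition induced_Q ::
  "('p, 'f::euclidean_space) manifold \<Rightarrow> ('p, 'e::euclidean_space) manifold \<Rightarrow> ('p, 'e) endo \<Rightarrow> ('p, 'f) distrib" where
  "induced_Q M N J p = (let \<iota> = pushforward M N (\<lambda>x. x) p; TM = tangent_space M p in
     {v \<in> TM. \<iota> v \<in> \<iota> ` TM \<inter> J p ` \<iota> ` TM})"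

definition induced_I ::
  "('p, 'f::euclidean_space) manifold \<Rightarrow> ('p, 'e::euclidean_space) manifold \<Rightarrow> ('p, 'e) endo \<Rightarrow> ('p, 'f) endo" where
  "induced_I M N J p v = (let \<iota> = pushforward M N (\<lambda>x. x) p in
     inv_into (tangent_space M p) \<iota> (J p (\<iota> v)))"

end

theory Submission
  imports Defs
begin

text \<open>
  Write \<open>D\<close> for the torsion-free connection. Since \<open>[X,Y] = D\<^sub>X Y - D\<^sub>Y X\<close> and
  \<open>D J\<^sub>a\<close> is a combination of the \<open>J\<^sub>b\<close>, for sections \<open>X, Y\<close> of \<open>Q\<close> the tensor
  \<open>J\<^sub>a ([X,Y] - [J\<^sub>a X,J\<^sub>a Y]) - [X,J\<^sub>a Y] - [J\<^sub>a X,Y]\<close> involves only terms \<open>J\<^sub>b X\<close>,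
  \<open>J\<^sub>b Y\<close> and therefore lies in the quaternionic subspace \<open>Q\<close>; as the last two brackets are
  tangent to \<open>M\<close>, this gives both integrability conditions. The derivatives are taken along the
  inclusion map, in coordinates, so that no field has to be extended from \<open>M\<close> to \<open>N\<close>.

  Pointwise, \<open>T M\<close> is the kernel of a conormal \<open>\<xi>\<close>, the four covectors \<open>\<xi>, \<xi> \<circ> J\<^sub>a\<close> are
  linearly independent, and a vector \<open>n\<close> with \<open>\<xi> n \<noteq> 0\<close>, \<open>\<xi> (J\<^sub>a n) = 0\<close> yields the
  admissible triple \<open>T\<^sub>a = - J\<^sub>a n\<close>. For every admissible triple, \<open>Q\<^sub>v\<close> and \<open>I\<^sub>v\<close> turn out to be
  induced by \<open>\<Sum> v\<^sub>a J\<^sub>a\<close>, so they transform like the quaternionic triples themselves.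
\<close>

section \<open>Calculus of smooth functions\<close>

text \<open>The connection is assumed to preserve the members of \<open>\<T>\<close>, while the
  claim concerns every compatible triple. Passing to such a triple multiplies by rotation-valued
  functions, whose derivatives add further combinations of the \<open>J b\<close>; since the
  argument only asks that the error be such a combination, it survives the passage.

  Identities with the connection are established at one point at a time, through the Christoffel
  symbols there. Smoothness is treated apart: brackets are smooth fields on their own, and
  \<open>induced_I\<close>, defined by an abstract inverse of the differential of the inclusion,
  becomes smooth once a smooth left inverse in coordinates replaces it.

  On overlaps two compatible triples are compared through a member of \<open>\<T>\<close>, hence
  only locally. The rotation is unique at each point, since \<open>J 1 e\<close>,
  \<open>J 2 e\<close>, \<open>J 3 e\<close> are independent for \<open>e \<noteq> 0\<close>; so the
  local rotations form one smooth function.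

  The sign in the admissible triple is chosen so that \<open>J a\<close> takes its
  \<open>a\<close>-th vector back to \<open>n\<close>, the same for all \<open>a\<close>.\<close>

abbreviation fderiv :: "('a::real_normed_vector \<Rightarrow> 'b::real_normed_vector) \<Rightarrow> 'a \<Rightarrow> 'a \<Rightarrow> 'b" where
  "fderiv f x \<equiv> frechet_derivative f (at x)"

section \<open>Locality of derivatives and of the classes C^k\<close>

lemma frechet_derivative_cong_open:
  fixes f g :: "'a::real_normed_vector \<Rightarrow> 'b::real_normed_vector"
  assumes "open S" "x \<in> S" "\<And>y. y \<in> S \<Longrightarrow> f y = g y"
  shows "fderiv f x = fderiv g x"
proof -
  have "(f has_derivative D) (at x) \<longleftrightarrow> (g has_derivative D) (at x)" for D
  proof
    assume "(f has_derivative D) (at x)"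
    then show "(g has_derivative D) (at x)"
      by (rule has_derivative_transform_within_open[OF _ assms(1,2)]) (simp add: assms(3))
  next
    assume "(g has_derivative D) (at x)"
    then show "(f has_derivative D) (at x)"
      by (rule has_derivative_transform_within_open[OF _ assms(1,2)]) (simp add: assms(3))
  qed
  then show ?thesis unfolding frechet_derivative_def by simp
qed

lemma has_frechet_derivative:
  "f differentiable (at x) \<Longrightarrow> (f has_derivative (\<lambda>v. fderiv f x v)) (at x)"
  by (simp add: frechet_derivative_works)

lemma differentiable_cong_open:
  assumes "open S" "x \<in> S" "\<And>y. y \<in> S \<Longrightarrow> f y = g y" "f differentiable (at x)"
  shows "g differentiable (at x)"
proof -
  obtain D where "(f has_derivative D) (at x)" using assms(4) by (auto simp: differentiable_def)
  then have "(g has_derivative D) (at x)"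
    by (rule has_derivative_transform_within_open[OF _ assms(1,2)]) (simp add: assms(3))
  then show ?thesis by (auto simp: differentiable_def)
qed

lemma Ck_on_cong:
  assumes "open S" "\<And>x. x \<in> S \<Longrightarrow> f x = g x"
  shows "Ck_on S k f \<longleftrightarrow> Ck_on S k g"
  using assms(2)
proof (induction k arbitrary: f g)
  case 0
  then show ?case using continuous_on_cong by auto
next
  case (Suc k)
  have "f differentiable (at x) \<longleftrightarrow> g differentiable (at x)" if "x \<in> S" for x
    using differentiable_cong_open[OF assms(1) that, of f g]
      differentiable_cong_open[OF assms(1) that, of g f] Suc.prems by auto
  moreover have "Ck_on S k (\<lambda>x. fderiv f x v) \<longleftrightarrow>
      Ck_on S k (\<lambda>x. fderiv g x v)" for v
  proof (rule Suc.IH)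
    fix x assume "x \<in> S"
    then show "fderiv f x v = fderiv g x v"
      using frechet_derivative_cong_open[OF assms(1), of x f g] Suc.prems by simp
  qed
  ultimately show ?case by simp
qed

text \<open>Outside \<open>S\<close> the term \<open>frechet_derivative\<close> may take arbitrary
  values, so it is convenient to give the derivative by a formula valid on \<open>S\<close> alone.
  Openness of \<open>S\<close> makes the class depend on the values there only; the product and
  chain rules below all go through this rule.\<close>

lemma Ck_on_SucI:
  assumes "open S" "\<And>x. x \<in> S \<Longrightarrow> (f has_derivative f' x) (at x)" "\<And>v. Ck_on S k (\<lambda>x. f' x v)"
  shows "Ck_on S (Suc k) f"
proof -
  have *: "f' x = fderiv f x" if "x \<in> S" for x
    using frechet_derivative_at[OF assms(2)[OF that]] .
  have "Ck_on S k (\<lambda>x. fderiv f x v)" for v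
    using assms(3)[of v] Ck_on_cong[OF assms(1), of "\<lambda>x. f' x v" "\<lambda>x. fderiv f x v" k] *
    by simp
  then show ?thesis using assms(2) by (auto simp: differentiable_def)
qed

lemma Ck_on_SucD:
  assumes "Ck_on S (Suc k) f" "x \<in> S"
  shows "(f has_derivative (\<lambda>v. fderiv f x v)) (at x)"
  using assms by (simp add: has_frechet_derivative)

lemma Ck_on_Suc_imp: "Ck_on S (Suc k) f \<Longrightarrow> Ck_on S k f"
proof (induction k arbitrary: f)
  case 0
  then show ?case
    by (auto intro!: continuous_at_imp_continuous_on differentiable_imp_continuous_within)
next
  case (Suc k)
  show ?case
    using Suc.prems Suc.IH unfolding Ck_on.simps(2)[of S "Suc k"] Ck_on.simps(2)[of S k] by blast
qed

lemma Ck_on_subset: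
  assumes "Ck_on S k f" "T \<subseteq> S"
  shows "Ck_on T k f"
  using assms(1)
proof (induction k arbitrary: f)
  case 0
  then show ?case using assms(2) continuous_on_subset by auto
next
  case (Suc k)
  then show ?case using assms(2) by auto
qed

lemma Ck_on_local:
  assumes "\<And>x. x \<in> S \<Longrightarrow> \<exists>T. open T \<and> x \<in> T \<and> Ck_on T k f"
  shows "Ck_on S k f"
  using assms
proof (induction k arbitrary: f)
  case 0
  show ?case
  proof (simp, rule continuous_at_imp_continuous_on, rule ballI)
    fix x assume "x \<in> S"
    with 0 obtain T where "open T" "x \<in> T" "continuous_on T f" by auto
    then show "isCont f x" using continuous_on_eq_continuous_at by blast
  qed
next
  case (Suc k)
  have "f differentiable (at x)" if "x \<in> S" for x
    using Suc.prems[OF that] by auto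
  moreover have "Ck_on S k (\<lambda>x. fderiv f x v)" for v
    by (rule Suc.IH) (use Suc.prems in \<open>fastforce\<close>)
  ultimately show ?case by simp
qed

section \<open>Algebraic operations and composition in the classes C^k\<close>

lemma Ck_on_const: "Ck_on S k (\<lambda>x. c)"
  by (induction k arbitrary: c) auto

lemma Ck_on_linear_id:
  assumes "bounded_linear h" shows "Ck_on S k h"
proof (cases k)
  case 0
  then show ?thesis using assms by (simp add: linear_continuous_on)
next
  case (Suc j)
  have "fderiv h x = h" for x
    using frechet_derivative_at[OF bounded_linear_imp_has_derivative[OF assms]] by simp
  then show ?thesis using Suc assms by (simp add: Ck_on_const bounded_linear_imp_differentiable)
qed

lemma Ck_on_linear:
  assumes "open S" "bounded_linear h" "Ck_on S k f"
  shows "Ck_on S k (\<lambda>x. h (f x))"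
  using assms(3)
proof (induction k arbitrary: f)
  case 0
  then show ?case using assms(2) by (simp add: bounded_linear.continuous_on)
next
  case (Suc k)
  show ?case
  proof (rule Ck_on_SucI[OF assms(1)])
    show "((\<lambda>x. h (f x)) has_derivative (\<lambda>v. h (fderiv f x v))) (at x)" if "x \<in> S" for x
      using bounded_linear.has_derivative[OF assms(2) Ck_on_SucD[OF Suc.prems that]] .
    show "Ck_on S k (\<lambda>x. h (fderiv f x v))" for v
      using Suc by auto
  qed
qed

lemma Ck_on_add:
  assumes "open S" "Ck_on S k f" "Ck_on S k g"
  shows "Ck_on S k (\<lambda>x. f x + g x)"
  using assms(2,3)
proof (induction k arbitrary: f g)
  case 0
  then show ?case by (simp add: continuous_on_add)
next
  case (Suc k)
  show ?case
  proof (rule Ck_on_SucI[OF assms(1)])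
    show "((\<lambda>x. f x + g x) has_derivative
        (\<lambda>v. fderiv f x v + fderiv g x v)) (at x)" if "x \<in> S" for x
      by (intro has_derivative_add Ck_on_SucD[OF _ that]) (use Suc in auto)
  qed (use Suc in auto)
qed

lemma Ck_on_bilinear:
  assumes "open S" "bounded_bilinear pr" "Ck_on S k f" "Ck_on S k g"
  shows "Ck_on S k (\<lambda>x. pr (f x) (g x))"
  using assms(3,4)
proof (induction k arbitrary: f g)
  case 0
  then show ?case using assms(2) by (simp add: bounded_bilinear.continuous_on)
next
  case (Suc k)
  show ?case
  proof (rule Ck_on_SucI[OF assms(1)])
    show "((\<lambda>x. pr (f x) (g x)) has_derivative
        (\<lambda>v. pr (f x) (fderiv g x v) + pr (fderiv f x v) (g x))) (at x)" if "x \<in> S" for x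
      by (intro bounded_bilinear.FDERIV[OF assms(2)] Ck_on_SucD[OF _ that]) (use Suc in auto)
    show "Ck_on S k (\<lambda>x. pr (f x) (fderiv g x v) + pr (fderiv f x v) (g x))" for v
      by (intro Ck_on_add[OF assms(1)] Suc.IH) (use Suc.prems Ck_on_Suc_imp in auto)
  qed
qed

text \<open>The derivative of the reciprocal is a product in which the reciprocal itself occurs, so
  the claim for order \<open>k\<close> is just what order \<open>Suc k\<close> asks for.\<close>

lemma Ck_on_inverse:
  fixes f :: "'a::real_normed_vector \<Rightarrow> real"
  assumes "open S" "Ck_on S k f" "\<And>x. x \<in> S \<Longrightarrow> f x \<noteq> 0"
  shows "Ck_on S k (\<lambda>x. inverse (f x))"
  using assms(2)
proof (induction k)
  case 0
  then show ?case using assms(3) by (auto intro!: continuous_on_inverse)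
next
  case (Suc k)
  note m = Ck_on_bilinear[OF assms(1) bounded_bilinear_mult]
  show ?case
  proof (rule Ck_on_SucI[OF assms(1)])
    show "((\<lambda>x. inverse (f x)) has_derivative
        (\<lambda>v. - (inverse (f x) * fderiv f x v * inverse (f x)))) (at x)" if "x \<in> S" for x
      using Deriv.has_derivative_inverse[OF assms(3)[OF that] Ck_on_SucD[OF Suc.prems that]] .
    have "Ck_on S k (\<lambda>x. inverse (f x) * fderiv f x v * inverse (f x))" for v
      by (intro m Suc.IH) (use Suc.prems Ck_on_Suc_imp in auto)
    from Ck_on_linear[OF assms(1) bounded_linear_minus[OF bounded_linear_ident] this]
    show "Ck_on S k (\<lambda>x. - (inverse (f x) * fderiv f x v * inverse (f x)))" for v .
  qed
qed

lemma Ck_on_sum: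
  assumes "open S" "\<And>i. i \<in> A \<Longrightarrow> Ck_on S k (f i)"
  shows "Ck_on S k (\<lambda>x. \<Sum>i\<in>A. f i x)"
  using assms(2)
  by (induction A rule: infinite_finite_induct) (auto intro: Ck_on_const Ck_on_add assms(1))

lemma linear_Basis_expansion:
  fixes h :: "'a::euclidean_space \<Rightarrow> 'b::real_vector"
  assumes "linear h"
  shows "h v = (\<Sum>b\<in>Basis. (v \<bullet> b) *\<^sub>R h b)"
proof -
  have "h v = h (\<Sum>b\<in>Basis. (v \<bullet> b) *\<^sub>R b)" by (simp add: euclidean_representation)
  also have "\<dots> = (\<Sum>b\<in>Basis. (v \<bullet> b) *\<^sub>R h b)"
    using assms by (simp add: linear_sum linear_scale)
  finally show ?thesis .
qed

text \<open>\<open>Ck_on\<close> controls derivatives in fixed directions, but in the chain rule the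
  direction \<open>f' x v\<close> moves with \<open>x\<close>. Expanding it in the basis of the
  intermediate space leaves a finite sum of products with derivatives of \<open>g\<close> in fixed
  directions, to which the induction hypothesis applies.\<close>

lemma Ck_on_compose:
  fixes f :: "'a::real_normed_vector \<Rightarrow> 'b::euclidean_space"
  assumes "open S" "open T" "f ` S \<subseteq> T" "Ck_on S k f" "Ck_on T k g"
  shows "Ck_on S k (\<lambda>x. g (f x))"
  using assms(4,5)
proof (induction k arbitrary: g)
  case 0
  then show ?case using assms(3) by (auto intro: continuous_on_compose2)
next
  case (Suc k)
  let ?f' = "\<lambda>x. fderiv f x" and ?g' = "\<lambda>x. fderiv g x"
  show ?case
  proof (rule Ck_on_SucI[OF assms(1)])
    fix x assume x: "x \<in> S"
    then have "f x \<in> T" using assms(3) by auto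
    have 1: "((\<lambda>x. g (f x)) has_derivative (\<lambda>v. ?g' (f x) (?f' x v))) (at x)"
      using diff_chain_at[OF Ck_on_SucD[OF Suc.prems(1) x] Ck_on_SucD[OF Suc.prems(2) \<open>f x \<in> T\<close>]]
      by (simp add: o_def)
    have "linear (?g' (f x))"
      using Suc.prems(2) \<open>f x \<in> T\<close> by (simp add: linear_frechet_derivative)
    from linear_Basis_expansion[OF this]
    have 2: "(\<lambda>v. ?g' (f x) (?f' x v)) = (\<lambda>v. \<Sum>b\<in>Basis. (?f' x v \<bullet> b) *\<^sub>R ?g' (f x) b)"
      by (rule ext)
    show "((\<lambda>x. g (f x)) has_derivative
        (\<lambda>v. \<Sum>b\<in>Basis. (?f' x v \<bullet> b) *\<^sub>R ?g' (f x) b)) (at x)"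
      by (fact has_derivative_eq_rhs[OF 1 2])
  next
    fix v
    have "Ck_on S k (\<lambda>x. ?f' x v \<bullet> b)" for b
      by (rule Ck_on_linear[OF assms(1) bounded_linear_inner_left]) (use Suc.prems in simp)
    moreover have "Ck_on S k (\<lambda>x. ?g' (f x) b)" for b
      by (rule Suc.IH[OF Ck_on_Suc_imp[OF Suc.prems(1)]]) (use Suc.prems in simp)
    ultimately show "Ck_on S k (\<lambda>x. \<Sum>b\<in>Basis. (?f' x v \<bullet> b) *\<^sub>R ?g' (f x) b)"
      by (intro Ck_on_sum[OF assms(1)] Ck_on_bilinear[OF assms(1) bounded_bilinear_scaleR])
  qed
qed

section \<open>Closure properties of smooth functions\<close>

lemma smooth_on_cong:
  "open S \<Longrightarrow> (\<And>x. x \<in> S \<Longrightarrow> f x = g x) \<Longrightarrow> smooth_on S f \<longleftrightarrow> smooth_on S g"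
  unfolding smooth_on_def using Ck_on_cong by blast

lemma smooth_on_eq:
  "smooth_on S g \<Longrightarrow> open S \<Longrightarrow> (\<And>x. x \<in> S \<Longrightarrow> f x = g x) \<Longrightarrow> smooth_on S f"
  using smooth_on_cong by blast

lemma smooth_on_subset: "smooth_on S f \<Longrightarrow> T \<subseteq> S \<Longrightarrow> smooth_on T f"
  unfolding smooth_on_def using Ck_on_subset by blast

lemma smooth_on_local:
  assumes "\<And>x. x \<in> S \<Longrightarrow> \<exists>T. open T \<and> x \<in> T \<and> smooth_on T f"
  shows "smooth_on S f"
  unfolding smooth_on_def
proof
  fix k show "Ck_on S k f"
    by (rule Ck_on_local) (use assms[unfolded smooth_on_def] in blast)
qed

lemma smooth_on_const: "smooth_on S (\<lambda>x. c)"
  by (simp add: smooth_on_def Ck_on_const)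

lemma smooth_on_ident: "smooth_on S (\<lambda>x. x)"
  by (simp add: smooth_on_def Ck_on_linear_id)

lemma smooth_on_linear:
  "open S \<Longrightarrow> bounded_linear h \<Longrightarrow> smooth_on S f \<Longrightarrow> smooth_on S (\<lambda>x. h (f x))"
  by (simp add: smooth_on_def Ck_on_linear)

lemma smooth_on_add:
  "open S \<Longrightarrow> smooth_on S f \<Longrightarrow> smooth_on S g \<Longrightarrow> smooth_on S (\<lambda>x. f x + g x)"
  by (simp add: smooth_on_def Ck_on_add)

lemma smooth_on_minus: "open S \<Longrightarrow> smooth_on S f \<Longrightarrow> smooth_on S (\<lambda>x. - f x)"
  using smooth_on_linear[OF _ bounded_linear_minus[OF bounded_linear_ident]] .

lemma smooth_on_diff:
  "open S \<Longrightarrow> smooth_on S f \<Longrightarrow> smooth_on S g \<Longrightarrow> smooth_on S (\<lambda>x. f x - g x)"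
  using smooth_on_add[of S f "\<lambda>x. - g x"] smooth_on_minus[of S g] by simp

lemma smooth_on_sum:
  "open S \<Longrightarrow> (\<And>i. i \<in> A \<Longrightarrow> smooth_on S (f i)) \<Longrightarrow> smooth_on S (\<lambda>x. \<Sum>i\<in>A. f i x)"
  by (simp add: smooth_on_def Ck_on_sum)

lemma smooth_on_scaleR:
  "open S \<Longrightarrow> smooth_on S f \<Longrightarrow> smooth_on S g \<Longrightarrow> smooth_on S (\<lambda>x. f x *\<^sub>R g x)"
  by (simp add: smooth_on_def Ck_on_bilinear[OF _ bounded_bilinear_scaleR])

lemma smooth_on_mult:
  fixes f g :: "_ \<Rightarrow> real"
  shows "open S \<Longrightarrow> smooth_on S f \<Longrightarrow> smooth_on S g \<Longrightarrow> smooth_on S (\<lambda>x. f x * g x)"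
  by (simp add: smooth_on_def Ck_on_bilinear[OF _ bounded_bilinear_mult])

lemma smooth_on_inner:
  "open S \<Longrightarrow> smooth_on S f \<Longrightarrow> smooth_on S g \<Longrightarrow> smooth_on S (\<lambda>x. f x \<bullet> g x)"
  by (simp add: smooth_on_def Ck_on_bilinear[OF _ bounded_bilinear_inner])

lemma smooth_on_inverse:
  fixes f :: "_ \<Rightarrow> real"
  shows "open S \<Longrightarrow> smooth_on S f \<Longrightarrow> (\<And>x. x \<in> S \<Longrightarrow> f x \<noteq> 0) \<Longrightarrow> smooth_on S (\<lambda>x. inverse (f x))"
  by (simp add: smooth_on_def Ck_on_inverse)

lemma smooth_on_divide:
  fixes f :: "_ \<Rightarrow> real"
  shows "open S \<Longrightarrow> smooth_on S f \<Longrightarrow> smooth_on S g \<Longrightarrow> (\<And>x. x \<in> S \<Longrightarrow> g x \<noteq> 0) \<Longrightarrow> smooth_on S (\<lambda>x. f x / g x)"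
  by (simp add: divide_inverse smooth_on_mult smooth_on_inverse)

lemma smooth_on_prod:
  fixes f :: "'i \<Rightarrow> _ \<Rightarrow> real"
  assumes "open S" "\<And>i. i \<in> A \<Longrightarrow> smooth_on S (f i)"
  shows "smooth_on S (\<lambda>x. \<Prod>i\<in>A. f i x)"
  using assms(2)
  by (induction A rule: infinite_finite_induct) (auto intro: smooth_on_const smooth_on_mult assms(1))

lemma smooth_on_compose:
  fixes f :: "'a::real_normed_vector \<Rightarrow> 'b::euclidean_space"
  assumes "open S" "open T" "smooth_on S f" "smooth_on T g" "\<And>x. x \<in> S \<Longrightarrow> f x \<in> T"
  shows "smooth_on S (\<lambda>x. g (f x))"
  using assms unfolding smooth_on_def by (blast intro: Ck_on_compose)

lemma smooth_on_differentiable: "smooth_on S f \<Longrightarrow> x \<in> S \<Longrightarrow> f differentiable (at x)"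
  unfolding smooth_on_def by (meson Ck_on.simps(2))

lemma smooth_on_has_derivative:
  "smooth_on S f \<Longrightarrow> x \<in> S \<Longrightarrow> (f has_derivative (\<lambda>v. fderiv f x v)) (at x)"
  by (simp add: has_frechet_derivative smooth_on_differentiable)

lemma smooth_on_continuous: "smooth_on S f \<Longrightarrow> continuous_on S f"
  using Ck_on.simps(1)[of S f] unfolding smooth_on_def by blast

lemma smooth_on_linear_derivative: "smooth_on S f \<Longrightarrow> x \<in> S \<Longrightarrow> linear (fderiv f x)"
  by (simp add: smooth_on_differentiable linear_frechet_derivative)

lemma smooth_on_frechet_derivative:
  "smooth_on S f \<Longrightarrow> smooth_on S (\<lambda>x. fderiv f x v)"
proof -
  assume "smooth_on S f"
  then have "Ck_on S (Suc k) f" for k unfolding smooth_on_def by blast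
  then show ?thesis unfolding smooth_on_def by simp
qed

lemma smooth_on_componentwise:
  fixes f :: "'a::real_normed_vector \<Rightarrow> 'b::euclidean_space"
  assumes "open S" "\<And>b. b \<in> Basis \<Longrightarrow> smooth_on S (\<lambda>x. f x \<bullet> b)"
  shows "smooth_on S f"
proof -
  have "smooth_on S (\<lambda>x. \<Sum>b\<in>Basis. (f x \<bullet> b) *\<^sub>R b)"
    by (intro smooth_on_sum smooth_on_scaleR assms smooth_on_const)
  then show ?thesis by (simp add: euclidean_representation)
qed

lemma smooth_on_vec:
  fixes f :: "'a::real_normed_vector \<Rightarrow> 'b::euclidean_space ^ 'n"
  assumes "open S" "\<And>i. smooth_on S (\<lambda>x. f x $ i)"
  shows "smooth_on S f"
proof (rule smooth_on_componentwise[OF assms(1)])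
  fix b :: "'b ^ 'n" assume "b \<in> Basis"
  then obtain i u where "b = axis i u" "u \<in> Basis" by (auto simp: Basis_vec_def)
  then show "smooth_on S (\<lambda>x. f x \<bullet> b)"
    by (simp add: inner_axis smooth_on_inner assms smooth_on_const)
qed

lemma smooth_on_nth: "open S \<Longrightarrow> smooth_on S f \<Longrightarrow> smooth_on S (\<lambda>x. f x $ i)"
  using smooth_on_linear[OF _ bounded_linear_vec_nth] .

text \<open>Expansion in the basis reduces a moving argument to finitely many fixed ones. In this
  way differentials, the coordinate matrices of \<open>J a\<close>, left inverses and conormals are
  applied to smooth fields.\<close>

lemma smooth_on_linear_family:
  fixes h :: "'a::real_normed_vector \<Rightarrow> 'b::euclidean_space \<Rightarrow> 'c::real_normed_vector"
  assumes "open S" "\<And>x. x \<in> S \<Longrightarrow> linear (h x)" "\<And>b. b \<in> Basis \<Longrightarrow> smooth_on S (\<lambda>x. h x b)" "smooth_on S g"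
  shows "smooth_on S (\<lambda>x. h x (g x))"
proof -
  have "smooth_on S (\<lambda>x. \<Sum>b\<in>Basis. (g x \<bullet> b) *\<^sub>R h x b)"
    by (intro smooth_on_sum smooth_on_scaleR smooth_on_inner smooth_on_const assms)
  moreover have "h x (g x) = (\<Sum>b\<in>Basis. (g x \<bullet> b) *\<^sub>R h x b)" if "x \<in> S" for x
    using linear_Basis_expansion[OF assms(2)[OF that]] .
  ultimately show ?thesis
    using smooth_on_cong[OF assms(1), of "\<lambda>x. h x (g x)" "\<lambda>x. \<Sum>b\<in>Basis. (g x \<bullet> b) *\<^sub>R h x b"] by blast
qed

lemma smooth_on_derivative_compose:
  fixes f :: "'b::euclidean_space \<Rightarrow> 'c::real_normed_vector" and h :: "'a::real_normed_vector \<Rightarrow> 'b"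
  assumes "open S" "open T" "smooth_on T f" "smooth_on S h" "\<And>x. x \<in> S \<Longrightarrow> h x \<in> T" "smooth_on S g"
  shows "smooth_on S (\<lambda>x. fderiv f (h x) (g x))"
proof (rule smooth_on_linear_family[OF assms(1) _ _ assms(6)])
  show "linear (fderiv f (h x))" if "x \<in> S" for x
    using smooth_on_linear_derivative assms(3,5) that by blast
  show "smooth_on S (\<lambda>x. fderiv f (h x) b)" for b
    by (rule smooth_on_compose[OF assms(1,2,4) smooth_on_frechet_derivative[OF assms(3)] assms(5)])
qed

text \<open>The Leibniz rule for evaluation, the first term having its argument frozen at
  \<open>g x\<close>. After expansion in the basis it is the product rule for a scalar times a
  vector, so \<open>h\<close> need not be treated as a map into a space of linear maps.\<close>

lemma frechet_derivative_linear_family: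
  fixes h :: "'a::real_normed_vector \<Rightarrow> 'b::euclidean_space \<Rightarrow> 'c::real_normed_vector"
  assumes "open S" "x \<in> S" "\<And>y. y \<in> S \<Longrightarrow> linear (h y)" "\<And>b. b \<in> Basis \<Longrightarrow> smooth_on S (\<lambda>y. h y b)" "smooth_on S g"
  shows "fderiv (\<lambda>y. h y (g y)) x v =
    fderiv (\<lambda>y. h y (g x)) x v + h x (fderiv g x v)"
proof -
  have lin: "linear (h y)" if "y \<in> S" for y using assms(3) that .
  have eq: "h y (k y) = (\<Sum>b\<in>Basis. (k y \<bullet> b) *\<^sub>R h y b)" if "y \<in> S" for y k
    using linear_Basis_expansion[OF lin[OF that]] .
  let ?h' = "\<lambda>b v. fderiv (\<lambda>y. h y b) x v" and ?g' = "\<lambda>v. fderiv g x v"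
  have h': "((\<lambda>y. h y b) has_derivative ?h' b) (at x)" if "b \<in> Basis" for b
    using smooth_on_has_derivative[OF assms(4)[OF that] assms(2)] .
  have g': "(g has_derivative ?g') (at x)"
    using smooth_on_has_derivative[OF assms(5,2)] .
  have 1: "((\<lambda>y. \<Sum>b\<in>Basis. (g y \<bullet> b) *\<^sub>R h y b) has_derivative
      (\<lambda>v. \<Sum>b\<in>Basis. (g x \<bullet> b) *\<^sub>R ?h' b v + (?g' v \<bullet> b) *\<^sub>R h x b)) (at x)"
    by (intro has_derivative_sum has_derivative_scaleR h' has_derivative_inner_left g')
  have 2: "((\<lambda>y. \<Sum>b\<in>Basis. (g x \<bullet> b) *\<^sub>R h y b) has_derivative
      (\<lambda>v. \<Sum>b\<in>Basis. (g x \<bullet> b) *\<^sub>R ?h' b v)) (at x)"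
    by (intro has_derivative_sum has_derivative_scaleR_right h')
  have "fderiv (\<lambda>y. h y (g y)) x v =
      (\<Sum>b\<in>Basis. (g x \<bullet> b) *\<^sub>R ?h' b v + (?g' v \<bullet> b) *\<^sub>R h x b)"
    by (simp add: frechet_derivative_cong_open[OF assms(1,2) eq[of _ g]] frechet_derivative_at[OF 1, symmetric])
  moreover have "fderiv (\<lambda>y. h y (g x)) x v = (\<Sum>b\<in>Basis. (g x \<bullet> b) *\<^sub>R ?h' b v)"
    by (simp add: frechet_derivative_cong_open[OF assms(1,2) eq[of _ "\<lambda>_. g x"]] frechet_derivative_at[OF 2, symmetric])
  ultimately show ?thesis
    using linear_Basis_expansion[OF lin[OF assms(2)], of "?g' v"] by (simp add: sum.distrib)
qed

text \<open>The mean value theorem is applied twice: in direction \<open>u\<close> to the increment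
  of \<open>f\<close> by \<open>s *\<^sub>R v\<close>, then in direction \<open>v\<close> to the
  derivative along \<open>u\<close>. The second difference on the left is symmetric in
  \<open>u\<close> and \<open>v\<close>, which the right-hand side does not show.\<close>

lemma second_difference_mean_value:
  fixes f :: "'a::real_normed_vector \<Rightarrow> real"
  assumes "Ck_on S 2 f" "s > 0"
    and "\<And>\<alpha> \<beta>. 0 \<le> \<alpha> \<Longrightarrow> \<alpha> \<le> s \<Longrightarrow> 0 \<le> \<beta> \<Longrightarrow> \<beta> \<le> s \<Longrightarrow> x + \<alpha> *\<^sub>R u + \<beta> *\<^sub>R v \<in> S"
  shows "\<exists>\<alpha> \<beta>. 0 \<le> \<alpha> \<and> \<alpha> \<le> s \<and> 0 \<le> \<beta> \<and> \<beta> \<le> s \<and>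
    f (x + s *\<^sub>R u + s *\<^sub>R v) - f (x + s *\<^sub>R u) - f (x + s *\<^sub>R v) + f x =
    s * s * fderiv (\<lambda>y. fderiv f y u) (x + \<alpha> *\<^sub>R u + \<beta> *\<^sub>R v) v"
proof -
  have line: "((\<lambda>t. g (a + t *\<^sub>R w)) has_real_derivative fderiv g (a + t *\<^sub>R w) w) (at t)"
    if "g differentiable (at (a + t *\<^sub>R w))" for g :: "'a \<Rightarrow> real" and a w t
  proof -
    have "((\<lambda>t. a + t *\<^sub>R w) has_derivative (\<lambda>r. r *\<^sub>R w)) (at t)"
      by (auto intro!: derivative_eq_intros)
    from diff_chain_at[OF this has_frechet_derivative[OF that]]
    have "((\<lambda>t. g (a + t *\<^sub>R w)) has_derivative (\<lambda>r. fderiv g (a + t *\<^sub>R w) (r *\<^sub>R w))) (at t)"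
      by (simp add: o_def)
    then show ?thesis
      using linear_scale[OF linear_frechet_derivative[OF that]]
      unfolding has_field_derivative_def
      by (elim has_derivative_eq_rhs) (auto simp: mult.commute)
  qed
  have d1: "f differentiable (at y)" if "y \<in> S" for y
    using assms(1) that by (simp add: numeral_2_eq_2)
  have d2: "(\<lambda>y. fderiv f y u) differentiable (at y)" if "y \<in> S" for y
    using assms(1) that by (simp add: numeral_2_eq_2)
  let ?g = "\<lambda>t. f ((x + s *\<^sub>R v) + t *\<^sub>R u) - f (x + t *\<^sub>R u)"
  let ?g' = "\<lambda>t. fderiv f ((x + s *\<^sub>R v) + t *\<^sub>R u) u - fderiv f (x + t *\<^sub>R u) u"
  have "(?g has_real_derivative ?g' t) (at t)" if "0 \<le> t" "t \<le> s" for t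
  proof (intro DERIV_diff line d1)
    show "x + s *\<^sub>R v + t *\<^sub>R u \<in> S" using assms(3)[of t s] that assms(2) by (simp add: algebra_simps)
    show "x + t *\<^sub>R u \<in> S" using assms(3)[of t 0] that assms(2) by simp
  qed
  from MVT2[OF assms(2) this] obtain \<alpha> where \<alpha>: "0 < \<alpha>" "\<alpha> < s" "?g s - ?g 0 = (s - 0) * ?g' \<alpha>"
    by blast
  let ?k = "\<lambda>t. fderiv f ((x + \<alpha> *\<^sub>R u) + t *\<^sub>R v) u"
  let ?k' = "\<lambda>t. fderiv (\<lambda>y. fderiv f y u) ((x + \<alpha> *\<^sub>R u) + t *\<^sub>R v) v"
  have "(?k has_real_derivative ?k' t) (at t)" if "0 \<le> t" "t \<le> s" for t
    by (rule line, rule d2, rule assms(3)) (use that \<alpha> in auto)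
  from MVT2[OF assms(2) this] obtain \<beta> where \<beta>: "0 < \<beta>" "\<beta> < s" "?k s - ?k 0 = (s - 0) * ?k' \<beta>"
    by blast
  have "?g' \<alpha> = ?k s - ?k 0" by (simp add: algebra_simps)
  then have "?g s - ?g 0 = s * s * ?k' \<beta>" using \<alpha>(3) \<beta>(3) by simp
  moreover have "?g s - ?g 0 = f (x + s *\<^sub>R u + s *\<^sub>R v) - f (x + s *\<^sub>R u) - f (x + s *\<^sub>R v) + f x"
    by (simp add: algebra_simps)
  ultimately show ?thesis using \<alpha> \<beta> by (metis less_imp_le)
qed

text \<open>The same second difference equals \<open>s * s\<close> times either mixed derivative,
  each at some point close to \<open>x\<close>. By continuity the two values at \<open>x\<close>
  cannot differ.\<close>

lemma symmetric_second_derivative_real: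
  fixes f :: "'a::real_normed_vector \<Rightarrow> real"
  assumes "open S" "Ck_on S 2 f" "x \<in> S"
  shows "fderiv (\<lambda>y. fderiv f y u) x v =
    fderiv (\<lambda>y. fderiv f y v) x u" (is "?h x = ?k x")
proof (rule ccontr)
  assume ne: "?h x \<noteq> ?k x"
  have cont: "isCont (\<lambda>y. fderiv (\<lambda>y. fderiv f y u) y v) x" for u v
    using assms by (auto simp: numeral_2_eq_2 continuous_on_eq_continuous_at)
  \<comment> \<open>Half the gap: two errors below \<open>e\<close> already contradict it.\<close>
  define e where "e = \<bar>?h x - ?k x\<bar> / 2"
  have "e > 0" using ne by (simp add: e_def)
  obtain d1 where d1: "d1 > 0" "\<And>y. dist y x < d1 \<Longrightarrow> dist (?h y) (?h x) < e"
    using cont[of u v] \<open>e > 0\<close> unfolding continuous_at_eps_delta by blast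
  obtain d2 where d2: "d2 > 0" "\<And>y. dist y x < d2 \<Longrightarrow> dist (?k y) (?k x) < e"
    using cont[of v u] \<open>e > 0\<close> unfolding continuous_at_eps_delta by blast
  obtain d3 where d3: "d3 > 0" "ball x d3 \<subseteq> S" using assms(1,3) openE by blast
  define d where "d = min d1 (min d2 d3)"
  have "d > 0" using d1 d2 d3 by (simp add: d_def)
  \<comment> \<open>With this side length the whole parallelogram spanned by
    \<open>s *\<^sub>R u\<close> and \<open>s *\<^sub>R v\<close> stays within distance
    \<open>d\<close> of \<open>x\<close>; the summand 1 covers the case that both vectors vanish,
    and the factor 2 makes the bound strict.\<close>
  define s where "s = d / (2 * (norm u + norm v + 1))"
  have n: "norm u + norm v + 1 > 0" by (simp add: add_nonneg_pos)
  have "s > 0" using \<open>d > 0\<close> n by (simp add: s_def)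
  have "s * (norm u + norm v) \<le> s * (norm u + norm v + 1)" using \<open>s > 0\<close> by simp
  also have "\<dots> = d / 2" using n by (simp add: s_def field_simps)
  also have "\<dots> < d" using \<open>d > 0\<close> by simp
  finally have sd: "s * (norm u + norm v) < d" .
  have near: "dist (x + \<alpha> *\<^sub>R u + \<beta> *\<^sub>R v) x < d"
    if "0 \<le> \<alpha>" "\<alpha> \<le> s" "0 \<le> \<beta>" "\<beta> \<le> s" for \<alpha> \<beta>
  proof -
    have "dist (x + \<alpha> *\<^sub>R u + \<beta> *\<^sub>R v) x = norm (\<alpha> *\<^sub>R u + \<beta> *\<^sub>R v)"
      by (simp add: dist_norm add.assoc)
    also have "\<dots> \<le> norm (\<alpha> *\<^sub>R u) + norm (\<beta> *\<^sub>R v)" by (rule norm_triangle_ineq)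
    also have "\<dots> \<le> s * norm u + s * norm v"
      using that by (auto intro!: add_mono mult_right_mono)
    also have "\<dots> < d" using sd by (simp add: algebra_simps)
    finally show ?thesis .
  qed
  have "x + \<alpha> *\<^sub>R u + \<beta> *\<^sub>R v \<in> S" if "0 \<le> \<alpha>" "\<alpha> \<le> s" "0 \<le> \<beta>" "\<beta> \<le> s" for \<alpha> \<beta>
    using near[OF that] d3(2) by (auto simp: d_def dist_commute)
  from second_difference_mean_value[OF assms(2) \<open>s > 0\<close>, of x u v, OF this]
  obtain \<alpha> \<beta> where 1: "0 \<le> \<alpha>" "\<alpha> \<le> s" "0 \<le> \<beta>" "\<beta> \<le> s"
    and e1: "f (x + s *\<^sub>R u + s *\<^sub>R v) - f (x + s *\<^sub>R u) - f (x + s *\<^sub>R v) + f x =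
      s * s * ?h (x + \<alpha> *\<^sub>R u + \<beta> *\<^sub>R v)" by blast
  have near': "dist (x + \<alpha> *\<^sub>R v + \<beta> *\<^sub>R u) x < d"
    if "0 \<le> \<alpha>" "\<alpha> \<le> s" "0 \<le> \<beta>" "\<beta> \<le> s" for \<alpha> \<beta>
    using near[OF that(3,4,1,2)] by (simp add: algebra_simps)
  have "x + \<alpha> *\<^sub>R v + \<beta> *\<^sub>R u \<in> S" if "0 \<le> \<alpha>" "\<alpha> \<le> s" "0 \<le> \<beta>" "\<beta> \<le> s" for \<alpha> \<beta>
    using near'[OF that] d3(2) by (auto simp: d_def dist_commute)
  from second_difference_mean_value[OF assms(2) \<open>s > 0\<close>, of x v u, OF this]
  obtain \<alpha>' \<beta>' where 2: "0 \<le> \<alpha>'" "\<alpha>' \<le> s" "0 \<le> \<beta>'" "\<beta>' \<le> s"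
    and e2: "f (x + s *\<^sub>R v + s *\<^sub>R u) - f (x + s *\<^sub>R v) - f (x + s *\<^sub>R u) + f x =
      s * s * ?k (x + \<alpha>' *\<^sub>R v + \<beta>' *\<^sub>R u)" by blast
  have "s * s * ?h (x + \<alpha> *\<^sub>R u + \<beta> *\<^sub>R v) = s * s * ?k (x + \<alpha>' *\<^sub>R v + \<beta>' *\<^sub>R u)"
  proof -
    have sw: "x + s *\<^sub>R v + s *\<^sub>R u = x + s *\<^sub>R u + s *\<^sub>R v" by simp
    show ?thesis unfolding e1[symmetric] e2[symmetric] sw by simp
  qed
  then have "?h (x + \<alpha> *\<^sub>R u + \<beta> *\<^sub>R v) = ?k (x + \<alpha>' *\<^sub>R v + \<beta>' *\<^sub>R u)"
    using \<open>s > 0\<close> by simp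
  moreover have "dist (?h (x + \<alpha> *\<^sub>R u + \<beta> *\<^sub>R v)) (?h x) < e"
    using d1(2) near[OF 1] by (simp add: d_def)
  moreover have "dist (?k (x + \<alpha>' *\<^sub>R v + \<beta>' *\<^sub>R u)) (?k x) < e"
    using d2(2) near'[OF 2] by (simp add: d_def)
  ultimately have "\<bar>?h x - ?k x\<bar> < e + e" unfolding dist_real_def by linarith
  then show False by (simp add: e_def)
qed

lemma symmetric_second_derivative:
  fixes f :: "'a::real_normed_vector \<Rightarrow> 'b::euclidean_space"
  assumes "open S" "smooth_on S f" "x \<in> S"
  shows "fderiv (\<lambda>y. fderiv f y u) x v =
    fderiv (\<lambda>y. fderiv f y v) x u"
proof (rule euclidean_eqI)
  fix b :: 'b assume "b \<in> Basis"
  have comp: "fderiv (\<lambda>y. g y \<bullet> b) y w = fderiv g y w \<bullet> b"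
    if "smooth_on S g" "y \<in> S" for g :: "'a \<Rightarrow> 'b" and y w
    using frechet_derivative_at[OF has_derivative_inner_left[OF smooth_on_has_derivative[OF that], of b]]
    by metis
  have fb: "smooth_on S (\<lambda>y. f y \<bullet> b)"
    by (intro smooth_on_inner assms smooth_on_const)
  have eq: "fderiv (\<lambda>y. fderiv f y u) x v \<bullet> b =
      fderiv (\<lambda>y. fderiv (\<lambda>z. f z \<bullet> b) y u) x v" for u v
    using comp[OF smooth_on_frechet_derivative[OF assms(2)] assms(3), of u v]
      frechet_derivative_cong_open[OF assms(1,3), of "\<lambda>y. fderiv (\<lambda>z. f z \<bullet> b) y u"
        "\<lambda>y. fderiv f y u \<bullet> b"] comp[OF assms(2)] by simp
  show "fderiv (\<lambda>y. fderiv f y u) x v \<bullet> b =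
    fderiv (\<lambda>y. fderiv f y v) x u \<bullet> b"
    unfolding eq
    by (rule symmetric_second_derivative_real[OF assms(1) _ assms(3)]) (use fb smooth_on_def in blast)
qed

text \<open>The pushforward of a coordinate bracket: the second derivatives of \<open>\<phi>\<close> cancel by symmetry.\<close>

lemma bracket_pushforward:
  fixes \<phi> :: "'a::euclidean_space \<Rightarrow> 'b::euclidean_space"
  assumes "open S" "x \<in> S" "smooth_on S \<phi>" "smooth_on S X" "smooth_on S Y"
  shows "fderiv (\<lambda>y. fderiv \<phi> y (Y y)) x (X x)
      - fderiv (\<lambda>y. fderiv \<phi> y (X y)) x (Y x)
    = fderiv \<phi> x (fderiv Y x (X x) - fderiv X x (Y x))"
proof -
  have lin: "linear (fderiv \<phi> y)" if "y \<in> S" for y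
    using smooth_on_linear_derivative[OF assms(3) that] .
  have fam: "fderiv (\<lambda>y. fderiv \<phi> y (g y)) x v =
      fderiv (\<lambda>y. fderiv \<phi> y (g x)) x v
      + fderiv \<phi> x (fderiv g x v)"
    if "smooth_on S g" for g v
    by (rule frechet_derivative_linear_family[OF assms(1,2)])
      (use lin smooth_on_frechet_derivative[OF assms(3)] that in auto)
  show ?thesis
    unfolding fam[OF assms(4)] fam[OF assms(5)] linear_diff[OF lin[OF assms(2)]]
    using symmetric_second_derivative[OF assms(1,3,2), of "Y x" "X x"] by simp
qed

section \<open>Determinants and inverses of smooth matrix families\<close>

lemma smooth_on_det:
  fixes A :: "'a::real_normed_vector \<Rightarrow> real^'n^'n"
  assumes "open S" "\<And>i j. smooth_on S (\<lambda>x. A x $ i $ j)"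
  shows "smooth_on S (\<lambda>x. det (A x))"
  unfolding det_def
  by (intro smooth_on_sum smooth_on_mult smooth_on_prod smooth_on_const assms)

lemma matrix_mul_matrix_inv:
  fixes A :: "real^'n^'n"
  assumes "det A \<noteq> 0"
  shows "A *v (matrix_inv A *v w) = w" "matrix_inv A *v (A *v w) = w"
proof -
  have "\<exists>A'. A ** A' = mat 1 \<and> A' ** A = mat 1"
    using assms by (simp add: invertible_det_nz[symmetric] invertible_def)
  then have "A ** matrix_inv A = mat 1 \<and> matrix_inv A ** A = mat 1"
    unfolding matrix_inv_def by (rule someI_ex)
  then show "A *v (matrix_inv A *v w) = w" "matrix_inv A *v (A *v w) = w"
    by (simp_all add: matrix_vector_mul_assoc)
qed

text \<open>Cramer's rule expresses the solution of a linear system by quotients of determinants;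
  \<open>?B x k\<close> is \<open>A x\<close> with its \<open>k\<close>-th column replaced by
  \<open>w\<close>.\<close>

lemma smooth_on_matrix_inv:
  fixes A :: "'a::real_normed_vector \<Rightarrow> real^'n^'n"
  assumes "open S" "\<And>i j. smooth_on S (\<lambda>x. A x $ i $ j)" "\<And>x. x \<in> S \<Longrightarrow> det (A x) \<noteq> 0"
  shows "smooth_on S (\<lambda>x. matrix_inv (A x) *v w)"
proof -
  let ?B = "\<lambda>x k. (\<chi> i j. if j = k then w $ i else A x $ i $ j) :: real^'n^'n"
  have "smooth_on S (\<lambda>x. det (?B x k) / det (A x))" for k
  proof (intro smooth_on_divide smooth_on_det assms)
    show "smooth_on S (\<lambda>x. ?B x k $ i $ j)" for i j
      by (cases "j = k") (simp_all add: smooth_on_const assms)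
  qed
  then have "smooth_on S (\<lambda>x. (\<chi> k. det (?B x k) / det (A x)))"
    by (intro smooth_on_vec assms) simp
  moreover have "matrix_inv (A x) *v w = (\<chi> k. det (?B x k) / det (A x))" if "x \<in> S" for x
    using cramer[OF assms(3)[OF that]] matrix_mul_matrix_inv(1)[OF assms(3)[OF that]] by blast
  ultimately show ?thesis
    using smooth_on_cong[OF assms(1), of "\<lambda>x. matrix_inv (A x) *v w"
      "\<lambda>x. (\<chi> k. det (?B x k) / det (A x))"] by blast
qed

section \<open>Charts, tangent vectors and vector fields\<close>

text \<open>The two charts may belong to different manifolds on the same point type, so one term
  serves for changes of charts and for the inclusion of \<open>M\<close> into \<open>N\<close> in
  coordinates.\<close>

definition transition :: "('p, 'e) chart \<Rightarrow> ('p, 'f) chart \<Rightarrow> 'e \<Rightarrow> 'f" where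
  "transition c d = snd d \<circ> chart_inv c"

lemma scaleR_fun_apply [simp]: "(r *\<^sub>R f) x = r *\<^sub>R f x"
  by (simp add: scaleR_fun_def)

lemma sum_fun_apply: "(\<Sum>b\<in>S. f b) x = (\<Sum>b\<in>S. f b x)"
  by (induction S rule: infinite_finite_induct) simp_all

text \<open>The tangent vector at \<open>p\<close> with coordinates \<open>u\<close> in the chart
  \<open>c\<close>. It inverts evaluation at \<open>c\<close> and so moves between families of
  coordinate expressions and the model space; the value 0 on other charts is what
  \<open>tangent_space\<close> prescribes.\<close>

definition lift :: "('p, 'e::euclidean_space) manifold \<Rightarrow> ('p, 'e) chart \<Rightarrow> 'p \<Rightarrow> 'e \<Rightarrow> ('p, 'e) tvec" where
  "lift M c p u = (\<lambda>d. if d \<in> charts M \<and> p \<in> fst d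
     then fderiv (transition c d) (snd c p) u else 0)"

text \<open>Stated for bare charts because it is used in three situations: all charts on one
  manifold, two on \<open>M\<close> followed by one on \<open>N\<close>, and one on \<open>M\<close>
  followed by two on \<open>N\<close>.\<close>

lemma transition_chain:
  assumes "open (snd c ` A)" "p \<in> A"
    and inv: "\<And>q. q \<in> A \<Longrightarrow> chart_inv c (snd c q) = q" "\<And>q. q \<in> A \<Longrightarrow> chart_inv d (snd d q) = q"
    and f: "(transition c d has_derivative f) (at (snd c p))"
    and g: "(transition d e has_derivative g) (at (snd d p))"
  shows "fderiv (transition c e) (snd c p) u = g (f u)"
proof -
  have x: "transition c d (snd c p) = snd d p" using inv assms(2) by (simp add: transition_def)
  have "(transition d e \<circ> transition c d has_derivative g \<circ> f) (at (snd c p))"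
    by (rule diff_chain_at[OF f]) (simp add: x g)
  then have "fderiv (transition d e \<circ> transition c d) (snd c p) = g \<circ> f"
    using frechet_derivative_at by metis
  moreover have "fderiv (transition d e \<circ> transition c d) (snd c p) =
      fderiv (transition c e) (snd c p)"
    by (rule frechet_derivative_cong_open[OF assms(1)]) (use assms(2) inv in \<open>auto simp: transition_def\<close>)
  ultimately show ?thesis by (metis comp_apply)
qed

section \<open>Charts and their transition maps\<close>

locale mfd =
  fixes M :: "('p, 'e::euclidean_space) manifold"
  assumes smooth_manifold: "smooth_manifold M"
begin

lemma openin_chart: "c \<in> charts M \<Longrightarrow> openin (mtop M) (fst c)"
  and open_chart: "c \<in> charts M \<Longrightarrow> open (snd c ` fst c)"
  and homeomorphic_chart: "c \<in> charts M \<Longrightarrow>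
    homeomorphic_map (subtopology (mtop M) (fst c)) (top_of_set (snd c ` fst c)) (snd c)"
  and smooth_transition: "c \<in> charts M \<Longrightarrow> d \<in> charts M \<Longrightarrow>
    smooth_on (snd c ` (fst c \<inter> fst d)) (transition c d)"
  using smooth_manifold by (auto simp: smooth_manifold_def transition_def)

lemma topspace_sub: "c \<in> charts M \<Longrightarrow> topspace (subtopology (mtop M) (fst c)) = fst c"
  using openin_subset[OF openin_chart[of c]] by (simp add: Int_absorb1)

lemma inj_chart: "c \<in> charts M \<Longrightarrow> inj_on (snd c) (fst c)"
  using homeomorphic_imp_injective_map[OF homeomorphic_chart] topspace_sub by fastforce

lemma chart_inv_chart [simp]: "c \<in> charts M \<Longrightarrow> p \<in> fst c \<Longrightarrow> chart_inv c (snd c p) = p"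
  by (simp add: chart_inv_def inv_into_f_f inj_chart)

lemma chart_chart_inv [simp]: "x \<in> snd c ` fst c \<Longrightarrow> snd c (chart_inv c x) = x"
  by (simp add: chart_inv_def f_inv_into_f)

lemma chart_inv_in: "x \<in> snd c ` fst c \<Longrightarrow> chart_inv c x \<in> fst c"
  by (simp add: chart_inv_def inv_into_into)

lemma open_chart_image:
  assumes "c \<in> charts M" "openin (mtop M) W"
  shows "open (snd c ` (fst c \<inter> W))"
proof -
  have "openin (subtopology (mtop M) (fst c)) (fst c \<inter> W)"
    using assms(2) by (metis inf_commute openin_subtopology)
  then have "openin (top_of_set (snd c ` fst c)) (snd c ` (fst c \<inter> W))"
    using homeomorphic_imp_open_map[OF homeomorphic_chart[OF assms(1)]] by (simp add: open_map_def)
  then show ?thesis using open_chart[OF assms(1)] openin_open_trans by blast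
qed

lemma openin_chart_preimage:
  assumes "c \<in> charts M" "open A"
  shows "openin (mtop M) {p \<in> fst c. snd c p \<in> A}"
proof -
  have "openin (top_of_set (snd c ` fst c)) (snd c ` fst c \<inter> A)"
    using assms(2) by auto
  then have "openin (subtopology (mtop M) (fst c)) {p \<in> fst c. snd c p \<in> snd c ` fst c \<inter> A}"
    using openin_continuous_map_preimage[OF homeomorphic_imp_continuous_map[OF homeomorphic_chart[OF assms(1)]]]
      topspace_sub[OF assms(1)] by fastforce
  moreover have "{p \<in> fst c. snd c p \<in> snd c ` fst c \<inter> A} = {p \<in> fst c. snd c p \<in> A}" by auto
  ultimately show ?thesis using openin_chart[OF assms(1)] openin_trans_full by metis
qed

lemma chart_image_mem: "c \<in> charts M \<Longrightarrow> x \<in> snd c ` (fst c \<inter> W) \<longleftrightarrow> x \<in> snd c ` fst c \<and> chart_inv c x \<in> W"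
  using inj_chart by (auto simp: chart_inv_in intro: rev_image_eqI)

lemma open_transition: "c \<in> charts M \<Longrightarrow> d \<in> charts M \<Longrightarrow> open (snd c ` (fst c \<inter> fst d))"
  by (simp add: open_chart_image openin_chart)

lemma transition_apply: "c \<in> charts M \<Longrightarrow> p \<in> fst c \<Longrightarrow> transition c d (snd c p) = snd d p"
  by (simp add: transition_def)

abbreviation "Dtr c d p \<equiv> fderiv (transition c d) (snd c p)"

lemma transition_has_derivative:
  assumes "c \<in> charts M" "d \<in> charts M" "p \<in> fst c" "p \<in> fst d"
  shows "(transition c d has_derivative (\<lambda>u. Dtr c d p u)) (at (snd c p))"
  by (rule smooth_on_has_derivative[OF smooth_transition[OF assms(1,2)]]) (use assms in auto)

lemma linear_Dtr:
  assumes "c \<in> charts M" "d \<in> charts M" "p \<in> fst c" "p \<in> fst d"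
  shows "linear (Dtr c d p)"
  by (rule smooth_on_linear_derivative[OF smooth_transition[OF assms(1,2)]]) (use assms in auto)

lemma Dtr_self [simp]:
  assumes "c \<in> charts M" "p \<in> fst c"
  shows "Dtr c c p u = u"
proof -
  have "Dtr c c p = fderiv (\<lambda>x. x) (snd c p)"
    by (rule frechet_derivative_cong_open[OF open_chart[OF assms(1)]])
      (use assms in \<open>auto simp: transition_def\<close>)
  then show ?thesis by simp
qed

lemma Dtr_cocycle:
  assumes "c \<in> charts M" "d \<in> charts M" "e \<in> charts M" "p \<in> fst c" "p \<in> fst d" "p \<in> fst e"
  shows "Dtr d e p (Dtr c d p u) = Dtr c e p u"
proof (rule transition_chain[OF _ _ _ _ transition_has_derivative[OF assms(1,2,4,5)]
      transition_has_derivative[OF assms(2,3,5,6)], symmetric])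
  show "open (snd c ` (fst c \<inter> (fst d \<inter> fst e)))" using assms by (intro open_chart_image openin_Int openin_chart)
qed (use assms in auto)

section \<open>Tangent vectors and vector fields in coordinates\<close>

lemma tangent_space_iff:
  "v \<in> tangent_space M p \<longleftrightarrow>
     (\<forall>c\<in>charts M. \<forall>d\<in>charts M. p \<in> fst c \<longrightarrow> p \<in> fst d \<longrightarrow> v d = Dtr c d p (v c)) \<and>
     (\<forall>c. c \<notin> charts M \<or> p \<notin> fst c \<longrightarrow> v c = 0)"
  unfolding tangent_space_def transition_def by auto

lemma tangent_transform:
  "v \<in> tangent_space M p \<Longrightarrow> c \<in> charts M \<Longrightarrow> d \<in> charts M \<Longrightarrow> p \<in> fst c \<Longrightarrow> p \<in> fst d \<Longrightarrow>
    Dtr c d p (v c) = v d"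
  unfolding tangent_space_iff by metis

lemma lift_in:
  "c \<in> charts M \<Longrightarrow> p \<in> fst c \<Longrightarrow> lift M c p u \<in> tangent_space M p"
  unfolding tangent_space_iff lift_def by (auto simp: Dtr_cocycle)

lemma lift_at [simp]: "c \<in> charts M \<Longrightarrow> p \<in> fst c \<Longrightarrow> lift M c p u c = u"
  by (simp add: lift_def)

lemma lift_eq [simp]:
  assumes "c \<in> charts M" "p \<in> fst c" "v \<in> tangent_space M p"
  shows "lift M c p (v c) = v"
proof
  fix d show "lift M c p (v c) d = v d"
    using assms tangent_transform[OF assms(3,1), of d]
    unfolding tangent_space_iff lift_def by metis
qed

lemma linear_lift: "c \<in> charts M \<Longrightarrow> p \<in> fst c \<Longrightarrow> linear (lift M c p)"
proof (rule linearI)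
  assume c: "c \<in> charts M" "p \<in> fst c"
  note l = linear_Dtr[OF c(1) _ c(2)]
  show "lift M c p (u + v) = lift M c p u + lift M c p v" for u v
    by (auto simp: lift_def fun_eq_iff linear_add[OF l])
  show "lift M c p (r *\<^sub>R v) = r *\<^sub>R lift M c p v" for r v
    by (auto simp: lift_def fun_eq_iff scaleR_fun_def linear_scale[OF l])
qed

lemma tangent_eq_range_lift: "c \<in> charts M \<Longrightarrow> p \<in> fst c \<Longrightarrow> tangent_space M p = range (lift M c p)"
  using lift_in[of c p] lift_eq[of c p] by (metis (no_types, opaque_lifting) image_subset_iff rangeI subsetI subset_antisym)

lemma exists_chart: "p \<in> topspace (mtop M) \<Longrightarrow> \<exists>c\<in>charts M. p \<in> fst c"
  using smooth_manifold by (auto simp: smooth_manifold_def)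

lemma chart_at: "p \<in> topspace (mtop M) \<Longrightarrow> chart_at M p \<in> charts M \<and> p \<in> fst (chart_at M p)"
  using someI_ex[of "\<lambda>c. c \<in> charts M \<and> p \<in> fst c"] exists_chart[of p] unfolding chart_at_def by blast

lemma subspace_tangent:
  assumes "p \<in> topspace (mtop M)" shows "subspace (tangent_space M p)"
  using chart_at[OF assms] tangent_eq_range_lift linear_subspace_image[OF linear_lift subspace_UNIV] by metis

text \<open>Smoothness may be tested in one chart around each point: in any other chart the field is
  the differential of a transition map applied to this expression, both composed with the reverse
  transition.\<close>

lemma vector_fieldI:
  assumes W: "openin (mtop M) W" and tan: "\<And>p. p \<in> W \<Longrightarrow> X p \<in> tangent_space M p"
    and loc: "\<And>p. p \<in> W \<Longrightarrow> \<exists>c A. c \<in> charts M \<and> p \<in> fst c \<and> open A \<and> snd c p \<in> A \<and> smooth_on A (local_rep c X)"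
  shows "X \<in> vector_fields M W"
proof -
  have "smooth_on (snd d ` (fst d \<inter> W)) (local_rep d X)" if d: "d \<in> charts M" for d
  proof (rule smooth_on_local)
    fix y assume y: "y \<in> snd d ` (fst d \<inter> W)"
    define p where "p = chart_inv d y"
    have p: "p \<in> W" "p \<in> fst d" "y = snd d p"
      using y d by (auto simp: p_def)
    from loc[OF p(1)] obtain c A where c: "c \<in> charts M" "p \<in> fst c" "open A" "snd c p \<in> A"
      "smooth_on A (local_rep c X)" by blast
    define V where "V = {q \<in> fst c. snd c q \<in> A} \<inter> W"
    have V: "openin (mtop M) V" unfolding V_def using openin_chart_preimage[OF c(1,3)] W by blast
    define B where "B = snd d ` (fst d \<inter> V)"
    have B: "open B" "y \<in> B" using open_chart_image[OF d V] p c by (auto simp: B_def V_def)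
    have Binfo: "y \<in> B \<Longrightarrow> chart_inv d y \<in> fst d \<inter> fst c \<inter> W \<and> snd c (chart_inv d y) \<in> A \<and> snd d (chart_inv d y) = y" for y
      using d by (auto simp: B_def V_def)
    have s1: "smooth_on B (transition d c)"
      by (rule smooth_on_subset[OF smooth_transition[OF d c(1)]]) (auto simp: B_def V_def)
    have s2: "smooth_on B (\<lambda>y. local_rep c X (transition d c y))"
      by (rule smooth_on_compose[OF B(1) c(3) s1 c(5)]) (use Binfo in \<open>auto simp: transition_def\<close>)
    have s3: "smooth_on B (\<lambda>y. fderiv (transition c d) (transition d c y) (local_rep c X (transition d c y)))"
    proof (rule smooth_on_derivative_compose[OF B(1) open_transition[OF c(1) d] smooth_transition[OF c(1) d] s1 _ s2])
      fix y assume "y \<in> B"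
      then show "transition d c y \<in> snd c ` (fst c \<inter> fst d)" using Binfo by (auto simp: transition_def)
    qed
    have eq: "local_rep d X y = fderiv (transition c d) (transition d c y) (local_rep c X (transition d c y))" if "y \<in> B" for y
      using Binfo[OF that] tangent_transform[OF tan c(1) d, of "chart_inv d y"] c(1) d
      by (simp add: local_rep_def transition_def)
    have "smooth_on B (local_rep d X)"
      using s3 smooth_on_cong[OF B(1), of "local_rep d X", OF eq] by blast
    then show "\<exists>T. open T \<and> y \<in> T \<and> smooth_on T (local_rep d X)" using B by blast
  qed
  then show ?thesis using tan by (simp add: vector_fields_def)
qed

lemma vector_field_tangent: "X \<in> vector_fields M W \<Longrightarrow> p \<in> W \<Longrightarrow> X p \<in> tangent_space M p"
  and vector_field_smooth: "X \<in> vector_fields M W \<Longrightarrow> c \<in> charts M \<Longrightarrow> smooth_on (snd c ` (fst c \<inter> W)) (local_rep c X)"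
  by (auto simp: vector_fields_def)

lemma local_rep_apply [simp]: "c \<in> charts M \<Longrightarrow> p \<in> fst c \<Longrightarrow> local_rep c X (snd c p) = X p c"
  by (simp add: local_rep_def)

lemma vector_field_lift:
  assumes c: "c \<in> charts M" and A: "open A" and g: "smooth_on A g"
    and W: "openin (mtop M) W" "W \<subseteq> fst c" "snd c ` W \<subseteq> A"
  shows "(\<lambda>p. lift M c p (g (snd c p))) \<in> vector_fields M W"
proof (rule vector_fieldI[OF W(1)])
  fix p assume p: "p \<in> W"
  then show "lift M c p (g (snd c p)) \<in> tangent_space M p" using W c by (auto intro: lift_in)
  let ?B = "snd c ` (fst c \<inter> W)"
  have B: "open ?B" by (rule open_chart_image[OF c W(1)])
  have "local_rep c (\<lambda>p. lift M c p (g (snd c p))) x = g x" if "x \<in> ?B" for x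
    using that c by (auto simp: local_rep_def)
  moreover have "smooth_on ?B g" by (rule smooth_on_subset[OF g]) (use W in auto)
  ultimately have "smooth_on ?B (local_rep c (\<lambda>p. lift M c p (g (snd c p))))"
    using smooth_on_cong[OF B] by blast
  then show "\<exists>d A. d \<in> charts M \<and> p \<in> fst d \<and> open A \<and> snd d p \<in> A \<and>
      smooth_on A (local_rep d (\<lambda>p. lift M c p (g (snd c p))))"
    using B p W c by blast
qed

lemma openin_topspace_fst: "c \<in> charts M \<Longrightarrow> p \<in> fst c \<Longrightarrow> p \<in> topspace (mtop M)"
  using openin_chart openin_subset by blast

lemma vector_field_add:
  assumes "openin (mtop M) W" "X \<in> vector_fields M W" "Y \<in> vector_fields M W"
  shows "X + Y \<in> vector_fields M W"
proof -
  have "(X + Y) p \<in> tangent_space M p" if "p \<in> W" for p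
    using that assms openin_subset[OF assms(1)] subspace_add[OF subspace_tangent]
    by (auto simp: vector_field_tangent)
  moreover have "smooth_on (snd c ` (fst c \<inter> W)) (local_rep c (X + Y))" if "c \<in> charts M" for c
  proof -
    have "local_rep c (X + Y) = (\<lambda>x. local_rep c X x + local_rep c Y x)"
      by (simp add: local_rep_def fun_eq_iff)
    then show ?thesis
      using that by (simp add: smooth_on_add open_chart_image assms vector_field_smooth)
  qed
  ultimately show ?thesis by (simp add: vector_fields_def)
qed

lemma vector_field_scale:
  assumes "openin (mtop M) W" "X \<in> vector_fields M W" "smooth_fun M W f"
  shows "(\<lambda>p. f p *\<^sub>R X p) \<in> vector_fields M W"
proof -
  have "f p *\<^sub>R X p \<in> tangent_space M p" if "p \<in> W" for p
    using that assms openin_subset[OF assms(1)] subspace_scale[OF subspace_tangent]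
    by (auto simp: vector_field_tangent)
  moreover have "smooth_on (snd c ` (fst c \<inter> W)) (local_rep c (\<lambda>p. f p *\<^sub>R X p))" if "c \<in> charts M" for c
  proof -
    have "local_rep c (\<lambda>p. f p *\<^sub>R X p) = (\<lambda>x. (f \<circ> chart_inv c) x *\<^sub>R local_rep c X x)"
      by (simp add: local_rep_def fun_eq_iff scaleR_fun_def)
    then show ?thesis
      using that assms(3) smooth_on_scaleR[OF open_chart_image[OF that assms(1)] _ vector_field_smooth[OF assms(2) that], of "f \<circ> chart_inv c"]
      unfolding smooth_fun_def by metis
  qed
  ultimately show ?thesis by (simp add: vector_fields_def)
qed

lemma smooth_fun_const: "smooth_fun M W (\<lambda>p. k)"
  by (simp add: smooth_fun_def o_def smooth_on_const)

lemma vector_field_diff: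
  assumes "openin (mtop M) W" "X \<in> vector_fields M W" "Y \<in> vector_fields M W"
  shows "X - Y \<in> vector_fields M W"
proof -
  have "X - Y = X + (\<lambda>p. (-1) *\<^sub>R Y p)" by (simp add: fun_eq_iff)
  then show ?thesis
    using vector_field_add[OF assms(1,2) vector_field_scale[OF assms(1,3) smooth_fun_const]] by metis
qed

lemma smooth_funI:
  fixes f :: "'p \<Rightarrow> 'b::real_normed_vector"
  assumes W: "openin (mtop M) W"
    and loc: "\<And>p. p \<in> W \<Longrightarrow> \<exists>c A. c \<in> charts M \<and> p \<in> fst c \<and> open A \<and> snd c p \<in> A \<and> smooth_on A (f \<circ> chart_inv c)"
  shows "smooth_fun M W f"
  unfolding smooth_fun_def
proof (intro ballI smooth_on_local)
  fix d y assume d: "d \<in> charts M" and y: "y \<in> snd d ` (fst d \<inter> W)"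
  define p where "p = chart_inv d y"
  have p: "p \<in> W" "p \<in> fst d" "y = snd d p" using y d by (auto simp: p_def)
  from loc[OF p(1)] obtain c A where c: "c \<in> charts M" "p \<in> fst c" "open A" "snd c p \<in> A"
    "smooth_on A (f \<circ> chart_inv c)" by blast
  define V where "V = {q \<in> fst c. snd c q \<in> A}"
  have V: "openin (mtop M) V" unfolding V_def by (rule openin_chart_preimage[OF c(1,3)])
  define B where "B = snd d ` (fst d \<inter> V)"
  have B: "open B" "y \<in> B" using open_chart_image[OF d V] p c by (auto simp: B_def V_def)
  have Binfo: "y \<in> B \<Longrightarrow> chart_inv d y \<in> fst d \<inter> fst c \<and> snd c (chart_inv d y) \<in> A" for y
    using d by (auto simp: B_def V_def)
  have s1: "smooth_on B (transition d c)"
    by (rule smooth_on_subset[OF smooth_transition[OF d c(1)]]) (auto simp: B_def V_def)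
  have "smooth_on B (\<lambda>y. (f \<circ> chart_inv c) (transition d c y))"
    by (rule smooth_on_compose[OF B(1) c(3) s1 c(5)]) (use Binfo in \<open>auto simp: transition_def\<close>)
  moreover have "(f \<circ> chart_inv c) (transition d c y) = (f \<circ> chart_inv d) y" if "y \<in> B" for y
    using Binfo[OF that] c(1) by (simp add: transition_def)
  ultimately have "smooth_on B (f \<circ> chart_inv d)"
    using smooth_on_cong[OF B(1), of "f \<circ> chart_inv d" "\<lambda>y. (f \<circ> chart_inv c) (transition d c y)"] by simp
  then show "\<exists>T. open T \<and> y \<in> T \<and> smooth_on T (f \<circ> chart_inv d)" using B by blast
qed

lemma local_rep_transition:
  assumes "c \<in> charts M" "d \<in> charts M" "X \<in> vector_fields M W" "x \<in> snd c ` (fst c \<inter> (fst d \<inter> W))"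
  shows "local_rep d X (transition c d x) = fderiv (transition c d) x (local_rep c X x)"
proof -
  obtain q where q: "q \<in> fst c" "q \<in> fst d" "q \<in> W" "x = snd c q" using assms(4) by auto
  then show ?thesis
    using tangent_transform[OF vector_field_tangent[OF assms(3)] assms(1,2), of q] assms(1,2)
    by (simp add: transition_apply)
qed

text \<open>The expressions of a field in two charts are related by the transition map, and
  \<open>bracket_pushforward\<close> says that brackets respect such a relation. Hence the
  coordinate formula transforms like a tangent vector.\<close>

lemma lie_bracket_in_vector_fields:
  assumes W: "openin (mtop M) W" and X: "X \<in> vector_fields M W" and Y: "Y \<in> vector_fields M W"
  shows "lie_bracket M X Y \<in> vector_fields M W"
proof -
  have "lie_bracket M X Y p \<in> tangent_space M p" if p: "p \<in> W" for p
    unfolding tangent_space_iff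
  proof (intro conjI ballI impI)
    fix c d assume c: "c \<in> charts M" "p \<in> fst c" and d: "d \<in> charts M" "p \<in> fst d"
    let ?A = "snd c ` (fst c \<inter> (fst d \<inter> W))" and ?B = "snd d ` (fst d \<inter> W)"
    let ?\<phi> = "transition c d" and ?x = "snd c p"
    have A: "open ?A" by (intro open_chart_image openin_Int openin_chart c d W)
    have x: "?x \<in> ?A" using c d p by auto
    have \<phi>: "smooth_on ?A ?\<phi>" by (rule smooth_on_subset[OF smooth_transition[OF c(1) d(1)]]) auto
    have sm: "smooth_on ?A (local_rep c Z)" if "Z \<in> vector_fields M W" for Z
      by (rule smooth_on_subset[OF vector_field_smooth[OF that c(1)]]) auto
    \<comment> \<open>The chain rule: differentiating the pushed field in the chart \<open>c\<close>
      along \<open>u\<close> is differentiating its expression in \<open>d\<close> along the pushed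
      vector.\<close>
    have der: "fderiv (\<lambda>y. fderiv ?\<phi> y (local_rep c Z y)) ?x u =
        fderiv (local_rep d Z) (snd d p) (Dtr c d p u)" if Z: "Z \<in> vector_fields M W" for Z u
    proof -
      have "(local_rep d Z has_derivative (\<lambda>u. fderiv (local_rep d Z) (?\<phi> ?x) u)) (at (?\<phi> ?x))"
        by (rule smooth_on_has_derivative[OF vector_field_smooth[OF Z d(1)]])
          (use c d p in \<open>auto simp: transition_apply\<close>)
      from diff_chain_at[OF smooth_on_has_derivative[OF \<phi> x] this]
      have "fderiv (\<lambda>y. local_rep d Z (?\<phi> y)) ?x =
          (\<lambda>u. fderiv (local_rep d Z) (snd d p) (Dtr c d p u))"
        using frechet_derivative_at c by (fastforce simp: o_def transition_apply)
      moreover have "fderiv (\<lambda>y. local_rep d Z (?\<phi> y)) ?x =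
          fderiv (\<lambda>y. fderiv ?\<phi> y (local_rep c Z y)) ?x"
        by (rule frechet_derivative_cong_open[OF A x]) (rule local_rep_transition[OF c(1) d(1) Z])
      ultimately show ?thesis by metis
    qed
    show "lie_bracket M X Y p d = Dtr c d p (lie_bracket M X Y p c)"
      using bracket_pushforward[OF A x \<phi> sm[OF X] sm[OF Y]] c d
        tangent_transform[OF vector_field_tangent[OF X p] c(1) d(1) c(2) d(2)]
        tangent_transform[OF vector_field_tangent[OF Y p] c(1) d(1) c(2) d(2)]
      by (simp add: lie_bracket_def der[OF X] der[OF Y])
  qed (auto simp: lie_bracket_def)
  moreover have "smooth_on (snd c ` (fst c \<inter> W)) (local_rep c (lie_bracket M X Y))" if c: "c \<in> charts M" for c
  proof -
    let ?B = "snd c ` (fst c \<inter> W)"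
    have B: "open ?B" by (rule open_chart_image[OF c W])
    have "smooth_on ?B (\<lambda>x. fderiv (local_rep c Y) x (local_rep c X x)
        - fderiv (local_rep c X) x (local_rep c Y x))"
      by (intro smooth_on_diff[OF B] smooth_on_derivative_compose[OF B B _ smooth_on_ident])
        (auto intro: vector_field_smooth X Y c)
    moreover have "local_rep c (lie_bracket M X Y) x = fderiv (local_rep c Y) x (local_rep c X x)
        - fderiv (local_rep c X) x (local_rep c Y x)" if "x \<in> ?B" for x
      using that c by (auto simp: lie_bracket_def local_rep_def)
    ultimately show ?thesis using smooth_on_cong[OF B] by (metis (no_types, lifting))
  qed
  ultimately show ?thesis by (simp add: vector_fields_def)
qed

end

section \<open>Hyperplanes in quaternionic vector spaces\<close>

lemma mod3_simps: "(4::3) = 1" "(5::3) = 2" "(1::3) + 1 = 2" "(1::3) + 2 = 3" "(2::3) + 1 = 3"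
    "(2::3) + 2 = 1" "(3::3) + 1 = 1" "(3::3) + 2 = 2"
  by simp_all

lemma mod3_distinct: "(1::3) \<noteq> 2" "(2::3) \<noteq> 3" "(3::3) \<noteq> 1" "(2::3) \<noteq> 1" "(3::3) \<noteq> 2" "(1::3) \<noteq> 3"
  by simp_all

lemma linear_on_simps:
  assumes "linear_on V f" "subspace V" "u \<in> V"
  shows "v \<in> V \<Longrightarrow> f (u + v) = f u + f v" "f (r *\<^sub>R u) = r *\<^sub>R f u" "f (- u) = - f u"
    "v \<in> V \<Longrightarrow> f (u - v) = f u - f v"
proof -
  show add: "f (u + v) = f u + f v" if "v \<in> V" for v using assms that by (auto simp: linear_on_def)
  have scale: "f (r *\<^sub>R u) = r *\<^sub>R f u" if "u \<in> V" for r u using assms(1) that by (auto simp: linear_on_def)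
  then show "f (r *\<^sub>R u) = r *\<^sub>R f u" using assms(3) by blast
  have neg: "f (- u) = - f u" if "u \<in> V" for u using scale[OF that, of "-1"] by simp
  then show "f (- u) = - f u" using assms(3) by blast
  show "f (u - v) = f u - f v" if "v \<in> V" for v
    using add[of "- v"] neg[OF that] subspace_neg[OF assms(2) that] by simp
qed

text \<open>The tangent space \<open>T\<close> of the hypersurface is mapped by \<open>\<iota>\<close> onto the kernel of \<open>\<xi>\<close> in the
  quaternionic vector space \<open>E\<close>; \<open>Q\<close> and \<open>I\<close> are the induced structures at a point.\<close>

locale quat_hyperplane =
  fixes T :: "'b::real_vector set" and \<iota> :: "'b \<Rightarrow> 'a::real_vector" and E :: "'a set"
    and J :: "3 \<Rightarrow> 'a \<Rightarrow> 'a" and \<xi> :: "'a \<Rightarrow> real"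
  assumes subspace_T: "subspace T" and subspace_E: "subspace E"
    and lin_\<iota>: "linear_on T \<iota>" and inj_\<iota>: "inj_on \<iota> T" and image_\<iota>: "\<iota> ` T = {e \<in> E. \<xi> e = 0}"
    and lin_\<xi>: "linear_on E \<xi>" and \<xi>_nonzero: "\<exists>e\<in>E. \<xi> e \<noteq> 0"
    and lin_J: "linear_on E (J a)" and J_in [simp]: "e \<in> E \<Longrightarrow> J a e \<in> E"
    and J_J [simp]: "e \<in> E \<Longrightarrow> J a (J a e) = - e"
    and J_cyclic: "e \<in> E \<Longrightarrow> J a (J (a + 1) e) = J (a + 2) e"
    and J_anticyclic: "e \<in> E \<Longrightarrow> J (a + 1) (J a e) = - J (a + 2) e"
begin

section \<open>The induced subspaces and complex structures at a point\<close>

definition "Q a = {v \<in> T. \<iota> v \<in> \<iota> ` T \<inter> J a ` \<iota> ` T}"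
definition "I a v = inv_into T \<iota> (J a (\<iota> v))"

lemma T_closed [simp]:
  "0 \<in> T" "u \<in> T \<Longrightarrow> v \<in> T \<Longrightarrow> u + v \<in> T" "u \<in> T \<Longrightarrow> v \<in> T \<Longrightarrow> u - v \<in> T"
  "u \<in> T \<Longrightarrow> r *\<^sub>R u \<in> T" "u \<in> T \<Longrightarrow> - u \<in> T"
  using subspace_T by (auto simp: subspace_0 subspace_add subspace_diff subspace_scale subspace_neg)

lemma E_closed [simp]:
  "0 \<in> E" "u \<in> E \<Longrightarrow> v \<in> E \<Longrightarrow> u + v \<in> E" "u \<in> E \<Longrightarrow> v \<in> E \<Longrightarrow> u - v \<in> E"
  "u \<in> E \<Longrightarrow> r *\<^sub>R u \<in> E" "u \<in> E \<Longrightarrow> - u \<in> E"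
  using subspace_E by (auto simp: subspace_0 subspace_add subspace_diff subspace_scale subspace_neg)

lemmas \<iota>_simps [simp] = linear_on_simps[OF lin_\<iota> subspace_T]
lemmas \<xi>_simps [simp] = linear_on_simps[OF lin_\<xi> subspace_E]
lemmas J_simps [simp] = linear_on_simps[OF lin_J subspace_E]

lemma \<iota>_in [simp]: "v \<in> T \<Longrightarrow> \<iota> v \<in> E" and \<xi>_\<iota> [simp]: "v \<in> T \<Longrightarrow> \<xi> (\<iota> v) = 0"
  using image_\<iota> by blast+

lemma \<iota>_eq_iff [simp]: "u \<in> T \<Longrightarrow> v \<in> T \<Longrightarrow> \<iota> u = \<iota> v \<longleftrightarrow> u = v"
  using inj_\<iota> by (auto simp: inj_on_def)

lemma T_eqI: "u \<in> T \<Longrightarrow> v \<in> T \<Longrightarrow> \<iota> u = \<iota> v \<Longrightarrow> u = v"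
  by simp

definition "\<kappa> = inv_into T \<iota>"

lemma \<kappa>_in: "e \<in> E \<Longrightarrow> \<xi> e = 0 \<Longrightarrow> \<kappa> e \<in> T" and \<iota>_\<kappa>: "e \<in> E \<Longrightarrow> \<xi> e = 0 \<Longrightarrow> \<iota> (\<kappa> e) = e"
  using inv_into_into[of e \<iota> T] f_inv_into_f[of e \<iota> T] image_\<iota> by (auto simp: \<kappa>_def)

lemma \<kappa>_\<iota> [simp]: "v \<in> T \<Longrightarrow> \<kappa> (\<iota> v) = v"
  by (simp add: \<kappa>_def inv_into_f_f inj_\<iota>)

lemma J_table [simp]:
  assumes "e \<in> E"
  shows "J 1 (J 2 e) = J 3 e" "J 2 (J 3 e) = J 1 e" "J 3 (J 1 e) = J 2 e"
    "J 2 (J 1 e) = - J 3 e" "J 3 (J 2 e) = - J 1 e" "J 1 (J 3 e) = - J 2 e"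
  using J_cyclic[OF assms, of 1] J_cyclic[OF assms, of 2] J_cyclic[OF assms, of 3]
    J_anticyclic[OF assms, of 1] J_anticyclic[OF assms, of 2] J_anticyclic[OF assms, of 3]
  by (simp_all add: mod3_simps)

text \<open>As \<open>J a\<close> squares to -1, the vector \<open>\<iota> v\<close> is the image
  under \<open>J a\<close> of a tangent vector exactly if \<open>J a (\<iota> v)\<close> is tangent,
  that is, killed by \<open>\<xi>\<close>. All later pointwise arguments use this linear
  condition.\<close>

lemma Q_iff: "v \<in> Q a \<longleftrightarrow> v \<in> T \<and> \<xi> (J a (\<iota> v)) = 0"
proof
  assume "v \<in> Q a"
  then obtain u where "v \<in> T" "u \<in> T" "\<iota> v = J a (\<iota> u)" by (auto simp: Q_def)
  then show "v \<in> T \<and> \<xi> (J a (\<iota> v)) = 0" by simp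
next
  assume v: "v \<in> T \<and> \<xi> (J a (\<iota> v)) = 0"
  then have "- J a (\<iota> v) \<in> \<iota> ` T" unfolding image_\<iota> by simp
  moreover have "\<iota> v = J a (- J a (\<iota> v))" using v by simp
  ultimately have "\<iota> v \<in> J a ` \<iota> ` T" by (rule rev_image_eqI)
  then show "v \<in> Q a" using v by (simp add: Q_def)
qed

lemma I_in: "v \<in> Q a \<Longrightarrow> I a v \<in> T" and \<iota>_I [simp]: "v \<in> Q a \<Longrightarrow> \<iota> (I a v) = J a (\<iota> v)"
  using \<kappa>_in[of "J a (\<iota> v)"] \<iota>_\<kappa>[of "J a (\<iota> v)"] by (auto simp: I_def Q_iff \<kappa>_def)

lemma Qint_iff: "v \<in> Q 1 \<inter> Q 2 \<inter> Q 3 \<longleftrightarrow> v \<in> T \<and> (\<forall>a. \<xi> (J a (\<iota> v)) = 0)"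
  unfolding forall_3 by (auto simp: Q_iff)

lemma linear_on_I: "linear_on (Q a) (I a)"
  unfolding linear_on_def
proof (intro conjI ballI allI)
  fix u v r assume uv: "u \<in> Q a" "v \<in> Q a"
  then have T: "u \<in> T" "v \<in> T" and sum: "u + v \<in> Q a" by (auto simp: Q_iff)
  show "I a (u + v) = I a u + I a v"
    by (rule T_eqI) (use uv T sum I_in in simp_all)
next
  fix v r assume v: "v \<in> Q a"
  then have T: "v \<in> T" and s: "r *\<^sub>R v \<in> Q a" by (auto simp: Q_iff)
  show "I a (r *\<^sub>R v) = r *\<^sub>R I a v"
    by (rule T_eqI) (use v T s I_in in simp_all)
qed

lemma I_in_Q: "v \<in> Q a \<Longrightarrow> I a v \<in> Q a"
  using I_in[of v a] \<iota>_I[of v a] by (auto simp: Q_iff)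

lemma I_I: "v \<in> Q a \<Longrightarrow> I a (I a v) = - v"
proof -
  assume v: "v \<in> Q a"
  then have "\<iota> (I a (I a v)) = \<iota> (- v)" using I_in_Q[OF v] by (simp add: Q_iff)
  moreover have "I a (I a v) \<in> T" "v \<in> T" using I_in[OF I_in_Q[OF v]] v by (auto simp: Q_iff)
  ultimately show ?thesis by (metis T_closed(5) \<iota>_eq_iff)
qed

text \<open>As a quaternion, \<open>\<xi> - (\<xi> \<circ> J 1) i - (\<xi> \<circ> J 2) j - (\<xi> \<circ> J 3) k\<close> depends \<open>\<H>\<close>-linearly on the
  vector; multiplying the vector by the conjugate of its value makes the value real.\<close>

definition "normal e = \<xi> e *\<^sub>R e + (\<xi> (J 1 e) *\<^sub>R J 1 e + (\<xi> (J 2 e) *\<^sub>R J 2 e + \<xi> (J 3 e) *\<^sub>R J 3 e))"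

lemma normal:
  assumes e: "e \<in> E" "\<xi> e \<noteq> 0"
  shows "normal e \<in> E" "\<xi> (normal e) \<noteq> 0" "\<xi> (J a (normal e)) = 0"
proof -
  \<comment> \<open>The squared norm of the quaternionic value at \<open>e\<close>, positive because
    its first summand is. It is the value of \<open>\<xi>\<close> on \<open>normal e\<close>, while
    for each \<open>J a\<close> the four products cancel in pairs.\<close>
  define r where "r = (\<xi> e)\<^sup>2 + (\<xi> (J 1 e))\<^sup>2 + (\<xi> (J 2 e))\<^sup>2 + (\<xi> (J 3 e))\<^sup>2"
  have "r > 0" using e(2) unfolding r_def by (intro add_pos_nonneg) auto
  moreover have "\<xi> (normal e) = r" using e by (simp add: normal_def r_def power2_eq_square)
  ultimately show "\<xi> (normal e) \<noteq> 0" by simp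
  show "normal e \<in> E" using e by (simp add: normal_def)
  have "\<xi> (J 1 (normal e)) = 0" "\<xi> (J 2 (normal e)) = 0" "\<xi> (J 3 (normal e)) = 0"
    using e by (simp_all add: normal_def)
  then show "\<xi> (J a (normal e)) = 0" using exhaust_3[of a] by auto
qed

definition "admissible \<tau> \<longleftrightarrow>
  (\<forall>a. \<tau> a \<in> Q (a + 1) \<inter> Q (a + 2) \<and> \<tau> a \<notin> Q 1 \<inter> Q 2 \<inter> Q 3 \<and> I a (\<tau> (a + 1)) = \<tau> (a + 2))"

text \<open>For different \<open>a\<close> and \<open>b\<close> the vector
  \<open>J b (J a n)\<close> is up to sign the third \<open>J c n\<close>, which
  \<open>\<xi>\<close> kills; for \<open>a = b\<close> it is \<open>- n\<close>, which
  \<open>\<xi>\<close> does not kill. This decides every membership in the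
  \<open>Q b\<close>.\<close>

lemma admissible_normal:
  assumes n: "n \<in> E" "\<xi> n \<noteq> 0" "\<And>a. \<xi> (J a n) = 0"
    and \<tau>: "\<And>a. \<tau> a \<in> T" "\<And>a. \<iota> (\<tau> a) = - J a n"
  shows "admissible \<tau>"
proof -
  have I: "I a (\<tau> b) = \<tau> c" if "\<tau> b \<in> Q a" "J a (- J b n) = - J c n" for a b c
  proof -
    have "\<iota> (I a (\<tau> b)) = \<iota> (\<tau> c)" using that by (simp add: \<tau>)
    then show ?thesis using I_in[OF that(1)] \<tau>(1) by simp
  qed
  have Q: "\<tau> 1 \<in> Q 2" "\<tau> 1 \<in> Q 3" "\<tau> 2 \<in> Q 1" "\<tau> 2 \<in> Q 3" "\<tau> 3 \<in> Q 1" "\<tau> 3 \<in> Q 2"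
    "\<tau> 1 \<notin> Q 1" "\<tau> 2 \<notin> Q 2" "\<tau> 3 \<notin> Q 3"
    using n by (simp_all add: Q_iff \<tau>)
  show ?thesis
    unfolding admissible_def forall_3 mod3_simps
    using Q n by (auto intro!: I)
qed

lemma exists_admissible: "\<exists>\<tau>. admissible \<tau>"
proof -
  obtain n where n: "n \<in> E" "\<xi> n \<noteq> 0" "\<And>a. \<xi> (J a n) = 0" using \<xi>_nonzero normal by blast
  have "admissible (\<lambda>a. \<kappa> (- J a n))"
    by (rule admissible_normal[of n]) (use n in \<open>auto intro!: \<kappa>_in \<iota>_\<kappa>\<close>)
  then show ?thesis by blast
qed

text \<open>The relations \<open>I a (\<tau> (a + 1)) = \<tau> (a + 2)\<close> and the quaternion
  table force the three vectors \<open>J a (\<iota> (\<tau> a))\<close> to coincide. Hence every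
  admissible triple is, up to one common factor \<open>k\<close>, dual to the covectors
  \<open>\<xi> \<circ> J b\<close>; this is why the later descriptions are independent of the
  triple.\<close>

lemma admissible_dual:
  assumes "admissible \<tau>"
  obtains n k where "n \<in> E" "k \<noteq> 0" "\<And>a. J a (\<iota> (\<tau> a)) = n" "\<And>a. \<tau> a \<in> T"
    "\<And>a b. \<xi> (J b (\<iota> (\<tau> a))) = (if a = b then k else 0)"
proof -
  have Q: "\<tau> 1 \<in> Q 2" "\<tau> 1 \<in> Q 3" "\<tau> 2 \<in> Q 1" "\<tau> 2 \<in> Q 3" "\<tau> 3 \<in> Q 1" "\<tau> 3 \<in> Q 2"
    and nQ: "\<tau> 1 \<notin> Q 1" and I: "I 1 (\<tau> 2) = \<tau> 3" "I 2 (\<tau> 3) = \<tau> 1" "I 3 (\<tau> 1) = \<tau> 2"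
    using assms unfolding admissible_def forall_3 mod3_simps by auto
  have T: "\<tau> a \<in> T" for a using Q exhaust_3[of a] by (auto simp: Q_iff)
  have J: "J 1 (\<iota> (\<tau> 2)) = \<iota> (\<tau> 3)" "J 2 (\<iota> (\<tau> 3)) = \<iota> (\<tau> 1)" "J 3 (\<iota> (\<tau> 1)) = \<iota> (\<tau> 2)"
    using \<iota>_I Q I by metis+
  let ?n = "J 1 (\<iota> (\<tau> 1))"
  have 3: "J 3 (\<iota> (\<tau> 3)) = ?n" using J_table(1)[of "\<iota> (\<tau> 3)"] J(2) T by simp
  have 2: "J 2 (\<iota> (\<tau> 2)) = ?n" using J_table(3)[of "\<iota> (\<tau> 2)"] J(1) T 3 by simp
  show thesis
  proof (rule that[of ?n "\<xi> ?n"])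
    show "?n \<in> E" using T by simp
    show "\<xi> ?n \<noteq> 0" using nQ T by (simp add: Q_iff)
    show "J a (\<iota> (\<tau> a)) = ?n" for a using 2 3 exhaust_3[of a] by auto
    show "\<tau> a \<in> T" for a by (rule T)
    have "\<forall>a b. \<xi> (J b (\<iota> (\<tau> a))) = (if a = b then \<xi> ?n else 0)"
      unfolding forall_3 using Q 2 3 mod3_distinct by (simp add: Q_iff)
    then show "\<xi> (J b (\<iota> (\<tau> a))) = (if a = b then \<xi> ?n else 0)" for a b by blast
  qed
qed

text \<open>Ensures that the covector cutting out \<open>Q a\<close> in the tangent space is
  nonzero, so that the corank is one and not zero.\<close>

lemma Q_proper: "\<exists>v\<in>T. v \<notin> Q a"
proof -
  obtain \<tau> where "admissible \<tau>" using exists_admissible by blast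
  then obtain n k where k: "k \<noteq> 0" and T: "\<And>a. \<tau> a \<in> T"
    and d: "\<And>a b. \<xi> (J b (\<iota> (\<tau> a))) = (if a = b then k else 0)" by (rule admissible_dual) blast
  then have "\<tau> a \<notin> Q a" by (simp add: Q_iff)
  then show ?thesis using T by blast
qed

lemma Q1_plus_Q2: "{u + v | u v. u \<in> Q 1 \<and> v \<in> Q 2} = T"
proof
  show "{u + v | u v. u \<in> Q 1 \<and> v \<in> Q 2} \<subseteq> T" by (auto simp: Q_iff)
  obtain \<tau> where "admissible \<tau>" using exists_admissible by blast
  then obtain n k where k: "k \<noteq> 0" and T: "\<And>a. \<tau> a \<in> T"
    and d: "\<And>a b. \<xi> (J b (\<iota> (\<tau> a))) = (if a = b then k else 0)" by (rule admissible_dual) blast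
  show "T \<subseteq> {u + v | u v. u \<in> Q 1 \<and> v \<in> Q 2}"
  proof
    fix v assume v: "v \<in> T"
    \<comment> \<open>Subtracting this multiple of \<open>\<tau> 1\<close> removes the value of
      \<open>\<xi> \<circ> J 1\<close>, and \<open>\<tau> 1\<close> itself lies in
      \<open>Q 2\<close> and \<open>Q 3\<close>.\<close>
    let ?r = "(\<xi> (J 1 (\<iota> v)) / k) *\<^sub>R \<tau> 1"
    have "v - ?r \<in> Q 1" "?r \<in> Q 2" using v T d k by (simp_all add: Q_iff)
    moreover have "v = (v - ?r) + ?r" by simp
    ultimately show "v \<in> {u + v | u v. u \<in> Q 1 \<and> v \<in> Q 2}" by blast
  qed
qed

text \<open>Since \<open>J 3 (J 1 e) = J 2 e\<close>, the condition of \<open>Q 3\<close> on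
  \<open>I 1 v\<close> is the condition of \<open>Q 2\<close> on \<open>v\<close>. The images
  occurring in \<open>almost_hyper_CR\<close> thereby become intersections.\<close>

lemma I1_image: "I 1 ` (Q 1 \<inter> Q 2) = Q 1 \<inter> Q 3"
proof
  show "I 1 ` (Q 1 \<inter> Q 2) \<subseteq> Q 1 \<inter> Q 3"
  proof (rule image_subsetI)
    fix v assume v: "v \<in> Q 1 \<inter> Q 2"
    then show "I 1 v \<in> Q 1 \<inter> Q 3"
      using I_in[of v 1] I_in_Q[of v 1] by (simp add: Q_iff[of _ 3]) (simp add: Q_iff)
  qed
  show "Q 1 \<inter> Q 3 \<subseteq> I 1 ` (Q 1 \<inter> Q 2)"
  proof
    fix v assume v: "v \<in> Q 1 \<inter> Q 3"
    then have u: "- I 1 v \<in> Q 1 \<inter> Q 2" "v \<in> T"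
      using I_in[of v 1] I_in_Q[of v 1] by (auto simp: Q_iff)
    have "I 1 (- I 1 v) = v"
      by (rule T_eqI) (use u v I_in[of v 1] I_in[of "- I 1 v" 1] in simp_all)
    then show "v \<in> I 1 ` (Q 1 \<inter> Q 2)" using u(1) by (metis imageI)
  qed
qed

lemma I2_image: "I 2 ` (Q 1 \<inter> Q 2) = Q 2 \<inter> Q 3"
proof
  show "I 2 ` (Q 1 \<inter> Q 2) \<subseteq> Q 2 \<inter> Q 3"
  proof (rule image_subsetI)
    fix v assume v: "v \<in> Q 1 \<inter> Q 2"
    then show "I 2 v \<in> Q 2 \<inter> Q 3"
      using I_in[of v 2] I_in_Q[of v 2] by (simp add: Q_iff[of _ 3]) (simp add: Q_iff)
  qed
  show "Q 2 \<inter> Q 3 \<subseteq> I 2 ` (Q 1 \<inter> Q 2)"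
  proof
    fix v assume v: "v \<in> Q 2 \<inter> Q 3"
    then have u: "- I 2 v \<in> Q 1 \<inter> Q 2" "v \<in> T"
      using I_in[of v 2] I_in_Q[of v 2] by (auto simp: Q_iff)
    have "I 2 (- I 2 v) = v"
      by (rule T_eqI) (use u v I_in[of v 2] I_in[of "- I 2 v" 2] in simp_all)
    then show "v \<in> I 2 ` (Q 1 \<inter> Q 2)" using u(1) by (metis imageI)
  qed
qed

lemma Q3_eq: "Q 3 = {u + v | u v. u \<in> I 1 ` (Q 1 \<inter> Q 2) \<and> v \<in> I 2 ` (Q 1 \<inter> Q 2)}"
  unfolding I1_image I2_image
proof
  show "{u + v | u v. u \<in> Q 1 \<inter> Q 3 \<and> v \<in> Q 2 \<inter> Q 3} \<subseteq> Q 3" by (auto simp: Q_iff)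
  obtain \<tau> where "admissible \<tau>" using exists_admissible by blast
  then obtain n k where k: "k \<noteq> 0" and T: "\<And>a. \<tau> a \<in> T"
    and d: "\<And>a b. \<xi> (J b (\<iota> (\<tau> a))) = (if a = b then k else 0)" by (rule admissible_dual) blast
  show "Q 3 \<subseteq> {u + v | u v. u \<in> Q 1 \<inter> Q 3 \<and> v \<in> Q 2 \<inter> Q 3}"
  proof
    fix v assume v: "v \<in> Q 3"
    let ?r = "(\<xi> (J 1 (\<iota> v)) / k) *\<^sub>R \<tau> 1"
    have "v - ?r \<in> Q 1 \<inter> Q 3" "?r \<in> Q 2 \<inter> Q 3" using v T d k by (simp_all add: Q_iff)
    moreover have "v = (v - ?r) + ?r" by simp
    ultimately show "v \<in> {u + v | u v. u \<in> Q 1 \<inter> Q 3 \<and> v \<in> Q 2 \<inter> Q 3}" by blast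
  qed
qed

lemma I3_on_I1: "v \<in> Q 1 \<inter> Q 3 \<Longrightarrow> I 3 v = - I 2 (I 1 v)"
proof -
  assume v: "v \<in> Q 1 \<inter> Q 3"
  then have 1: "I 1 v \<in> Q 2" using I_in[of v 1] by (auto simp: Q_iff)
  have "\<iota> (I 3 v) = \<iota> (- I 2 (I 1 v))" using v 1 I_in[OF 1] by (simp add: Q_iff)
  then show ?thesis using I_in[OF 1] I_in[of v 3] v by (metis IntD2 T_closed(5) \<iota>_eq_iff)
qed

lemma I3_on_I2: "v \<in> Q 2 \<inter> Q 3 \<Longrightarrow> I 3 v = I 1 (I 2 v)"
proof -
  assume v: "v \<in> Q 2 \<inter> Q 3"
  then have 1: "I 2 v \<in> Q 1" using I_in[of v 2] by (auto simp: Q_iff)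
  have "\<iota> (I 3 v) = \<iota> (I 1 (I 2 v))" using v 1 I_in[OF 1] by (simp add: Q_iff)
  then show ?thesis using I_in[OF 1] I_in[of v 3] v by (metis IntD2 \<iota>_eq_iff)
qed

lemma I_anticommute: "v \<in> Q 1 \<inter> Q 2 \<inter> Q 3 \<Longrightarrow> I 1 (I 2 v) = - I 2 (I 1 v)"
  using I3_on_I1[of v] I3_on_I2[of v] by auto

text \<open>For a unit vector \<open>v\<close> this is to the complex structure
  \<open>\<Sum> v_a J_a\<close> what \<open>Q a\<close> is to \<open>J a\<close>; no admissible
  triple enters.\<close>

definition "QV v = {u \<in> T. (\<Sum>a\<in>UNIV. (v $ a) * \<xi> (J a (\<iota> u))) = 0}" for v :: "real^3"

lemma QV_eq: "QV v = {u \<in> T. \<xi> (\<Sum>a\<in>UNIV. (v $ a) *\<^sub>R J a (\<iota> u)) = 0}"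
  by (auto simp: QV_def sum_3)

lemma admissible_QV:
  assumes "admissible \<tau>"
  shows "{w + (\<Sum>a\<in>UNIV. (x $ a) *\<^sub>R \<tau> a) | w x. w \<in> Q 1 \<inter> Q 2 \<inter> Q 3 \<and> x \<bullet> v = 0} = QV v" (is "?L = _")
proof -
  obtain n k where k: "k \<noteq> 0" and T: "\<And>a. \<tau> a \<in> T"
    and d: "\<And>a b. \<xi> (J b (\<iota> (\<tau> a))) = (if a = b then k else 0)"
    using admissible_dual[OF assms] by metis
  note d' = d[of 1] d[of 2] d[of 3]
  show ?thesis
  proof
    show "?L \<subseteq> QV v"
    proof clarify
      fix w and x :: "real^3" assume w: "w \<in> Q 1" "w \<in> Q 2" "w \<in> Q 3" and xv: "x \<bullet> v = 0"
      have "\<xi> (J b (\<iota> (w + (\<Sum>a\<in>UNIV. (x $ a) *\<^sub>R \<tau> a)))) = x $ b * k" for b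
        using w T exhaust_3[of b] mod3_distinct by (auto simp: sum_3 Q_iff d')
      moreover have "(\<Sum>b\<in>UNIV. v $ b * (x $ b * k)) = k * (x \<bullet> v)"
        by (simp add: inner_vec_def sum_3 algebra_simps)
      moreover have "w + (\<Sum>a\<in>UNIV. (x $ a) *\<^sub>R \<tau> a) \<in> T" using w T by (simp add: sum_3 Q_iff)
      ultimately show "w + (\<Sum>a\<in>UNIV. (x $ a) *\<^sub>R \<tau> a) \<in> QV v" using xv by (simp add: QV_def)
    qed
    show "QV v \<subseteq> ?L"
    proof
      fix u assume u: "u \<in> QV v"
      then have uT: "u \<in> T" by (simp add: QV_def)
      \<comment> \<open>The components of \<open>u\<close> along the triple, read off by the dual
        covectors; after subtracting them, all \<open>\<xi> \<circ> J b\<close> vanish on the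
        remainder.\<close>
      define x :: "real^3" where "x = (\<chi> a. \<xi> (J a (\<iota> u)) / k)"
      let ?s = "\<Sum>a\<in>UNIV. (x $ a) *\<^sub>R \<tau> a"
      have sT: "?s \<in> T" using T by (simp add: sum_3)
      have s: "\<xi> (J b (\<iota> ?s)) = \<xi> (J b (\<iota> u))" for b
        using T k exhaust_3[of b] mod3_distinct by (auto simp: sum_3 d' x_def)
      have "u - ?s \<in> Q 1 \<inter> Q 2 \<inter> Q 3" unfolding Qint_iff using uT sT s by simp
      moreover have "x \<bullet> v = 0"
        using u k unfolding QV_def x_def inner_vec_def sum_3 by (simp add: field_simps)
      moreover have "u = (u - ?s) + ?s" by simp
      ultimately show "u \<in> ?L" by blast
    qed
  qed
qed

text \<open>Extending \<open>I a\<close> by zero along \<open>\<tau> a\<close> changes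
  \<open>J a (\<iota> u)\<close> by a multiple \<open>r a\<close> of
  \<open>n = J a (\<iota> (\<tau> a))\<close>. As \<open>n\<close> is the same for all
  \<open>a\<close>, the total error is \<open>\<Sum> v_a r_a\<close> times \<open>n\<close>, and
  this coefficient vanishes precisely by \<open>u \<in> QV v\<close>.\<close>

lemma admissible_IV:
  assumes "admissible \<tau>" "u \<in> QV v"
  shows "(\<Sum>a\<in>UNIV. (v $ a) *\<^sub>R extend_by_zero (Q a) (\<tau> a) (I a) u) = \<kappa> (\<Sum>a\<in>UNIV. (v $ a) *\<^sub>R J a (\<iota> u))"
proof -
  obtain n k where n: "n \<in> E" "\<And>a. J a (\<iota> (\<tau> a)) = n" and k: "k \<noteq> 0" and T: "\<And>a. \<tau> a \<in> T"
    and d: "\<And>a b. \<xi> (J b (\<iota> (\<tau> a))) = (if a = b then k else 0)"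
    using admissible_dual[OF assms(1)] by metis
  have u: "u \<in> T" using assms(2) by (simp add: QV_def)
  define r where "r a = \<xi> (J a (\<iota> u)) / k" for a
  have q: "u - r a *\<^sub>R \<tau> a \<in> Q a" for a
    using u T k by (simp add: Q_iff d r_def)
  have "(THE w. w \<in> Q a \<and> (\<exists>s. u = w + s *\<^sub>R \<tau> a)) = u - r a *\<^sub>R \<tau> a" for a
  proof (rule the_equality)
    show "u - r a *\<^sub>R \<tau> a \<in> Q a \<and> (\<exists>s. u = u - r a *\<^sub>R \<tau> a + s *\<^sub>R \<tau> a)"
      using q by (auto intro: exI[of _ "r a"])
    fix w assume "w \<in> Q a \<and> (\<exists>s. u = w + s *\<^sub>R \<tau> a)"
    then obtain s where w: "w \<in> T" "\<xi> (J a (\<iota> w)) = 0" "u = w + s *\<^sub>R \<tau> a" by (auto simp: Q_iff)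
    then have "r a = s" using T k by (simp add: r_def d)
    then show "w = u - r a *\<^sub>R \<tau> a" using w by simp
  qed
  then have ext: "extend_by_zero (Q a) (\<tau> a) (I a) u = I a (u - r a *\<^sub>R \<tau> a)" for a
    by (simp add: extend_by_zero_def)
  have iT: "I a (u - r a *\<^sub>R \<tau> a) \<in> T" for a by (rule I_in[OF q])
  have i: "\<iota> (I a (u - r a *\<^sub>R \<tau> a)) = J a (\<iota> u) - r a *\<^sub>R n" for a
    using \<iota>_I[OF q] u T n by simp
  have "(\<Sum>a\<in>UNIV. v $ a * r a) = (\<Sum>a\<in>UNIV. v $ a * \<xi> (J a (\<iota> u))) / k"
    by (simp add: r_def sum_divide_distrib)
  also have "\<dots> = 0" using assms(2) by (simp add: QV_def)
  finally have z: "(\<Sum>a\<in>UNIV. v $ a * r a) = 0" .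
  have "\<iota> (\<Sum>a\<in>UNIV. (v $ a) *\<^sub>R extend_by_zero (Q a) (\<tau> a) (I a) u) =
      (\<Sum>a\<in>UNIV. (v $ a) *\<^sub>R (J a (\<iota> u) - r a *\<^sub>R n))"
    using iT by (simp add: sum_3 ext i)
  also have "\<dots> = (\<Sum>a\<in>UNIV. (v $ a) *\<^sub>R J a (\<iota> u)) - (\<Sum>a\<in>UNIV. v $ a * r a) *\<^sub>R n"
    by (simp add: algebra_simps sum_3)
  finally have 1: "\<iota> (\<Sum>a\<in>UNIV. (v $ a) *\<^sub>R extend_by_zero (Q a) (\<tau> a) (I a) u) =
      (\<Sum>a\<in>UNIV. (v $ a) *\<^sub>R J a (\<iota> u))"
    unfolding z by simp
  have 2: "(\<Sum>a\<in>UNIV. (v $ a) *\<^sub>R extend_by_zero (Q a) (\<tau> a) (I a) u) \<in> T"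
    using iT by (simp add: sum_3 ext)
  show ?thesis using \<kappa>_\<iota>[OF 2] unfolding 1 by (rule sym)
qed

end

section \<open>Hypersurfaces in coordinates\<close>

lemma linear_smooth_on: "linear h \<Longrightarrow> open S \<Longrightarrow> smooth_on S f \<Longrightarrow> smooth_on S (\<lambda>x. h (f x))"
  for f :: "'a::real_normed_vector \<Rightarrow> 'b::euclidean_space" and h :: "'b \<Rightarrow> 'c::real_normed_vector"
  by (simp add: smooth_on_linear linear_conv_bounded_linear)

text \<open>With a fixed transversal vector \<open>\<nu>\<close> the derivative of the immersion is completed to the
  invertible matrix \<open>C\<close>, from which a left inverse and a conormal are read off.\<close>

lemma hypersurface_immersion:
  fixes \<phi> :: "real^'m \<Rightarrow> real^'k"
  assumes S: "open S" "x0 \<in> S" and \<phi>: "smooth_on S \<phi>"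
    and inj: "inj (fderiv \<phi> x0)" and card: "CARD('k) = CARD('m) + 1"
  obtains A L \<theta> where "open A" "x0 \<in> A" "A \<subseteq> S"
    "\<And>x. x \<in> A \<Longrightarrow> linear (L x)" "\<And>x. x \<in> A \<Longrightarrow> linear (\<theta> x)"
    "\<And>w :: real^'k. smooth_on A (\<lambda>x. L x w :: real^'m)" "\<And>w. smooth_on A (\<lambda>x. \<theta> x w :: real)"
    "\<And>x u. x \<in> A \<Longrightarrow> L x (fderiv \<phi> x u) = u"
    "\<And>x w. x \<in> A \<Longrightarrow> \<theta> x w = 0 \<longleftrightarrow> w \<in> range (fderiv \<phi> x)"
    "\<And>x. x \<in> A \<Longrightarrow> \<exists>w. \<theta> x w \<noteq> 0"
proof -
  define B where "B x = fderiv \<phi> x" for x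
  have linB: "linear (B x)" if "x \<in> S" for x
    unfolding B_def by (rule smooth_on_linear_derivative[OF \<phi> that])
  have lin0: "linear (B x0)" by (rule linB[OF S(2)])
  have dimr: "dim (range (B x0)) = CARD('m)"
    using dim_image_eq[OF lin0, of UNIV] inj by (simp add: B_def span_UNIV)
  then obtain \<nu> where \<nu>: "\<nu> \<noteq> 0" "\<And>y. y \<in> range (B x0) \<Longrightarrow> \<nu> \<bullet> y = 0"
    using orthogonal_to_subspace_exists[of "range (B x0)"] card
    by (metis DIM_cart DIM_real less_add_one mult.right_neutral orthogonal_def span_base)
  have range0: "range (B x0) = {y. \<nu> \<bullet> y = 0}"
  proof (rule subspace_dim_equal)
    show "subspace (range (B x0))" using linear_subspace_image[OF lin0 subspace_UNIV] .
    show "subspace {y. \<nu> \<bullet> y = 0}" by (rule subspace_hyperplane)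
    show "range (B x0) \<subseteq> {y. \<nu> \<bullet> y = 0}" using \<nu>(2) by auto
    show "dim {y. \<nu> \<bullet> y = 0} \<le> dim (range (B x0))"
      using dimr dim_hyperplane[OF \<nu>(1)] card by simp
  qed
  obtain g where g: "linear g" "g \<circ> B x0 = id"
    using linear_injective_left_inverse[OF lin0] inj by (auto simp: B_def)
  define pr where "pr w = ((\<nu> \<bullet> w) / (\<nu> \<bullet> \<nu>)) *\<^sub>R \<nu>" for w
  have linpr: "linear pr"
    by (rule linearI) (simp_all add: pr_def inner_add_right add_divide_distrib scaleR_add_left)
  have pr_B0: "pr (B x0 u) = 0" for u using \<nu>(2) by (simp add: pr_def)
  have \<nu>pr: "\<nu> \<bullet> pr w = \<nu> \<bullet> w" for w using \<nu>(1) by (simp add: pr_def)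
  define L0 where "L0 w = g (w - pr w)" for w
  have linL0: "linear L0"
    unfolding L0_def using linear_compose[OF linear_compose_sub[OF linear_ident linpr] g(1)] by (simp add: o_def)
  have L0B: "L0 (B x0 u) = u" for u
    using g(2) by (simp add: L0_def pr_B0 fun_eq_iff)
  have B0L0: "B x0 (L0 w) = w - pr w" for w
  proof -
    have "w - pr w \<in> range (B x0)" unfolding range0 by (simp add: inner_diff_right \<nu>pr)
    then obtain u where u: "w - pr w = B x0 u" by blast
    have "g (B x0 u) = u" using g(2) by (simp add: fun_eq_iff)
    then show ?thesis unfolding L0_def u by simp
  qed
  \<comment> \<open>\<open>C x\<close> sends \<open>B x0 u\<close> to \<open>B x u\<close> and fixes
    \<open>\<nu>\<close>, because \<open>L0\<close> is a left inverse of \<open>B x0\<close> that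
    kills \<open>\<nu>\<close>. It is the identity at \<open>x0\<close>, hence invertible nearby,
    and its inverse straightens the moving hyperplane \<open>range (B x)\<close> to the fixed one
    orthogonal to \<open>\<nu>\<close>.\<close>
  define C where "C x = matrix (\<lambda>w. B x (L0 w) + pr w)" for x
  have linC: "linear (\<lambda>w. B x (L0 w) + pr w)" if "x \<in> S" for x
    using linear_compose_add[OF linear_compose[OF linL0 linB[OF that]] linpr] by (simp add: o_def)
  have C: "C x *v w = B x (L0 w) + pr w" if "x \<in> S" for x w
    unfolding C_def by (simp add: matrix_works linC[OF that])
  have smC: "smooth_on S (\<lambda>x. C x $ i $ j)" for i j
    unfolding C_def matrix_def B_def
    by (simp, intro smooth_on_add S smooth_on_const smooth_on_nth smooth_on_frechet_derivative \<phi>)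
  have "C x0 *v w = w" for w by (simp add: C[OF S(2)] B0L0)
  then have "C x0 = mat 1" by (simp add: matrix_eq)
  then have det0: "det (C x0) \<noteq> 0" by simp
  have detC: "continuous_on S (\<lambda>x. det (C x))"
    by (rule smooth_on_continuous[OF smooth_on_det[OF S(1) smC]])
  define A where "A = S \<inter> (\<lambda>x. det (C x)) -` (- {0})"
  have A: "open A" "x0 \<in> A" "A \<subseteq> S"
    using continuous_open_preimage[OF detC S(1)] det0 S(2) by (auto simp: A_def)
  have dA: "det (C x) \<noteq> 0" if "x \<in> A" for x using that by (simp add: A_def)
  let ?D = "\<lambda>x w. matrix_inv (C x) *v w"
  have CD: "C x *v ?D x w = w" "?D x (C x *v w) = w" if "x \<in> A" for x w
    using matrix_mul_matrix_inv[OF dA[OF that]] by auto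
  have smD: "smooth_on A (\<lambda>x. ?D x w)" for w
    by (rule smooth_on_matrix_inv[OF A(1) smooth_on_subset[OF smC A(3)] dA])
  have DB: "?D x (B x u) = B x0 u" if "x \<in> A" for x u
  proof -
    have "C x *v B x0 u = B x u" using that A(3) by (simp add: C subset_iff L0B pr_B0)
    then show ?thesis using CD(2)[OF that] by metis
  qed
  show thesis
  proof (rule that[OF A, of "\<lambda>x w. L0 (?D x w)" "\<lambda>x w. \<nu> \<bullet> ?D x w"])
    fix x assume x: "x \<in> A"
    have lD: "linear (?D x)" by simp
    show "linear (\<lambda>w. L0 (?D x w))" using linear_compose[OF lD linL0] by (simp add: o_def)
    show "linear (\<lambda>w. \<nu> \<bullet> ?D x w)"
      by (rule linearI) (simp_all add: matrix_vector_right_distrib inner_add_right matrix_vector_mult_scaleR)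
    show "L0 (?D x (fderiv \<phi> x u)) = u" for u
      using DB[OF x] by (simp add: B_def[symmetric] L0B)
    show "\<nu> \<bullet> ?D x w = 0 \<longleftrightarrow> w \<in> range (fderiv \<phi> x)" for w
    proof
      assume "\<nu> \<bullet> ?D x w = 0"
      then have "?D x w \<in> range (B x0)" by (simp add: range0)
      then obtain u where "?D x w = B x0 u" by blast
      then have "w = C x *v B x0 u" using CD(1)[OF x, of w] by simp
      also have "\<dots> = B x u" using x A(3) by (simp add: C subset_iff L0B pr_B0)
      finally show "w \<in> range (fderiv \<phi> x)" by (simp add: B_def)
    next
      assume "w \<in> range (fderiv \<phi> x)"
      then obtain u where "w = B x u" by (auto simp: B_def)
      then show "\<nu> \<bullet> ?D x w = 0" using \<nu>(2) by (simp add: DB[OF x])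
    qed
    have "\<nu> \<bullet> ?D x (C x *v \<nu>) \<noteq> 0" using \<nu>(1) by (simp add: CD(2)[OF x])
    then show "\<exists>w. \<nu> \<bullet> ?D x w \<noteq> 0" by blast
  next
    show "smooth_on A (\<lambda>x. L0 (?D x w))" for w by (rule linear_smooth_on[OF linL0 A(1) smD])
    show "smooth_on A (\<lambda>x. \<nu> \<bullet> ?D x w)" for w by (rule smooth_on_inner[OF A(1) smooth_on_const smD])
  qed
qed

section \<open>Frames for the kernel of a covector\<close>

lemma span_axis_except:
  "span ((\<lambda>j. axis j 1 :: real^'m) ` (UNIV - {i})) = {u. u $ i = 0}"
proof
  have "subspace {u :: real^'m. u $ i = 0}" by (auto simp: subspace_def)
  then show "span ((\<lambda>j. axis j 1) ` (UNIV - {i})) \<subseteq> {u :: real^'m. u $ i = 0}"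
    by (intro span_minimal) (auto simp: axis_def)
  show "{u :: real^'m. u $ i = 0} \<subseteq> span ((\<lambda>j. axis j 1) ` (UNIV - {i}))"
  proof
    fix u :: "real^'m" assume "u \<in> {u. u $ i = 0}"
    then have "u = (\<Sum>j\<in>UNIV - {i}. u $ j *\<^sub>R axis j 1)"
      by (auto simp: vec_eq_iff axis_def if_distrib cong: if_cong)
    also have "\<dots> \<in> span ((\<lambda>j. axis j 1) ` (UNIV - {i}))"
      by (intro span_sum span_scale span_base) auto
    finally show "u \<in> span ((\<lambda>j. axis j 1) ` (UNIV - {i}))" .
  qed
qed

text \<open>The projection of \<open>u\<close> to the kernel of \<open>\<eta>\<close> along the
  \<open>i\<close>-th axis, provided that \<open>\<eta>\<close> does not vanish on this
  axis.\<close>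

definition along :: "real^'m \<Rightarrow> (real^'m \<Rightarrow> real) \<Rightarrow> 'm \<Rightarrow> real^'m" where
  "along u \<eta> i = u - (\<eta> u / \<eta> (axis i 1)) *\<^sub>R axis i 1"

text \<open>The projection along the \<open>i\<close>-th axis maps the coordinate hyperplane
  \<open>u $ i = 0\<close> isomorphically to the kernel of \<open>\<eta>\<close>, so it carries the
  remaining axes to a basis. The basis depends on \<open>\<eta>\<close> by rational formulas, hence
  smoothly when \<open>\<eta>\<close> varies.\<close>

lemma kernel_basis:
  fixes \<eta> :: "real^'m \<Rightarrow> real" and h :: "real^'m \<Rightarrow> 'b::real_vector"
  assumes \<eta>: "linear \<eta>" "\<eta> (axis i 1) \<noteq> 0" and h: "linear h" "inj h"
  shows "inj_on (\<lambda>j. h (along (axis j 1) \<eta> i)) (UNIV - {i})"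
    and "independent ((\<lambda>j. h (along (axis j 1) \<eta> i)) ` (UNIV - {i}))"
    and "span ((\<lambda>j. h (along (axis j 1) \<eta> i)) ` (UNIV - {i})) = h ` {u. \<eta> u = 0}"
proof -
  let ?f = "(\<lambda>j. h (along (axis j 1) \<eta> i))"
  let ?ax = "\<lambda>j. axis j 1 :: real^'m" and ?g = "\<lambda>u. along u \<eta> i"
  have ling: "linear ?g"
    by (rule linearI) (simp_all add: along_def linear_add[OF \<eta>(1)] linear_scale[OF \<eta>(1)]
      add_divide_distrib scaleR_add_left algebra_simps)
  have lin: "linear (\<lambda>u. h (?g u))" using linear_compose[OF ling h(1)] by (simp add: o_def)
  have injg: "inj_on (\<lambda>u. h (?g u)) {u. u $ i = 0}"
  proof (rule inj_onI)
    fix u v assume uv: "u \<in> {u. u $ i = 0}" "v \<in> {u. u $ i = 0}" "h (?g u) = h (?g v)"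
    have "?g (u - v) = 0" using uv(3) h(2) linear_diff[OF ling] by (simp add: inj_eq)
    then have e: "u - v = (\<eta> (u - v) / \<eta> (axis i 1)) *\<^sub>R axis i 1" by (simp add: along_def)
    have "(u - v) $ i = 0" using uv by simp
    then have "\<eta> (u - v) / \<eta> (axis i 1) = 0" by (subst (asm) e) simp
    then have "u - v = 0" using e by (metis scale_zero_left)
    then show "u = v" by simp
  qed
  have inj_ax: "inj_on ?ax (UNIV - {i})" by (auto simp: inj_on_def axis_eq_axis)
  have ind: "independent (?ax ` (UNIV - {i}))"
    by (rule independent_mono[OF independent_Basis]) (auto simp: Basis_vec_def)
  have comp: "?f ` (UNIV - {i}) = (\<lambda>u. h (?g u)) ` ?ax ` (UNIV - {i})" by (simp add: image_image)
  have "?ax ` (UNIV - {i}) \<subseteq> {u. u $ i = 0}" by (auto simp: axis_def)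
  then show "inj_on ?f (UNIV - {i})"
    using comp_inj_on[OF inj_ax inj_on_subset[OF injg]] by (simp add: o_def)
  show "independent (?f ` (UNIV - {i}))"
    unfolding comp by (rule linear_independent_injective_image[OF lin ind]) (simp add: span_axis_except injg)
  have "?g ` {u. u $ i = 0} = {u. \<eta> u = 0}"
  proof
    show "?g ` {u. u $ i = 0} \<subseteq> {u. \<eta> u = 0}"
      using \<eta> by (auto simp: along_def linear_diff linear_scale)
    show "{u. \<eta> u = 0} \<subseteq> ?g ` {u. u $ i = 0}"
    proof
      fix u assume u: "u \<in> {u. \<eta> u = 0}"
      have "u = ?g (u - u $ i *\<^sub>R axis i 1)"
        using u \<eta> by (simp add: along_def linear_diff linear_scale)
      moreover have "u - u $ i *\<^sub>R axis i 1 \<in> {u. u $ i = 0}" by simp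
      ultimately show "u \<in> ?g ` {u. u $ i = 0}" by blast
    qed
  qed
  then show "span (?f ` (UNIV - {i})) = h ` {u. \<eta> u = 0}"
    unfolding comp linear_span_image[OF lin] span_axis_except by (metis image_image)
qed

section \<open>The inclusion of the hypersurface and its differential in charts\<close>

locale hypersurf = M: mfd M + N: mfd N
  for M :: "('p, real^'m) manifold" and N :: "('p, real^'k) manifold" +
  assumes hyp: "hypersurface M N"
begin

lemma card_k: "CARD('k) = CARD('m) + 1"
  using hyp by (simp add: hypersurface_def)

lemma topspace_subset: "topspace (mtop M) \<subseteq> topspace (mtop N)"
  using hyp by (simp add: hypersurface_def)

lemma openin_M: "openin (mtop N) U \<Longrightarrow> openin (mtop M) (topspace (mtop M) \<inter> U)"
proof -
  assume "openin (mtop N) U"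
  then have "openin (subtopology (mtop N) (topspace (mtop M))) (topspace (mtop M) \<inter> U)"
    by (auto simp: openin_subtopology)
  then show ?thesis using hyp unfolding hypersurface_def by metis
qed

lemma openin_M_Int:
  assumes "openin (mtop M) W" "openin (mtop N) U"
  shows "openin (mtop M) (W \<inter> U)"
proof -
  have "W \<inter> U = W \<inter> (topspace (mtop M) \<inter> U)" using openin_subset[OF assms(1)] by blast
  then show ?thesis using openin_Int[OF assms(1) openin_M[OF assms(2)]] by simp
qed

lemma smooth_inclusion:
  assumes "c \<in> charts M" "d \<in> charts N"
  shows "smooth_on (snd c ` (fst c \<inter> fst d)) (transition c d)"
proof -
  have "smooth_map M N (\<lambda>x. x)" using hyp by (simp add: hypersurface_def)
  then have "smooth_on (snd c ` (fst c \<inter> (\<lambda>x. x) -` fst d)) (snd d \<circ> (\<lambda>x. x) \<circ> chart_inv c)"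
    using assms unfolding smooth_map_def by blast
  then show ?thesis by (simp add: transition_def o_def vimage_def)
qed

lemma open_inclusion: "c \<in> charts M \<Longrightarrow> d \<in> charts N \<Longrightarrow> open (snd c ` (fst c \<inter> fst d))"
  using M.open_chart_image[of c "fst c \<inter> fst d"] openin_M_Int M.openin_chart N.openin_chart
  by (metis inf.left_idem)

abbreviation "Di c d p \<equiv> fderiv (transition c d) (snd c p)"

lemma Di_has_derivative:
  assumes "c \<in> charts M" "d \<in> charts N" "p \<in> fst c" "p \<in> fst d"
  shows "(transition c d has_derivative (\<lambda>u. Di c d p u)) (at (snd c p))"
  by (rule smooth_on_has_derivative[OF smooth_inclusion[OF assms(1,2)]]) (use assms in auto)

lemma linear_Di:
  assumes "c \<in> charts M" "d \<in> charts N" "p \<in> fst c" "p \<in> fst d"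
  shows "linear (Di c d p)"
  by (rule smooth_on_linear_derivative[OF smooth_inclusion[OF assms(1,2)]]) (use assms in auto)

lemma Di_Dtr:
  assumes "c \<in> charts M" "c' \<in> charts M" "d \<in> charts N" "p \<in> fst c" "p \<in> fst c'" "p \<in> fst d"
  shows "Di c' d p (M.Dtr c c' p u) = Di c d p u"
proof (rule transition_chain[OF _ _ _ _ M.transition_has_derivative[OF assms(1,2,4,5)]
      Di_has_derivative[OF assms(2,3,5,6)], symmetric])
  show "open (snd c ` (fst c \<inter> (fst c' \<inter> fst d)))"
    using assms by (intro M.open_chart_image openin_M_Int M.openin_chart N.openin_chart)
qed (use assms in auto)

lemma Dtr_Di:
  assumes "c \<in> charts M" "d \<in> charts N" "d' \<in> charts N" "p \<in> fst c" "p \<in> fst d" "p \<in> fst d'"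
  shows "N.Dtr d d' p (Di c d p u) = Di c d' p u"
proof (rule transition_chain[OF _ _ _ _ Di_has_derivative[OF assms(1,2,4,5)]
      N.transition_has_derivative[OF assms(2,3,5,6)], symmetric])
  show "open (snd c ` (fst c \<inter> (fst c \<inter> fst d \<inter> fst d')))"
    using assms by (intro M.open_chart_image openin_M_Int M.openin_chart N.openin_chart)
qed (use assms in auto)

abbreviation "TM \<equiv> tangent_space M"
abbreviation "TN \<equiv> tangent_space N"

abbreviation "\<iota> p \<equiv> pushforward M N (\<lambda>x. x) p"

text \<open>\<open>pushforward\<close> is defined with the chart chosen at \<open>p\<close>; the
  chain rule \<open>Di_Dtr\<close> frees the formula from that choice.\<close>

lemma \<iota>_apply:
  assumes c: "c \<in> charts M" "p \<in> fst c" and d: "d \<in> charts N" "p \<in> fst d" and v: "v \<in> TM p"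
  shows "\<iota> p v d = Di c d p (v c)"
proof -
  let ?c = "chart_at M p"
  have a: "?c \<in> charts M" "p \<in> fst ?c" using M.chart_at M.openin_topspace_fst[OF c] by auto
  have "\<iota> p v d = Di ?c d p (v ?c)"
    using d by (simp add: pushforward_def transition_def o_def)
  also have "v ?c = M.Dtr c ?c p (v c)" using M.tangent_transform[OF v c(1) a(1) c(2) a(2)] by simp
  also have "Di ?c d p (M.Dtr c ?c p (v c)) = Di c d p (v c)"
    by (rule Di_Dtr[OF c(1) a(1) d(1) c(2) a(2) d(2)])
  finally show ?thesis .
qed

lemma \<iota>_eq_lift:
  assumes c: "c \<in> charts M" "p \<in> fst c" and d: "d \<in> charts N" "p \<in> fst d" and v: "v \<in> TM p"
  shows "\<iota> p v = lift N d p (Di c d p (v c))"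
proof
  fix e show "\<iota> p v e = lift N d p (Di c d p (v c)) e"
  proof (cases "e \<in> charts N \<and> p \<in> fst e")
    case True
    then show ?thesis using \<iota>_apply[OF c _ _ v] Dtr_Di[OF c(1) d(1) _ c(2) d(2)] by (simp add: lift_def)
  next
    case False
    then show ?thesis by (simp only: pushforward_def lift_def if_False)
  qed
qed

lemma \<iota>_in:
  assumes "p \<in> topspace (mtop M)" "v \<in> TM p"
  shows "\<iota> p v \<in> TN p"
proof -
  obtain c d where cd: "c \<in> charts M" "p \<in> fst c" "d \<in> charts N" "p \<in> fst d"
    using M.exists_chart N.exists_chart assms(1) topspace_subset by blast
  show ?thesis unfolding \<iota>_eq_lift[OF cd assms(2)] by (rule N.lift_in[OF cd(3,4)])
qed

lemma linear_on_\<iota>: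
  assumes "p \<in> topspace (mtop M)"
  shows "linear_on (TM p) (\<iota> p)"
proof -
  obtain c d where cd: "c \<in> charts M" "p \<in> fst c" "d \<in> charts N" "p \<in> fst d"
    using M.exists_chart N.exists_chart assms(1) topspace_subset by blast
  note S = M.subspace_tangent[OF assms]
  note l = linear_Di[OF cd(1,3,2,4)] and k = N.linear_lift[OF cd(3,4)]
  show ?thesis unfolding linear_on_def
    by (auto simp: \<iota>_eq_lift[OF cd] subspace_add[OF S] subspace_scale[OF S]
        linear_add[OF l] linear_add[OF k] linear_scale[OF l] linear_scale[OF k])
qed

lemma inj_on_\<iota>: "p \<in> topspace (mtop M) \<Longrightarrow> inj_on (\<iota> p) (TM p)"
  using hyp by (simp add: hypersurface_def)

lemma inj_Di:
  assumes c: "c \<in> charts M" "p \<in> fst c" and d: "d \<in> charts N" "p \<in> fst d"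
  shows "inj (Di c d p)"
proof (rule injI)
  fix u v assume "Di c d p u = Di c d p v"
  then have "\<iota> p (lift M c p u) = \<iota> p (lift M c p v)"
    using \<iota>_eq_lift[OF c d M.lift_in[OF c]] c by simp
  then have "lift M c p u = lift M c p v"
    using inj_on_\<iota>[OF M.openin_topspace_fst[OF c]] M.lift_in[OF c] by (auto simp: inj_on_def)
  then show "u = v" using M.lift_at[OF c] by metis
qed

text \<open>\<open>L\<close> is a left inverse of the differential of the inclusion and
  \<open>\<theta>\<close> a conormal, both smooth in the coordinates of \<open>M\<close>. They turn
  the inverse of \<open>\<iota>\<close> and the condition of being tangent to \<open>M\<close> into
  smooth data.\<close>

definition "adapted c d A L \<theta> \<longleftrightarrow> c \<in> charts M \<and> d \<in> charts N \<and> open A \<and> A \<subseteq> snd c ` (fst c \<inter> fst d) \<and>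
  (\<forall>x\<in>A. linear (L x) \<and> linear (\<theta> x) \<and> (\<exists>w. \<theta> x w \<noteq> 0) \<and>
    (\<forall>u. L x (fderiv (transition c d) x u) = u) \<and>
    (\<forall>w. \<theta> x w = 0 \<longleftrightarrow> w \<in> range (fderiv (transition c d) x))) \<and>
  (\<forall>w. smooth_on A (\<lambda>x. L x w) \<and> smooth_on A (\<lambda>x. \<theta> x w))"
  for L :: "real^'m \<Rightarrow> real^'k \<Rightarrow> real^'m" and \<theta> :: "real^'m \<Rightarrow> real^'k \<Rightarrow> real"

lemma exists_adapted:
  assumes c: "c \<in> charts M" "p \<in> fst c" and d: "d \<in> charts N" "p \<in> fst d"
  shows "\<exists>A L \<theta>. adapted c d A L \<theta> \<and> snd c p \<in> A"
proof -
  have "snd c p \<in> snd c ` (fst c \<inter> fst d)" using c d by blast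
  from hypersurface_immersion[OF open_inclusion[OF c(1) d(1)] this smooth_inclusion[OF c(1) d(1)] inj_Di[OF c d] card_k]
  obtain A and L :: "real^'m \<Rightarrow> real^'k \<Rightarrow> real^'m" and \<theta> :: "real^'m \<Rightarrow> real^'k \<Rightarrow> real"
    where 1: "open A" "snd c p \<in> A" "A \<subseteq> snd c ` (fst c \<inter> fst d)"
    "\<And>x. x \<in> A \<Longrightarrow> linear (L x)" "\<And>x. x \<in> A \<Longrightarrow> linear (\<theta> x)"
    "\<And>w. smooth_on A (\<lambda>x. L x w)" "\<And>w. smooth_on A (\<lambda>x. \<theta> x w)"
    "\<And>x u. x \<in> A \<Longrightarrow> L x (fderiv (transition c d) x u) = u"
    "\<And>x w. x \<in> A \<Longrightarrow> \<theta> x w = 0 \<longleftrightarrow> w \<in> range (fderiv (transition c d) x)"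
    "\<And>x. x \<in> A \<Longrightarrow> \<exists>w. \<theta> x w \<noteq> 0" by blast
  then have "adapted c d A L \<theta>" unfolding adapted_def using c d by blast
  then show ?thesis using 1(2) by blast
qed

lemma adaptedD:
  assumes "adapted c d A L \<theta>"
  shows "c \<in> charts M" "d \<in> charts N" "open A" "A \<subseteq> snd c ` (fst c \<inter> fst d)"
    "\<And>x. x \<in> A \<Longrightarrow> linear (L x)" "\<And>x. x \<in> A \<Longrightarrow> linear (\<theta> x)" "\<And>x. x \<in> A \<Longrightarrow> \<exists>w. \<theta> x w \<noteq> 0"
    "\<And>x u. x \<in> A \<Longrightarrow> L x (fderiv (transition c d) x u) = u"
    "\<And>x w. x \<in> A \<Longrightarrow> \<theta> x w = 0 \<longleftrightarrow> w \<in> range (fderiv (transition c d) x)"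
    "\<And>w. smooth_on A (\<lambda>x. L x w)" "\<And>w. smooth_on A (\<lambda>x. \<theta> x w)"
  using assms unfolding adapted_def by (blast, blast, blast, blast, blast, blast, blast, blast, blast, blast, blast)

lemma adapted_mem:
  assumes "adapted c d A L \<theta>" "q \<in> fst c" "snd c q \<in> A"
  shows "q \<in> fst d"
proof -
  obtain q' where "q' \<in> fst c" "q' \<in> fst d" "snd c q = snd c q'"
    using adaptedD(4)[OF assms(1)] assms(3) by blast
  then show ?thesis using M.inj_chart[OF adaptedD(1)[OF assms(1)]] assms(2) by (metis inj_onD)
qed

lemma image_\<iota>:
  assumes ad: "adapted c d A L \<theta>" and q: "q \<in> fst c" "snd c q \<in> A"
  shows "\<iota> q ` TM q = {e \<in> TN q. \<theta> (snd c q) (e d) = 0}"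
proof -
  note a = adaptedD[OF ad] and qd = adapted_mem[OF ad q]
  have "\<iota> q ` TM q = range (\<lambda>u. lift N d q (Di c d q u))"
    unfolding M.tangent_eq_range_lift[OF a(1) q(1)]
    using \<iota>_eq_lift[OF a(1) q(1) a(2) qd M.lift_in[OF a(1) q(1)]] a(1) q(1) by (simp add: image_image)
  also have "\<dots> = {e \<in> TN q. \<theta> (snd c q) (e d) = 0}"
    unfolding a(9)[OF q(2)] N.tangent_eq_range_lift[OF a(2) qd] using a(2) qd by auto
  finally show ?thesis .
qed

lemma inv_\<iota>_coord:
  assumes ad: "adapted c d A L \<theta>" and q: "q \<in> fst c" "snd c q \<in> A" and e: "e \<in> \<iota> q ` TM q"
  shows "inv_into (TM q) (\<iota> q) e c = L (snd c q) (e d)"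
proof -
  note a = adaptedD[OF ad] and qd = adapted_mem[OF ad q]
  obtain v where v: "v \<in> TM q" "e = \<iota> q v" using e by blast
  then have "inv_into (TM q) (\<iota> q) e = v"
    by (simp add: inv_into_f_f[OF inj_on_\<iota>[OF M.openin_topspace_fst[OF a(1) q(1)]]])
  moreover have "L (snd c q) (e d) = v c"
    unfolding v(2) \<iota>_apply[OF a(1) q(1) a(2) qd v(1)] by (rule a(8)[OF q(2)])
  ultimately show ?thesis by simp
qed

end

section \<open>The induced almost hyper CR structure\<close>

locale hypersurf_triple = hypersurf M N
  for M :: "('p, real^'m) manifold" and N :: "('p, real^'k) manifold" +
  fixes U :: "'p set" and J :: "3 \<Rightarrow> ('p, real^'k) endo"
  assumes triple: "local_quaternionic_triple N U J"
begin

abbreviation "QJ a \<equiv> induced_Q M N (J a)"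
abbreviation "IJ a \<equiv> induced_I M N (J a)"
abbreviation "hyperplane p \<equiv> quat_hyperplane (TM p) (\<iota> p) (TN p) (\<lambda>a. J a p)"
abbreviation "MU \<equiv> topspace (mtop M) \<inter> U"

lemma openin_U: "openin (mtop N) U" and
  complex_J: "complex_structure_on N U (TN) (J a)"
  using triple by (auto simp: local_quaternionic_triple_def)

lemma openin_MU: "openin (mtop M) MU"
  by (rule openin_M[OF openin_U])

lemma J_point:
  assumes "q \<in> U"
  shows "linear_on (TN q) (J a q)"
    "v \<in> TN q \<Longrightarrow> J a q v \<in> TN q"
    "v \<in> TN q \<Longrightarrow> J a q (J a q v) = - v"
    "v \<in> TN q \<Longrightarrow> J a q (J (a + 1) q v) = J (a + 2) q v"
    "v \<in> TN q \<Longrightarrow> J (a + 1) q (J a q v) = - J (a + 2) q v"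
  using complex_J[of a] triple assms unfolding complex_structure_on_def local_quaternionic_triple_def by blast+

lemma J_field:
  assumes "openin (mtop N) W" "W \<subseteq> U" "X \<in> vector_fields N W"
  shows "app (J a) X \<in> vector_fields N W"
  using complex_J[of a] assms N.vector_field_tangent[OF assms(3)]
  unfolding complex_structure_on_def sections_def by blast

text \<open>The coordinate matrix of \<open>J a\<close> in the chart \<open>d\<close>, as a function
  of the coordinates \<open>y\<close>, applied to \<open>w\<close>.\<close>

definition "Jc a d y w = J a (chart_inv d y) (lift N d (chart_inv d y) w) d"

lemma Jc_apply:
  assumes "d \<in> charts N" "q \<in> fst d" "v \<in> TN q"
  shows "J a q v d = Jc a d (snd d q) (v d)"
  using assms by (simp add: Jc_def)

lemma linear_Jc:
  assumes d: "d \<in> charts N" "q \<in> fst d" and q: "q \<in> U"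
  shows "linear (Jc a d (snd d q))"
proof -
  note S = N.subspace_tangent[OF N.openin_topspace_fst[OF d]]
  note l = linear_on_simps[OF J_point(1)[OF q] S N.lift_in[OF d]] and k = N.linear_lift[OF d]
  show ?thesis
    by (rule linearI) (simp_all add: Jc_def d l linear_add[OF k] linear_scale[OF k] N.lift_in[OF d])
qed

text \<open>Smoothness of \<open>J a\<close> is given only by its action on fields; the columns of
  its matrix are obtained from fields with constant coordinates.\<close>

lemma smooth_Jc:
  assumes d: "d \<in> charts N"
  shows "smooth_on (snd d ` (fst d \<inter> U)) (\<lambda>y. Jc a d y w)"
proof -
  let ?W = "fst d \<inter> U"
  have W: "openin (mtop N) ?W" by (intro openin_Int N.openin_chart d openin_U)
  have "(\<lambda>p. lift N d p w) \<in> vector_fields N ?W"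
    by (rule N.vector_field_lift[OF d open_UNIV smooth_on_const W]) auto
  from J_field[OF W _ this] have "app (J a) (\<lambda>p. lift N d p w) \<in> vector_fields N ?W" by blast
  from N.vector_field_smooth[OF this d] show ?thesis
    by (simp add: local_rep_def app_def Jc_def[abs_def])
qed

lemma smooth_Jc_along:
  assumes c: "c \<in> charts M" and d: "d \<in> charts N" and A: "open A" "A \<subseteq> snd c ` (fst c \<inter> (fst d \<inter> U))"
    and g: "smooth_on A g"
  shows "smooth_on A (\<lambda>x. Jc a d (transition c d x) (g x))"
proof -
  have x: "\<exists>q. q \<in> fst c \<and> q \<in> fst d \<and> q \<in> U \<and> x = snd c q" if "x \<in> A" for x using that A(2) by blast
  have s: "smooth_on A (transition c d)"
    by (rule smooth_on_subset[OF smooth_inclusion[OF c d]]) (use A(2) in blast)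
  show ?thesis
  proof (rule smooth_on_linear_family[OF A(1) _ _ g])
    show "linear (Jc a d (transition c d x))" if "x \<in> A" for x
      using x[OF that] linear_Jc[OF d] by (auto simp: M.transition_apply[OF c])
    show "smooth_on A (\<lambda>x. Jc a d (transition c d x) b)" for b
    proof (rule smooth_on_compose[OF A(1) _ s smooth_Jc[OF d]])
      show "open (snd d ` (fst d \<inter> U))" by (rule N.open_chart_image[OF d openin_U])
      show "transition c d x \<in> snd d ` (fst d \<inter> U)" if "x \<in> A" for x
        using x[OF that] by (auto simp: M.transition_apply[OF c])
    qed
  qed
qed

lemma hyperplane_adapted:
  assumes ad: "adapted c d A L \<theta>" and q: "q \<in> fst c" "snd c q \<in> A" "q \<in> U"
  shows "hyperplane q (\<lambda>v. \<theta> (snd c q) (v d))"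
proof -
  note a = adaptedD[OF ad] and qd = adapted_mem[OF ad q(1,2)]
  have qM: "q \<in> topspace (mtop M)" by (rule M.openin_topspace_fst[OF a(1) q(1)])
  have qN: "q \<in> topspace (mtop N)" using qM topspace_subset by blast
  obtain w where w: "\<theta> (snd c q) w \<noteq> 0" using a(7)[OF q(2)] by blast
  show ?thesis
  proof
    show "\<exists>e\<in>TN q. \<theta> (snd c q) (e d) \<noteq> 0"
      using N.lift_in[OF a(2) qd, of w] w a(2) qd by (metis N.lift_at)
    show "linear_on (TN q) (\<lambda>v. \<theta> (snd c q) (v d))"
      using a(6)[OF q(2)] by (simp add: linear_on_def linear_add linear_scale)
    show "\<iota> q ` TM q = {e \<in> TN q. \<theta> (snd c q) (e d) = 0}"
      by (rule image_\<iota>[OF ad q(1,2)])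
  qed (use q(3) J_point[OF q(3)] linear_on_\<iota>[OF qM] inj_on_\<iota>[OF qM] M.subspace_tangent[OF qM]
      N.subspace_tangent[OF qN] in blast)+
qed

lemma adapted_at:
  assumes "q \<in> topspace (mtop M)"
  obtains c d A L \<theta> where "adapted c d A L \<theta>" "q \<in> fst c" "snd c q \<in> A" "q \<in> fst d"
proof -
  obtain c d where cd: "c \<in> charts M" "q \<in> fst c" "d \<in> charts N" "q \<in> fst d"
    using M.exists_chart N.exists_chart assms(1) topspace_subset by blast
  from exists_adapted[OF cd] show thesis using that cd(2,4) by blast
qed

lemma hyperplane_at:
  assumes "q \<in> MU"
  obtains \<xi> where "hyperplane q \<xi>"
  using assms adapted_at hyperplane_adapted by (metis IntD1 IntD2)

lemma Q_eq:
  assumes "quat_hyperplane (TM q) (\<iota> q) E (\<lambda>a. J a q) \<xi>"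
  shows "quat_hyperplane.Q (TM q) (\<iota> q) (\<lambda>a. J a q) a = QJ a q"
    "quat_hyperplane.I (TM q) (\<iota> q) (\<lambda>a. J a q) a = IJ a q"
  unfolding quat_hyperplane.Q_def[OF assms] quat_hyperplane.I_def[OF assms, abs_def]
  by (simp_all add: induced_Q_def induced_I_def[abs_def] Let_def)

lemma QJ_adapted:
  assumes ad: "adapted c d A L \<theta>" and q: "q \<in> fst c" "snd c q \<in> A" "q \<in> U"
  shows "v \<in> QJ a q \<longleftrightarrow> v \<in> TM q \<and>
    \<theta> (snd c q) (Jc a d (snd d q) (Di c d q (v c))) = 0"
proof -
  note a = adaptedD[OF ad] and qd = adapted_mem[OF ad q(1,2)]
  interpret h: quat_hyperplane "TM q" "\<iota> q" "TN q" "\<lambda>a. J a q" "\<lambda>v. \<theta> (snd c q) (v d)"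
    by (rule hyperplane_adapted[OF ad q])
  have "J a q (\<iota> q v) d = Jc a d (snd d q) (Di c d q (v c))" if "v \<in> TM q"
    using Jc_apply[OF a(2) qd] \<iota>_apply[OF a(1) q(1) a(2) qd that] that by simp
  note * = this
  show ?thesis
    unfolding Q_eq(1)[OF h.quat_hyperplane_axioms, symmetric] h.Q_iff
    by (rule conj_cong[OF refl]) (simp only: *)
qed

text \<open>On sections of \<open>QJ a\<close> the vector \<open>J a (\<iota> X)\<close> is tangent
  to \<open>M\<close>, so the abstract inverse in \<open>induced_I\<close> agrees with
  \<open>L\<close> there. In coordinates the field is then \<open>L\<close> after \<open>Jc\<close>
  after the differential of the inclusion, applied to \<open>X\<close>: smooth families of linear
  maps.\<close>

lemma app_IJ_section:
  assumes W: "openin (mtop M) W" "W \<subseteq> MU" and X: "X \<in> sections M W (QJ a)"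
  shows "app (IJ a) X \<in> sections M W (QJ a)"
proof -
  have XV: "X \<in> vector_fields M W" and XQ: "\<And>p. p \<in> W \<Longrightarrow> X p \<in> QJ a p" using X by (auto simp: sections_def)
  have Q: "IJ a p (X p) \<in> QJ a p" and T: "IJ a p (X p) \<in> TM p" and im: "J a p (\<iota> p (X p)) \<in> \<iota> p ` TM p"
    if p: "p \<in> W" for p
  proof -
    have pU: "p \<in> MU" using p W by blast
    obtain \<xi> where q: "hyperplane p \<xi>"
      by (rule hyperplane_at[OF pU])
    interpret h: quat_hyperplane "TM p" "\<iota> p" "TN p" "\<lambda>a. J a p" \<xi> by (rule q)
    have x: "X p \<in> h.Q a" using XQ[OF p] unfolding Q_eq[OF q] .
    show "IJ a p (X p) \<in> QJ a p" "IJ a p (X p) \<in> TM p"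
      using h.I_in_Q[OF x] h.I_in[OF x] unfolding Q_eq[OF q] .
    show "J a p (\<iota> p (X p)) \<in> \<iota> p ` TM p"
      using imageI[OF h.I_in[OF x], of "\<iota> p"] unfolding h.\<iota>_I[OF x] .
  qed
  have "app (IJ a) X \<in> vector_fields M W"
  proof (rule M.vector_fieldI[OF W(1)])
    fix p assume p: "p \<in> W"
    show "app (IJ a) X p \<in> TM p" using T[OF p] by (simp add: app_def)
    have "p \<in> topspace (mtop M)" using p W by blast
    then obtain c d A L \<theta> where ad: "adapted c d A L \<theta>" and pc: "p \<in> fst c" "snd c p \<in> A" "p \<in> fst d"
      by (rule adapted_at)
    note a = adaptedD[OF ad]
    define B where "B = A \<inter> snd c ` (fst c \<inter> W)"
    have B: "open B" "snd c p \<in> B" "B \<subseteq> A" "B \<subseteq> snd c ` (fst c \<inter> W)"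
      using M.open_chart_image[OF a(1) W(1)] a(3) pc p by (auto simp: B_def)
    have Bq: "\<exists>q. q \<in> fst c \<and> q \<in> fst d \<and> q \<in> W \<and> x = snd c q" if "x \<in> B" for x
      using that adapted_mem[OF ad] by (auto simp: B_def)
    have BU: "B \<subseteq> snd c ` (fst c \<inter> (fst d \<inter> U))" using Bq W(2) by blast
    have s1: "smooth_on B (local_rep c X)"
      by (rule smooth_on_subset[OF M.vector_field_smooth[OF XV a(1)] B(4)])
    have s2: "smooth_on B (transition c d)"
      by (rule smooth_on_subset[OF smooth_inclusion[OF a(1,2)]]) (use BU in blast)
    have s3: "smooth_on B (\<lambda>x. fderiv (transition c d) x (local_rep c X x))"
      by (rule smooth_on_derivative_compose[OF B(1) B(1) s2 smooth_on_ident _ s1])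
    have s4: "smooth_on B (\<lambda>x. Jc a d (transition c d x) (fderiv (transition c d) x (local_rep c X x)))"
      by (rule smooth_Jc_along[OF a(1,2) B(1) BU s3])
    have s5: "smooth_on B (\<lambda>x. L x (Jc a d (transition c d x) (fderiv (transition c d) x (local_rep c X x))))"
      by (rule smooth_on_linear_family[OF B(1) _ _ s4]) (use a(5) a(10) B(3) smooth_on_subset in blast)+
    have "local_rep c (app (IJ a) X) x =
        L x (Jc a d (transition c d x) (fderiv (transition c d) x (local_rep c X x)))" if x: "x \<in> B" for x
    proof -
      obtain q where q: "q \<in> fst c" "q \<in> fst d" "q \<in> W" "x = snd c q" using Bq[OF x] by blast
      have qA: "snd c q \<in> A" using x q(4) B(3) by blast
      have XT: "X q \<in> TM q" by (rule M.vector_field_tangent[OF XV q(3)])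
      have "q \<in> topspace (mtop M)" using q(3) W by blast
      note i = \<iota>_in[OF this XT]
      show ?thesis
        using inv_\<iota>_coord[OF ad q(1) qA im[OF q(3)]] Jc_apply[OF a(2) q(2) i] \<iota>_apply[OF a(1) q(1) a(2) q(2) XT]
        by (simp add: q(4) M.local_rep_apply[OF a(1) q(1)] app_def induced_I_def Let_def M.transition_apply[OF a(1) q(1)])
    qed
    then have "smooth_on B (local_rep c (app (IJ a) X))"
      by (rule smooth_on_eq[OF s5 B(1)])
    then show "\<exists>c A. c \<in> charts M \<and> p \<in> fst c \<and> open A \<and> snd c p \<in> A \<and> smooth_on A (local_rep c (app (IJ a) X))"
      using a(1) pc(1) B(1,2) by blast
  qed
  then show ?thesis using Q by (simp add: sections_def app_def)
qed

lemma complex_structure_IJ: "complex_structure_on M MU (QJ a) (IJ a)"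
  unfolding complex_structure_on_def
proof (intro conjI ballI allI impI)
  fix p assume p: "p \<in> MU"
  obtain \<xi> where q: "hyperplane p \<xi>"
    by (rule hyperplane_at[OF p])
  note h = quat_hyperplane.linear_on_I[OF q] quat_hyperplane.I_in_Q[OF q] quat_hyperplane.I_I[OF q]
  show "linear_on (QJ a p) (IJ a p)" using h(1)[of a] unfolding Q_eq[OF q] .
  show "IJ a p v \<in> QJ a p" "IJ a p (IJ a p v) = - v" if "v \<in> QJ a p" for v
    using h(2)[of v a] h(3)[of v a] that unfolding Q_eq[OF q] by auto
qed (use app_IJ_section in blast)

text \<open>In the chart \<open>c\<close> the covector \<open>\<eta>\<close> cuts out
  \<open>QJ a\<close>. It is nonzero at \<open>p\<close> by \<open>Q_proper\<close>, so it is
  nonzero on some axis \<open>i\<close>, also at nearby points, and projecting the other axes along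
  \<open>i\<close> gives a smooth frame.\<close>

lemma subbundle_QJ: "subbundle M MU (CARD('m) - 1) (QJ a)"
  unfolding subbundle_def
proof
  fix p assume p: "p \<in> MU"
  then have "p \<in> topspace (mtop M)" by blast
  then obtain c d A L \<theta> where ad: "adapted c d A L \<theta>" and pc: "p \<in> fst c" "snd c p \<in> A" "p \<in> fst d"
    by (rule adapted_at)
  note ad' = adaptedD[OF ad]
  define B where "B = A \<inter> snd c ` (fst c \<inter> MU)"
  have B: "open B" "snd c p \<in> B" "B \<subseteq> A"
    using M.open_chart_image[OF ad'(1) openin_MU] ad'(3) pc p by (auto simp: B_def)
  have Bq: "\<exists>q. q \<in> fst c \<and> q \<in> fst d \<and> q \<in> MU \<and> x = snd c q" if "x \<in> B" for x
    using that adapted_mem[OF ad] by (auto simp: B_def)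
  have BU: "B \<subseteq> snd c ` (fst c \<inter> (fst d \<inter> U))" using Bq by blast
  define \<eta> where "\<eta> x u = \<theta> x (Jc a d (transition c d x) (fderiv (transition c d) x u))" for x u
  have s2: "smooth_on B (transition c d)"
    by (rule smooth_on_subset[OF smooth_inclusion[OF ad'(1,2)]]) (use BU in blast)
  have s\<eta>: "smooth_on B (\<lambda>x. \<eta> x u)" for u
    unfolding \<eta>_def
    by (rule smooth_on_linear_family[OF B(1) _ _ smooth_Jc_along[OF ad'(1,2) B(1) BU smooth_on_frechet_derivative[OF s2]]])
      (use ad'(6) ad'(11) B(3) smooth_on_subset in blast)+
  have lin\<eta>: "linear (\<eta> x)" if x: "x \<in> B" for x
  proof -
    obtain q where q: "q \<in> fst c" "q \<in> fst d" "q \<in> MU" "x = snd c q" using Bq[OF x] by blast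
    have "linear (\<theta> x \<circ> (Jc a d (snd d q) \<circ> Di c d q))"
      using q x B(3) by (intro linear_compose linear_Di ad' linear_Jc) auto
    then show ?thesis
      by (simp add: \<eta>_def[abs_def] o_def q(4) M.transition_apply[OF ad'(1) q(1)])
  qed
  have Bmem: "q \<in> MU" if q: "q \<in> fst c" "snd c q \<in> B" for q
  proof -
    have "snd c q \<in> snd c ` (fst c \<inter> MU)" using q by (simp add: B_def)
    then show ?thesis using M.chart_image_mem[OF ad'(1), of "snd c q" MU] ad'(1) q(1) by simp
  qed
  have QJ: "v \<in> QJ a q \<longleftrightarrow> v \<in> TM q \<and> \<eta> (snd c q) (v c) = 0" if "q \<in> fst c" "snd c q \<in> B" for q v
  proof -
    have "q \<in> U" using Bmem[OF that] by blast
    then show ?thesis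
      using QJ_adapted[OF ad that(1)] that B(3) by (auto simp: \<eta>_def M.transition_apply[OF ad'(1) that(1)])
  qed
  have "\<exists>i. \<eta> (snd c p) (axis i 1) \<noteq> 0"
  proof (rule ccontr)
    assume "\<not> ?thesis"
    then have "\<eta> (snd c p) b = 0" if "b \<in> Basis" for b
      using that by (auto simp: Basis_vec_def)
    then have "\<eta> (snd c p) u = 0" for u
      using linear_Basis_expansion[OF lin\<eta>[OF B(2)], of u] by simp
    then have eq: "QJ a p = TM p" using QJ[OF pc(1) B(2)] by blast
    obtain \<xi> where q: "hyperplane p \<xi>"
      by (rule hyperplane_at[OF p])
    from quat_hyperplane.Q_proper[OF q, of a] show False unfolding Q_eq[OF q] eq by blast
  qed
  then obtain i where i: "\<eta> (snd c p) (axis i 1) \<noteq> 0" by blast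
  have cont: "continuous_on B (\<lambda>x. \<eta> x (axis i 1))" by (rule smooth_on_continuous[OF s\<eta>])
  define C where "C = B \<inter> (\<lambda>x. \<eta> x (axis i 1)) -` (- {0})"
  have C: "open C" "snd c p \<in> C" "C \<subseteq> B"
    using continuous_open_preimage[OF cont B(1)] B(2) i by (auto simp: C_def)
  have \<eta>i: "\<eta> x (axis i 1) \<noteq> 0" if "x \<in> C" for x using that by (simp add: C_def)
  define W where "W = {q \<in> fst c. snd c q \<in> C}"
  have W: "openin (mtop M) W" "p \<in> W" "W \<subseteq> MU"
  proof -
    show "openin (mtop M) W" unfolding W_def by (rule M.openin_chart_preimage[OF ad'(1) C(1)])
    show "p \<in> W" using pc C by (simp add: W_def)
    show "W \<subseteq> MU" using C(3) Bmem unfolding W_def by blast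
  qed
  \<comment> \<open>\<open>subbundle\<close> counts its frames by initial segments of the naturals,
    while the frame here is naturally indexed by the axes other than \<open>i\<close>.\<close>
  obtain e where e: "bij_betw e {..<CARD('m) - 1} (UNIV - {i})"
    using ex_bij_betw_nat_finite[of "UNIV - {i}"] by (auto simp: card_Diff_singleton atLeast0LessThan)
  define X where "X j q = lift M c q (along (axis (e j) 1) (\<eta> (snd c q)) i)" for j q
  have "X j \<in> vector_fields M W" for j
    unfolding X_def
  proof (rule M.vector_field_lift[OF ad'(1) C(1) _ W(1)])
    show "smooth_on C (\<lambda>x. along (axis (e j) 1) (\<eta> x) i)"
      unfolding along_def
      by (intro smooth_on_diff[OF C(1)] smooth_on_scaleR[OF C(1)] smooth_on_divide[OF C(1)] smooth_on_const
        smooth_on_subset[OF s\<eta> C(3)] \<eta>i)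
  qed (auto simp: W_def)
  moreover have "inj_on (\<lambda>j. X j q) {..<CARD('m) - 1} \<and> independent ((\<lambda>j. X j q) ` {..<CARD('m) - 1}) \<and>
      span ((\<lambda>j. X j q) ` {..<CARD('m) - 1}) = QJ a q" if q: "q \<in> W" for q
  proof -
    have qc: "q \<in> fst c" "snd c q \<in> C" "snd c q \<in> B" using q C(3) by (auto simp: W_def)
    have inj: "inj (lift M c q)" by (rule injI) (metis M.lift_at[OF ad'(1) qc(1)])
    note k = kernel_basis[OF lin\<eta>[OF qc(3)] \<eta>i[OF qc(2)] M.linear_lift[OF ad'(1) qc(1)] inj]
    have im: "(\<lambda>j. X j q) ` {..<CARD('m) - 1} = (\<lambda>j. lift M c q (along (axis j 1) (\<eta> (snd c q)) i)) ` (UNIV - {i})"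
      unfolding bij_betw_imp_surj_on[OF e, symmetric] X_def image_image ..
    have "inj_on ((\<lambda>j. lift M c q (along (axis j 1) (\<eta> (snd c q)) i)) \<circ> e) {..<CARD('m) - 1}"
      using e k(1) by (intro comp_inj_on) (auto simp: bij_betw_def)
    then have "inj_on (\<lambda>j. X j q) {..<CARD('m) - 1}" by (simp add: X_def o_def)
    moreover have "lift M c q ` {u. \<eta> (snd c q) u = 0} = QJ a q"
    proof
      show "lift M c q ` {u. \<eta> (snd c q) u = 0} \<subseteq> QJ a q"
        using QJ[OF qc(1,3)] M.lift_in[OF ad'(1) qc(1)] M.lift_at[OF ad'(1) qc(1)] by auto
      show "QJ a q \<subseteq> lift M c q ` {u. \<eta> (snd c q) u = 0}"
      proof
        fix v assume "v \<in> QJ a q"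
        then have "\<eta> (snd c q) (v c) = 0" "lift M c q (v c) = v"
          using QJ[OF qc(1,3)] M.lift_eq[OF ad'(1) qc(1)] by blast+
        then show "v \<in> lift M c q ` {u. \<eta> (snd c q) u = 0}" by (intro image_eqI[of _ _ "v c"]) simp_all
      qed
    qed
    ultimately show ?thesis using k(2,3) unfolding im by simp
  qed
  ultimately show "\<exists>W X. openin (mtop M) W \<and> p \<in> W \<and> W \<subseteq> MU \<and> (\<forall>j<CARD('m) - 1. X j \<in> vector_fields M W) \<and>
      (\<forall>q\<in>W. inj_on (\<lambda>j. X j q) {..<CARD('m) - 1} \<and> independent ((\<lambda>j. X j q) ` {..<CARD('m) - 1}) \<and>
        span ((\<lambda>j. X j q) ` {..<CARD('m) - 1}) = QJ a q)"
    using W by (intro exI[of _ W] exI[of _ X]) blast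
qed

end

section \<open>Almost hyper CR axioms, admissible fields and the family over the sphere\<close>

context hypersurf_triple
begin

lemma almost_hyper_CR_induced:
  assumes "CARD('m) = 4 * n + 3"
  shows "almost_hyper_CR M MU (\<lambda>a. QJ a) (\<lambda>a. IJ a)"
proof -
  have "almost_CR M MU (QJ a) (IJ a)" for a
    unfolding almost_CR_def using subbundle_QJ[of a] complex_structure_IJ[of a]
    by (auto intro!: exI[of _ "CARD('m) - 1"])
  moreover have "let H = QJ 1 p \<inter> QJ 2 p in
        {u + v | u v. u \<in> QJ 1 p \<and> v \<in> QJ 2 p} = TM p \<and>
        (\<forall>v\<in>IJ 1 p ` H \<inter> IJ 2 p ` H. IJ 1 p (IJ 2 p v) = - IJ 2 p (IJ 1 p v)) \<and>
        QJ 3 p = {u + v | u v. u \<in> IJ 1 p ` H \<and> v \<in> IJ 2 p ` H} \<and>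
        (\<forall>v\<in>IJ 1 p ` H. IJ 3 p v = - IJ 2 p (IJ 1 p v)) \<and>
        (\<forall>v\<in>IJ 2 p ` H. IJ 3 p v = IJ 1 p (IJ 2 p v))" if p: "p \<in> MU" for p
  proof -
    obtain \<xi> where q: "hyperplane p \<xi>"
      by (rule hyperplane_at[OF p])
    note Q = Q_eq[OF q]
    note 1 = quat_hyperplane.Q1_plus_Q2[OF q, unfolded Q] quat_hyperplane.I_anticommute[OF q, unfolded Q]
      quat_hyperplane.Q3_eq[OF q, unfolded Q] quat_hyperplane.I3_on_I1[OF q, unfolded Q]
      quat_hyperplane.I3_on_I2[OF q, unfolded Q]
    note 2 = quat_hyperplane.I1_image[OF q, unfolded Q] quat_hyperplane.I2_image[OF q, unfolded Q]
    show ?thesis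
      unfolding Let_def
    proof (intro conjI)
      show "\<forall>v\<in>IJ 1 p ` (QJ 1 p \<inter> QJ 2 p) \<inter> IJ 2 p ` (QJ 1 p \<inter> QJ 2 p). IJ 1 p (IJ 2 p v) = - IJ 2 p (IJ 1 p v)"
        unfolding 2 using 1(2) by blast
      show "\<forall>v\<in>IJ 1 p ` (QJ 1 p \<inter> QJ 2 p). IJ 3 p v = - IJ 2 p (IJ 1 p v)"
        unfolding 2 using 1(4) by blast
      show "\<forall>v\<in>IJ 2 p ` (QJ 1 p \<inter> QJ 2 p). IJ 3 p v = IJ 1 p (IJ 2 p v)"
        unfolding 2 using 1(5) by blast
    qed (rule 1(1), rule 1(3))
  qed
  ultimately show ?thesis unfolding almost_hyper_CR_def using assms by auto
qed

lemma admissible_iff: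
  assumes q: "hyperplane p \<xi>"
  shows "quat_hyperplane.admissible (TM p) (\<iota> p) (\<lambda>a. J a p) \<tau> \<longleftrightarrow>
    (\<forall>a. \<tau> a \<in> QJ (a + 1) p \<inter> QJ (a + 2) p \<and> \<tau> a \<notin> Qint (\<lambda>a. QJ a) p \<and> IJ a p (\<tau> (a + 1)) = \<tau> (a + 2))"
  unfolding quat_hyperplane.admissible_def[OF q] Q_eq[OF q] Qint_def ..

text \<open>The pointwise construction is made smooth by starting from one vector \<open>w\<close>
  with constant coordinates in \<open>N\<close>. If it is transversal to \<open>M\<close> at
  \<open>p\<close>, it remains so on the neighbourhood \<open>C\<close>, and correcting it to a
  normal vector uses only smooth operations.\<close>

lemma exists_admissible_triple:
  assumes p: "p \<in> MU"
  shows "\<exists>T W. openin (mtop M) W \<and> p \<in> W \<and> admissible_triple M W (\<lambda>a. QJ a) (\<lambda>a. IJ a) T"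
proof -
  have "p \<in> topspace (mtop M)" using p by blast
  then obtain c d A L \<theta> where ad: "adapted c d A L \<theta>" and pc: "p \<in> fst c" "snd c p \<in> A" "p \<in> fst d"
    by (rule adapted_at)
  note ad' = adaptedD[OF ad]
  obtain w where w: "\<theta> (snd c p) w \<noteq> 0" using ad'(7)[OF pc(2)] by blast
  define B where "B = A \<inter> snd c ` (fst c \<inter> MU)"
  have B: "open B" "snd c p \<in> B" "B \<subseteq> A"
    using M.open_chart_image[OF ad'(1) openin_MU] ad'(3) pc p by (auto simp: B_def)
  have s\<theta>: "smooth_on B (\<lambda>x. \<theta> x w)" by (rule smooth_on_subset[OF ad'(11) B(3)])
  define C where "C = B \<inter> (\<lambda>x. \<theta> x w) -` (- {0})"
  have C: "open C" "snd c p \<in> C" "C \<subseteq> A" "C \<subseteq> B"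
    using continuous_open_preimage[OF smooth_on_continuous[OF s\<theta>] B(1)] B(2,3) w by (auto simp: C_def)
  have Cq: "q \<in> fst d \<and> q \<in> MU" if q: "q \<in> fst c" "snd c q \<in> C" for q
  proof -
    have "snd c q \<in> snd c ` (fst c \<inter> MU)" using q C(4) by (auto simp: B_def)
    then have "q \<in> MU" using M.chart_image_mem[OF ad'(1), of "snd c q" MU] ad'(1) q(1) by simp
    then show ?thesis using adapted_mem[OF ad q(1)] q(2) C(3) by blast
  qed
  have CU: "C \<subseteq> snd c ` (fst c \<inter> (fst d \<inter> U))"
  proof
    fix x assume x: "x \<in> C"
    then obtain q where "q \<in> fst c" "x = snd c q" using C(3) ad'(4) by blast
    then show "x \<in> snd c ` (fst c \<inter> (fst d \<inter> U))" using Cq x by blast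
  qed
  let ?K = "\<lambda>a x v. Jc a d (transition c d x) v"
  \<comment> \<open>The coordinates of \<open>h.normal\<close> at the vector with coordinates
    \<open>w\<close>: the same formula with \<open>Jc\<close> and \<open>\<theta>\<close> in place
    of \<open>J\<close> and \<open>\<xi>\<close>.\<close>
  define m where "m x = \<theta> x w *\<^sub>R w + (\<theta> x (?K 1 x w) *\<^sub>R ?K 1 x w + (\<theta> x (?K 2 x w) *\<^sub>R ?K 2 x w
    + \<theta> x (?K 3 x w) *\<^sub>R ?K 3 x w))" for x
  have sK: "smooth_on C (\<lambda>x. ?K a x w)" for a
    by (rule smooth_Jc_along[OF ad'(1,2) C(1) CU smooth_on_const])
  have s\<theta>g: "smooth_on C (\<lambda>x. \<theta> x (g x))" if "smooth_on C g" for g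
    by (rule smooth_on_linear_family[OF C(1) _ _ that]) (use ad'(6) smooth_on_subset[OF ad'(11) C(3)] C(3) in blast)+
  have sm: "smooth_on C m"
    unfolding m_def by (intro smooth_on_add[OF C(1)] smooth_on_scaleR[OF C(1)] s\<theta>g sK smooth_on_const)
  have sT: "smooth_on C (\<lambda>x. L x (- ?K a x (m x)))" for a
    by (rule smooth_on_linear_family[OF C(1) _ _ smooth_on_minus[OF C(1) smooth_Jc_along[OF ad'(1,2) C(1) CU sm]]])
      (use ad'(5) smooth_on_subset[OF ad'(10) C(3)] C(3) in blast)+
  define W where "W = {q \<in> fst c. snd c q \<in> C}"
  have W: "openin (mtop M) W" "p \<in> W"
    unfolding W_def using M.openin_chart_preimage[OF ad'(1) C(1)] pc(1) C(2) by auto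
  define T where "T a q = lift M c q (L (snd c q) (- ?K a (snd c q) (m (snd c q))))" for a q
  have "T a \<in> vector_fields M W" for a
    unfolding T_def by (rule M.vector_field_lift[OF ad'(1) C(1) sT W(1)]) (auto simp: W_def)
  moreover have "\<forall>a. T a q \<in> QJ (a + 1) q \<inter> QJ (a + 2) q \<and> T a q \<notin> Qint (\<lambda>a. QJ a) q \<and> IJ a q (T (a + 1) q) = T (a + 2) q"
    if q: "q \<in> W" for q
  proof -
    have qc: "q \<in> fst c" "snd c q \<in> A" "snd c q \<in> C" using q C(3) by (auto simp: W_def)
    have qd: "q \<in> fst d" "q \<in> U" using Cq[OF qc(1,3)] by auto
    let ?e = "lift N d q w"
    interpret h: quat_hyperplane "TM q" "\<iota> q" "TN q" "\<lambda>a. J a q" "\<lambda>v. \<theta> (snd c q) (v d)"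
      by (rule hyperplane_adapted[OF ad qc(1,2) qd(2)])
    have eE: "?e \<in> TN q" by (rule N.lift_in[OF ad'(2) qd(1)])
    have ed: "?e d = w" by (rule N.lift_at[OF ad'(2) qd(1)])
    have e0: "\<theta> (snd c q) (?e d) \<noteq> 0" using qc(3) ed by (simp add: C_def)
    note n = h.normal[OF eE e0]
    have Jd: "J a q v d = ?K a (snd c q) (v d)" if "v \<in> TN q" for a v
      using Jc_apply[OF ad'(2) qd(1) that] by (simp add: M.transition_apply[OF ad'(1) qc(1)])
    have nd: "h.normal ?e d = m (snd c q)"
      by (simp add: h.normal_def m_def Jd[OF eE] ed)
    have "T a q = h.\<kappa> (- J a q (h.normal ?e))" for a
    proof -
      have E: "- J a q (h.normal ?e) \<in> TN q" "\<theta> (snd c q) ((- J a q (h.normal ?e)) d) = 0"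
        using n h.\<xi>_simps(3)[OF h.J_in[OF n(1)]] by auto
      then have "- J a q (h.normal ?e) \<in> \<iota> q ` TM q"
        unfolding image_\<iota>[OF ad qc(1,2)] by blast
      from inv_\<iota>_coord[OF ad qc(1,2) this]
      have "h.\<kappa> (- J a q (h.normal ?e)) c = L (snd c q) (- ?K a (snd c q) (m (snd c q)))"
        unfolding h.\<kappa>_def by (simp add: Jd[OF n(1)] nd)
      then show ?thesis
        unfolding T_def using M.lift_eq[OF ad'(1) qc(1) h.\<kappa>_in[OF E]] by (simp only:)
    qed
    then have "h.admissible (\<lambda>a. T a q)"
      using n h.\<xi>_simps(3)[OF h.J_in[OF n(1)]]
      by (intro h.admissible_normal[OF n]) (auto intro!: h.\<kappa>_in h.\<iota>_\<kappa>)
    then show ?thesis unfolding admissible_iff[OF h.quat_hyperplane_axioms] .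
  qed
  ultimately have "admissible_triple M W (\<lambda>a. QJ a) (\<lambda>a. IJ a) T"
    unfolding admissible_triple_def by blast
  then show ?thesis using W by blast
qed

text \<open>The triple chosen by \<open>admissible_at\<close> may change arbitrarily with
  \<open>p\<close>; only its value at \<open>p\<close> enters \<open>Q_vec\<close> and
  \<open>I_vec\<close>.\<close>

lemma admissible_at_point:
  assumes p: "p \<in> MU" and q: "hyperplane p \<xi>"
  shows "quat_hyperplane.admissible (TM p) (\<iota> p) (\<lambda>a. J a p)
    (\<lambda>a. admissible_at M (\<lambda>a. QJ a) (\<lambda>a. IJ a) p a p)"
proof -
  let ?T = "admissible_at M (\<lambda>a. QJ a) (\<lambda>a. IJ a) p"
  have "\<exists>W. openin (mtop M) W \<and> p \<in> W \<and> admissible_triple M W (\<lambda>a. QJ a) (\<lambda>a. IJ a) ?T"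
    unfolding admissible_at_def by (rule someI_ex[OF exists_admissible_triple[OF p]])
  then show ?thesis unfolding admissible_iff[OF q] admissible_triple_def by blast
qed

text \<open>Here \<open>v\<close> and \<open>J\<close> occur only in the combination
  \<open>\<Sum> v_a J_a\<close>. A rotation of the triple can therefore be traded for a rotation of
  \<open>v\<close>.\<close>

lemma Q_vec_induced:
  assumes p: "p \<in> MU"
  shows "Q_vec M (\<lambda>a. QJ a) (\<lambda>a. IJ a) v p =
    {u \<in> TM p. (\<Sum>a\<in>UNIV. (v $ a) *\<^sub>R J a p (\<iota> p u)) \<in> \<iota> p ` TM p}" (is ?Q)
  and I_vec_induced:
    "u \<in> Q_vec M (\<lambda>a. QJ a) (\<lambda>a. IJ a) v p \<Longrightarrow> I_vec M (\<lambda>a. QJ a) (\<lambda>a. IJ a) v p u =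
      inv_into (TM p) (\<iota> p) (\<Sum>a\<in>UNIV. (v $ a) *\<^sub>R J a p (\<iota> p u))"
proof -
  obtain \<xi> where q: "hyperplane p \<xi>"
    by (rule hyperplane_at[OF p])
  interpret h: quat_hyperplane "TM p" "\<iota> p" "TN p" "\<lambda>a. J a p" \<xi> by (rule q)
  note adm = admissible_at_point[OF p q]
  have Q: "Q_vec M (\<lambda>a. QJ a) (\<lambda>a. IJ a) v p = h.QV v"
    using h.admissible_QV[OF adm, of v] unfolding Q_vec_def Let_def Qint_def Q_eq[OF q] .
  have "(\<Sum>a\<in>UNIV. (v $ a) *\<^sub>R J a p (\<iota> p u)) \<in> TN p" if "u \<in> TM p" for u
    using that by (simp add: sum_3)
  then show ?Q unfolding Q h.QV_eq h.image_\<iota> by blast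
  assume "u \<in> Q_vec M (\<lambda>a. QJ a) (\<lambda>a. IJ a) v p"
  then show "I_vec M (\<lambda>a. QJ a) (\<lambda>a. IJ a) v p u =
      inv_into (TM p) (\<iota> p) (\<Sum>a\<in>UNIV. (v $ a) *\<^sub>R J a p (\<iota> p u))"
    using h.admissible_IV[OF adm, of u v] unfolding Q I_vec_def Let_def h.\<kappa>_def Q_eq[OF q] by blast
qed

end

section \<open>The connection in coordinates\<close>

locale torsion_free_connection = mfd N
  for N :: "('p, 'e::euclidean_space) manifold" +
  fixes D :: "('p, 'e) covderiv"
  assumes connection: "affine_connection N D" and torsion_free: "torsion_free N D"
begin

lemma
  assumes "openin (mtop N) W" "Y \<in> vector_fields N W" "p \<in> W"
  shows D_linear: "linear_on (tangent_space N p) (\<lambda>v. D p v Y)"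
    and D_in: "v \<in> tangent_space N p \<Longrightarrow> D p v Y \<in> tangent_space N p"
    and D_add: "v \<in> tangent_space N p \<Longrightarrow> Z \<in> vector_fields N W \<Longrightarrow> D p v (Y + Z) = D p v Y + D p v Z"
    and D_scale: "v \<in> tangent_space N p \<Longrightarrow> smooth_fun N W f \<Longrightarrow>
      D p v (\<lambda>q. f q *\<^sub>R Y q) = dir_deriv N p v f *\<^sub>R Y p + f p *\<^sub>R D p v Y"
    and D_cong: "v \<in> tangent_space N p \<Longrightarrow> Z \<in> vector_fields N W \<Longrightarrow> (\<And>q. q \<in> W \<Longrightarrow> Y q = Z q) \<Longrightarrow> D p v Y = D p v Z"
proof -
  have "(\<forall>p\<in>W. linear_on (tangent_space N p) (\<lambda>v. D p v Y)) \<and>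
      (\<forall>p\<in>W. \<forall>v\<in>tangent_space N p. D p v Y \<in> tangent_space N p \<and>
         (\<forall>Z\<in>vector_fields N W. D p v (Y + Z) = D p v Y + D p v Z) \<and>
         (\<forall>f. smooth_fun N W f \<longrightarrow>
            D p v (\<lambda>q. f q *\<^sub>R Y q) = dir_deriv N p v f *\<^sub>R Y p + f p *\<^sub>R D p v Y) \<and>
         (\<forall>Z\<in>vector_fields N W. (\<forall>q\<in>W. Y q = Z q) \<longrightarrow> D p v Y = D p v Z)) \<and>
      (\<forall>X\<in>vector_fields N W. (\<lambda>p. D p (X p) Y) \<in> vector_fields N W)"
    by (rule bspec[OF mp[OF spec[OF connection[unfolded affine_connection_def], of W] assms(1)] assms(2)])
  note 1 = bspec[OF conjunct1[OF this] assms(3)] and 2 = bspec[OF bspec[OF conjunct1[OF conjunct2[OF this]] assms(3)]]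
  show "linear_on (tangent_space N p) (\<lambda>v. D p v Y)" by (rule 1)
  assume "v \<in> tangent_space N p"
  note 2 = 2[OF this]
  show "D p v Y \<in> tangent_space N p" using 2 by (rule conjunct1)
  show "D p v (Y + Z) = D p v Y + D p v Z" if "Z \<in> vector_fields N W"
    by (rule bspec[OF conjunct1[OF conjunct2[OF 2]] that])
  show "D p v (\<lambda>q. f q *\<^sub>R Y q) = dir_deriv N p v f *\<^sub>R Y p + f p *\<^sub>R D p v Y" if "smooth_fun N W f"
    by (rule mp[OF spec[OF conjunct1[OF conjunct2[OF conjunct2[OF 2]]]] that])
  show "D p v Y = D p v Z" if "Z \<in> vector_fields N W" "\<And>q. q \<in> W \<Longrightarrow> Y q = Z q"
    using bspec[OF conjunct2[OF conjunct2[OF conjunct2[OF 2]]] that(1)] that(2) by simp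
qed

definition coord_field :: "'p \<Rightarrow> 'e \<Rightarrow> ('p, 'e) vfield" where
  "coord_field p w = (\<lambda>q. lift N (chart_at N p) q w)"

text \<open>The Christoffel symbols at \<open>p\<close> of the chart chosen at \<open>p\<close>.\<close>

definition \<Gamma> :: "'p \<Rightarrow> 'e \<Rightarrow> 'e \<Rightarrow> 'e" where
  "\<Gamma> p v w = D p (lift N (chart_at N p) p v) (coord_field p w) (chart_at N p)"

lemma coord_field_in:
  assumes "p \<in> topspace (mtop N)" "openin (mtop N) W" "W \<subseteq> fst (chart_at N p)"
  shows "coord_field p w \<in> vector_fields N W"
  unfolding coord_field_def
  by (rule vector_field_lift[OF _ open_UNIV smooth_on_const assms(2,3)]) (use chart_at[OF assms(1)] in auto)

lemma \<Gamma>_linear1: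
  assumes p: "p \<in> topspace (mtop N)"
  shows "linear (\<lambda>v. \<Gamma> p v w)"
proof -
  let ?d = "chart_at N p"
  have d: "?d \<in> charts N" "p \<in> fst ?d" using chart_at[OF p] by auto
  have l: "linear_on (tangent_space N p) (\<lambda>v. D p v (coord_field p w))"
    by (rule D_linear[OF openin_chart[OF d(1)] coord_field_in[OF p openin_chart[OF d(1)] subset_refl] d(2)])
  note k = linear_lift[OF d] and s = linear_on_simps[OF l subspace_tangent[OF p] lift_in[OF d]]
  show ?thesis
    by (rule linearI) (simp_all add: \<Gamma>_def linear_add[OF k] linear_scale[OF k] s lift_in[OF d])
qed

text \<open>Fields with constant coordinates in the same chart commute, so torsion-freeness equates
  the two derivatives.\<close>

lemma \<Gamma>_symmetric:
  assumes p: "p \<in> topspace (mtop N)"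
  shows "\<Gamma> p v w = \<Gamma> p w v"
proof -
  let ?d = "chart_at N p"
  have d: "?d \<in> charts N" "p \<in> fst ?d" using chart_at[OF p] by auto
  note f = coord_field_in[OF p openin_chart[OF d(1)] subset_refl]
  have "D p (coord_field p v p) (coord_field p w) - D p (coord_field p w p) (coord_field p v)
      = lie_bracket N (coord_field p v) (coord_field p w) p"
    using torsion_free openin_chart[OF d(1)] f d(2) unfolding torsion_free_def by blast
  moreover have "fderiv (local_rep ?d (coord_field p w)) (snd ?d p) = (\<lambda>u. 0)" for w
  proof -
    have "fderiv (local_rep ?d (coord_field p w)) (snd ?d p) = fderiv (\<lambda>x. w) (snd ?d p)"
      by (rule frechet_derivative_cong_open[OF open_chart[OF d(1)]])
        (use d in \<open>auto simp: local_rep_def coord_field_def\<close>)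
    then show ?thesis by simp
  qed
  ultimately have "(D p (coord_field p v p) (coord_field p w) - D p (coord_field p w p) (coord_field p v)) ?d = 0"
    using d by (simp add: lie_bracket_def)
  then show ?thesis by (simp add: \<Gamma>_def coord_field_def)
qed

text \<open>Linearity in the differentiated field follows by symmetry from linearity in the
  direction.\<close>

lemma \<Gamma>_linear2: "p \<in> topspace (mtop N) \<Longrightarrow> linear (\<Gamma> p v)"
  using \<Gamma>_linear1[of p v] \<Gamma>_symmetric[of p v] by presburger

lemma zero_field: "openin (mtop N) W \<Longrightarrow> (\<lambda>q. 0) \<in> vector_fields N W"
  using openin_subset[of "mtop N" W] subspace_0[OF subspace_tangent]
  by (auto simp: vector_fields_def local_rep_def smooth_on_const)

lemma dir_deriv_const [simp]: "dir_deriv N p v (\<lambda>q. k) = 0"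
  by (simp add: dir_deriv_def o_def)

text \<open>That the sum is a vector field is proved along with the formula, because additivity of
  \<open>D\<close> is given between fields on \<open>W\<close>.\<close>

lemma D_sum:
  assumes W: "openin (mtop N) W" "p \<in> W" and v: "v \<in> tangent_space N p"
    and "finite S" and f: "\<And>b. b \<in> S \<Longrightarrow> smooth_fun N W (f b)" and Y: "\<And>b. b \<in> S \<Longrightarrow> Y b \<in> vector_fields N W"
  shows "(\<lambda>q. \<Sum>b\<in>S. f b q *\<^sub>R Y b q) \<in> vector_fields N W \<and>
    D p v (\<lambda>q. \<Sum>b\<in>S. f b q *\<^sub>R Y b q) = (\<Sum>b\<in>S. dir_deriv N p v (f b) *\<^sub>R Y b p + f b p *\<^sub>R D p v (Y b))"
  using \<open>finite S\<close> f Y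
proof (induction S)
  case empty
  \<comment> \<open>The empty sum: with the zero field written as a multiple by 0, the Leibniz rule
    makes its derivative vanish.\<close>
  have "D p v (\<lambda>q. 0 *\<^sub>R 0) = dir_deriv N p v (\<lambda>q. 0) *\<^sub>R 0 + 0 *\<^sub>R D p v (\<lambda>q. 0)"
    by (rule D_scale[OF W(1) zero_field[OF W(1)] W(2) v smooth_fun_const])
  then have "D p v (\<lambda>q. 0) = 0" by simp
  then show ?case unfolding sum.empty using zero_field[OF W(1)] by blast
next
  case (insert b S)
  let ?Z = "\<lambda>q. \<Sum>b\<in>S. f b q *\<^sub>R Y b q"
  have b: "smooth_fun N W (f b)" "Y b \<in> vector_fields N W" using insert.prems by auto
  have IH: "?Z \<in> vector_fields N W"
    "D p v ?Z = (\<Sum>b\<in>S. dir_deriv N p v (f b) *\<^sub>R Y b p + f b p *\<^sub>R D p v (Y b))"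
    using insert.IH[OF insert.prems(1)[OF insertI2] insert.prems(2)[OF insertI2]] by blast+
  have eq: "(\<lambda>q. \<Sum>b\<in>insert b S. f b q *\<^sub>R Y b q) = (\<lambda>q. f b q *\<^sub>R Y b q) + ?Z"
    using insert.hyps by (simp add: fun_eq_iff)
  note fY = vector_field_scale[OF W(1) b(2,1)]
  show ?case
    unfolding eq D_add[OF W(1) fY W(2) v IH(1)] D_scale[OF W(1) b(2) W(2) v b(1)] IH(2)
    unfolding sum.insert[OF insert.hyps]
    by (rule conjI[OF vector_field_add[OF W(1) fY IH(1)] refl])
qed

text \<open>The field is a combination of constant coordinate fields with the components of
  \<open>g\<close> as coefficients. By the Leibniz rule the coefficients contribute the ordinary
  derivative of \<open>g\<close> and the coordinate fields the Christoffel term.\<close>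

lemma D_coord:
  assumes p: "p \<in> topspace (mtop N)" and A: "open A" "snd (chart_at N p) p \<in> A" and g: "smooth_on A g"
    and v: "v \<in> tangent_space N p"
  shows "D p v (\<lambda>q. lift N (chart_at N p) q (g (snd (chart_at N p) q))) (chart_at N p) =
    fderiv g (snd (chart_at N p) p) (v (chart_at N p)) + \<Gamma> p (v (chart_at N p)) (g (snd (chart_at N p) p))"
proof -
  let ?d = "chart_at N p"
  let ?y = "snd ?d p"
  have d: "?d \<in> charts N" "p \<in> fst ?d" using chart_at[OF p] by auto
  define W where "W = {q \<in> fst ?d. snd ?d q \<in> A}"
  have W: "openin (mtop N) W" "p \<in> W" "W \<subseteq> fst ?d"
    unfolding W_def using openin_chart_preimage[OF d(1) A(1)] d A by auto
  define f where "f b q = g (snd ?d q) \<bullet> b" for b q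
  let ?B = "snd ?d ` (fst ?d \<inter> W)"
  have B: "open ?B" "?y \<in> ?B" by (rule open_chart_image[OF d(1) W(1)]) (use d W in auto)
  have sg: "smooth_on ?B g" by (rule smooth_on_subset[OF g]) (auto simp: W_def)
  have fg: "(f b \<circ> chart_inv ?d) x = g x \<bullet> b" if "x \<in> ?B" for x b
    using that d by (auto simp: f_def)
  have sgb: "smooth_on ?B (\<lambda>x. g x \<bullet> b)" for b by (rule smooth_on_inner[OF B(1) sg smooth_on_const])
  have f: "smooth_fun N W (f b)" for b
  proof (rule smooth_funI[OF W(1)])
    fix q assume q: "q \<in> W"
    have "smooth_on ?B (f b \<circ> chart_inv ?d)" by (rule smooth_on_eq[OF sgb B(1) fg])
    then show "\<exists>c A. c \<in> charts N \<and> q \<in> fst c \<and> open A \<and> snd c q \<in> A \<and> smooth_on A (f b \<circ> chart_inv c)"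
      using d(1) q W(3) B(1) by blast
  qed
  have df: "dir_deriv N p v (f b) = fderiv g ?y (v ?d) \<bullet> b" for b
  proof -
    have "fderiv (f b \<circ> chart_inv ?d) ?y = fderiv (\<lambda>x. g x \<bullet> b) ?y"
      by (rule frechet_derivative_cong_open[OF B fg])
    also have "\<dots> = (\<lambda>u. fderiv g ?y u \<bullet> b)"
      using frechet_derivative_at[OF has_derivative_inner_left[OF smooth_on_has_derivative[OF sg B(2)], of b]] by (rule sym)
    finally show ?thesis by (simp add: dir_deriv_def)
  qed
  have Y: "coord_field p b \<in> vector_fields N W" for b by (rule coord_field_in[OF p W(1,3)])
  have eq: "lift N ?d q (g (snd ?d q)) = (\<Sum>b\<in>Basis. f b q *\<^sub>R coord_field p b q)" if q: "q \<in> W" for q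
    unfolding f_def coord_field_def using linear_Basis_expansion[OF linear_lift[OF d(1)]] q W(3) by blast
  note S = D_sum[OF W(1,2) v finite_Basis, of f "coord_field p", OF f Y]
  have "D p v (\<lambda>q. lift N ?d q (g (snd ?d q))) = D p v (\<lambda>q. \<Sum>b\<in>Basis. f b q *\<^sub>R coord_field p b q)"
    by (rule D_cong[OF W(1) vector_field_lift[OF d(1) A(1) g W(1,3)] W(2) v S[THEN conjunct1] eq]) (auto simp: W_def)
  also have "\<dots> = (\<Sum>b\<in>Basis. dir_deriv N p v (f b) *\<^sub>R coord_field p b p + f b p *\<^sub>R D p v (coord_field p b))"
    using S by blast
  finally have "D p v (\<lambda>q. lift N ?d q (g (snd ?d q))) ?d =
      (\<Sum>b\<in>Basis. dir_deriv N p v (f b) *\<^sub>R coord_field p b p + f b p *\<^sub>R D p v (coord_field p b)) ?d" by simp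
  also have "\<dots> = (\<Sum>b\<in>Basis. dir_deriv N p v (f b) *\<^sub>R b + f b p *\<^sub>R D p v (coord_field p b) ?d)"
    using d by (simp add: sum_fun_apply coord_field_def)
  also have "\<dots> = (\<Sum>b\<in>Basis. (fderiv g ?y (v ?d) \<bullet> b) *\<^sub>R b) + (\<Sum>b\<in>Basis. (g ?y \<bullet> b) *\<^sub>R \<Gamma> p (v ?d) b)"
    unfolding df sum.distrib using d v by (simp add: f_def \<Gamma>_def)
  also have "\<dots> = fderiv g ?y (v ?d) + \<Gamma> p (v ?d) (g ?y)"
    using linear_Basis_expansion[OF \<Gamma>_linear2[OF p], of "v ?d" "g ?y"] by (simp add: euclidean_representation)
  finally show ?thesis .
qed

end

section \<open>Integrability\<close>

context quat_hyperplane
begin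

text \<open>The largest subspace of the kernel of \<open>\<xi>\<close> stable under all
  \<open>J a\<close>; under \<open>\<iota>\<close> it corresponds to the intersection of the three
  \<open>Q a\<close>.\<close>

definition "H = {e \<in> E. \<xi> e = 0 \<and> (\<forall>a. \<xi> (J a e) = 0)}"

lemma H_closed:
  "u \<in> H \<Longrightarrow> v \<in> H \<Longrightarrow> u + v \<in> H" "u \<in> H \<Longrightarrow> v \<in> H \<Longrightarrow> u - v \<in> H" "u \<in> H \<Longrightarrow> r *\<^sub>R u \<in> H"
  "u \<in> H \<Longrightarrow> - u \<in> H"
  by (auto simp: H_def)

lemma J_in_H: "e \<in> H \<Longrightarrow> J a e \<in> H"
  using exhaust_3[of a] unfolding H_def forall_3 by auto

lemma sum_J_in_H: "e \<in> H \<Longrightarrow> (\<Sum>b\<in>UNIV. r b *\<^sub>R J b e) \<in> H"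
  unfolding sum_3 by (intro H_closed J_in_H)

lemma \<iota>_in_H_iff: "v \<in> T \<Longrightarrow> \<iota> v \<in> H \<longleftrightarrow> v \<in> Q 1 \<inter> Q 2 \<inter> Q 3"
  unfolding Qint_iff by (auto simp: H_def)

text \<open>\<open>xy, yx, \<dots>\<close> stand for the covariant derivatives of \<open>X, I\<^sub>a X, Y, I\<^sub>a Y\<close> along each other,
  a prime marking the application of \<open>I\<^sub>a\<close>.\<close>

lemma integrability_algebra:
  assumes T: "Z \<in> T" "u1 \<in> T" "u2 \<in> T" and E: "xy \<in> E" "yx \<in> E" "x'y \<in> E" "y'x \<in> E"
    and H: "e1 \<in> H" "e2 \<in> H" "e3 \<in> H" "e4 \<in> H"
    and Z: "\<iota> Z = (xy - yx) - (x'y' - y'x')" and u: "\<iota> u1 = xy' - y'x" "\<iota> u2 = x'y - yx'"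
    and eq: "xy' = J a xy + e1" "x'y' = J a x'y + e2" "yx' = J a yx + e3" "y'x' = J a y'x + e4"
  shows "Z \<in> Q a" "I a Z - u1 - u2 \<in> Q 1 \<inter> Q 2 \<inter> Q 3"
proof -
  have e: "e1 \<in> E" "e2 \<in> E" "e3 \<in> E" "e4 \<in> E" using H by (auto simp: H_def)
  \<comment> \<open>All eight derivatives cancel because \<open>J a\<close> squares to -1; what
    remains are the error terms.\<close>
  have "J a (\<iota> Z) - \<iota> u1 - \<iota> u2 = J a e4 - J a e2 - e1 + e3"
    unfolding Z u eq using E e by simp
  also have "\<dots> \<in> H" by (intro H_closed J_in_H H)
  finally have R: "J a (\<iota> Z) - \<iota> u1 - \<iota> u2 \<in> H" .
  \<comment> \<open>\<open>\<xi>\<close> kills both \<open>H\<close> and the tangent vectors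
    \<open>\<iota> u1\<close>, \<open>\<iota> u2\<close>, hence also \<open>J a (\<iota> Z)\<close>.
    The first integrability condition is thus a consequence of the second tensor lying in
    \<open>H\<close>.\<close>
  then have "\<xi> (J a (\<iota> Z)) = 0" using T by (simp add: H_def)
  then show Q: "Z \<in> Q a" using T by (simp add: Q_iff)
  have I: "I a Z \<in> T" by (rule I_in[OF Q])
  then have "\<iota> (I a Z - u1 - u2) \<in> H" using R T \<iota>_I[OF Q] by simp
  moreover have "I a Z - u1 - u2 \<in> T" using I T by simp
  ultimately show "I a Z - u1 - u2 \<in> Q 1 \<inter> Q 2 \<inter> Q 3" using \<iota>_in_H_iff by metis
qed

end

section \<open>Rotated triples and the hypotheses on the connection\<close>

lemma rotation_combination_invert:
  fixes S :: "real^'n^'n" and j k :: "'n \<Rightarrow> 'b::real_vector"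
  assumes "rotation_matrix S" and j: "\<And>a. j a = (\<Sum>b\<in>UNIV. (S $ b $ a) *\<^sub>R k b)"
  shows "k c = (\<Sum>a\<in>UNIV. (S $ c $ a) *\<^sub>R j a)"
proof -
  have "S ** transpose S = mat 1"
    using assms(1) by (simp add: rotation_matrix_def orthogonal_matrix_def)
  then have orth: "(\<Sum>b\<in>UNIV. S $ c $ b * S $ e $ b) = (if c = e then 1 else 0)" for c e
    by (simp add: vec_eq_iff matrix_matrix_mult_def transpose_def mat_def)
  have "(\<Sum>a\<in>UNIV. (S $ c $ a) *\<^sub>R j a) = (\<Sum>a\<in>UNIV. \<Sum>e\<in>UNIV. (S $ c $ a * S $ e $ a) *\<^sub>R k e)"
    unfolding j scaleR_sum_right scaleR_scaleR ..
  also have "\<dots> = (\<Sum>e\<in>UNIV. (\<Sum>a\<in>UNIV. S $ c $ a * S $ e $ a) *\<^sub>R k e)"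
    unfolding scaleR_sum_left by (rule sum.swap)
  also have "\<dots> = (\<Sum>e\<in>UNIV. if c = e then k e else 0)"
    unfolding orth by (rule sum.cong) simp_all
  also have "\<dots> = k c" by simp
  finally show ?thesis by (rule sym)
qed

lemma SO3_relatedE:
  assumes "SO3_related N V K U J"
  obtains S :: "'p \<Rightarrow> real^3^3" where "smooth_fun N (V \<inter> U) S"
    "\<And>q. q \<in> V \<inter> U \<Longrightarrow> rotation_matrix (S q)"
    "\<And>q a v. q \<in> V \<inter> U \<Longrightarrow> v \<in> tangent_space N q \<Longrightarrow> J a q v = (\<Sum>b\<in>UNIV. (S q $ b $ a) *\<^sub>R K b q v)"
proof -
  obtain S :: "'p \<Rightarrow> real^3^3" where S: "smooth_fun N (V \<inter> U) S" "\<forall>q\<in>V \<inter> U. rotation_matrix (S q) \<and>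
      (\<forall>a. \<forall>v\<in>tangent_space N q. J a q v = (\<Sum>b\<in>UNIV. (S q $ b $ a) *\<^sub>R K b q v))"
    using assms unfolding SO3_related_def by (elim exE conjE)
  show thesis
  proof (rule that[OF S(1)])
    show "rotation_matrix (S q)" if "q \<in> V \<inter> U" for q using bspec[OF S(2) that] by (rule conjunct1)
    show "J a q v = (\<Sum>b\<in>UNIV. (S q $ b $ a) *\<^sub>R K b q v)" if "q \<in> V \<inter> U" "v \<in> tangent_space N q" for q a v
      by (rule bspec[OF spec[OF conjunct2[OF bspec[OF S(2) that(1)]]] that(2)])
  qed
qed

lemma preserves_tripleE:
  assumes "preserves_triple N D V K"
  obtains \<gamma> where "\<And>W Y a p v. openin (mtop N) W \<Longrightarrow> W \<subseteq> V \<Longrightarrow> Y \<in> vector_fields N W \<Longrightarrow> p \<in> W \<Longrightarrow>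
      v \<in> tangent_space N p \<Longrightarrow> D p v (app (K a) Y) - K a p (D p v Y) = (\<Sum>b\<in>UNIV. \<gamma> a b p v *\<^sub>R K b p (Y p))"
proof -
  obtain \<gamma> where \<gamma>: "\<forall>W Y. openin (mtop N) W \<and> W \<subseteq> V \<and> Y \<in> vector_fields N W \<longrightarrow>
      (\<forall>a. \<forall>p\<in>W. \<forall>v\<in>tangent_space N p.
        D p v (app (K a) Y) - K a p (D p v Y) = (\<Sum>b\<in>UNIV. \<gamma> a b p v *\<^sub>R K b p (Y p)))"
    using assms unfolding preserves_triple_def by (elim exE conjE)
  show thesis
  proof (rule that)
    fix W Y a p v assume *: "openin (mtop N) W" "W \<subseteq> V" "Y \<in> vector_fields N W" "p \<in> W" "v \<in> tangent_space N p"
    show "D p v (app (K a) Y) - K a p (D p v Y) = (\<Sum>b\<in>UNIV. \<gamma> a b p v *\<^sub>R K b p (Y p))"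
      by (rule bspec[OF bspec[OF spec[OF mp[OF spec[OF spec[OF \<gamma>, of W], of Y]]] *(4)] *(5)]) (use * in blast)
  qed
qed

section \<open>Covariant derivatives along the hypersurface\<close>

locale quat_hypersurf = hypersurf_triple M N U J + C: torsion_free_connection N D
  for M :: "('p, real^'m) manifold" and N :: "('p, real^'k) manifold"
    and U :: "'p set" and J :: "3 \<Rightarrow> ('p, real^'k) endo" and D :: "('p, real^'k) covderiv" +
  fixes \<T> :: "('p set \<times> (3 \<Rightarrow> ('p, real^'k) endo)) set"
  assumes cover: "(\<Union>(V, K)\<in>\<T>. V) = topspace (mtop N)"
    and triples: "(V, K) \<in> \<T> \<Longrightarrow> local_quaternionic_triple N V K"
    and preserves: "(V, K) \<in> \<T> \<Longrightarrow> preserves_triple N D V K"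
    and related: "(V, K) \<in> \<T> \<Longrightarrow> SO3_related N V K U J"
begin

text \<open>Near \<open>p\<close> the field \<open>J a E\<close> is a combination of the
  \<open>K b E\<close>, with \<open>K\<close> a member of \<open>\<T>\<close> and entries of a
  rotation as coefficients. The Leibniz rule produces derivatives of these entries and the
  connection forms of \<open>K\<close>, all multiplying some \<open>K c E\<close>; the inverse
  rotation rewrites the result in terms of the \<open>J b E\<close>.\<close>

lemma D_J:
  assumes p: "p \<in> topspace (mtop N)" "p \<in> U" and v: "v \<in> TN p"
  shows "\<exists>\<epsilon>. D p v (app (J a) (C.coord_field p w)) =
    J a p (D p v (C.coord_field p w)) + (\<Sum>b\<in>UNIV. \<epsilon> b *\<^sub>R J b p (C.coord_field p w p))"
proof -
  let ?d = "chart_at N p"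
  have d: "?d \<in> charts N" "p \<in> fst ?d" using N.chart_at[OF p(1)] by auto
  have "p \<in> (\<Union>(V, K)\<in>\<T>. V)" unfolding cover by (rule p(1))
  then obtain V K where VK: "(V, K) \<in> \<T>" "p \<in> V" by auto
  interpret K: hypersurf_triple M N V K
    using triples[OF VK(1)] by unfold_locales
  obtain S :: "'p \<Rightarrow> real^3^3" where S: "smooth_fun N (V \<inter> U) S"
    "\<And>q. q \<in> V \<inter> U \<Longrightarrow> rotation_matrix (S q)"
    "\<And>q a v. q \<in> V \<inter> U \<Longrightarrow> v \<in> TN q \<Longrightarrow> J a q v = (\<Sum>b\<in>UNIV. (S q $ b $ a) *\<^sub>R K b q v)"
    by (rule SO3_relatedE[OF related[OF VK(1)]]) (rule that)
  obtain \<gamma> where \<gamma>: "\<And>W Y a p v. openin (mtop N) W \<Longrightarrow> W \<subseteq> V \<Longrightarrow> Y \<in> vector_fields N W \<Longrightarrow> p \<in> W \<Longrightarrow>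
      v \<in> TN p \<Longrightarrow> D p v (app (K a) Y) - K a p (D p v Y) = (\<Sum>b\<in>UNIV. \<gamma> a b p v *\<^sub>R K b p (Y p))"
    by (rule preserves_tripleE[OF preserves[OF VK(1)]]) (rule that)
  define W where "W = V \<inter> U \<inter> fst ?d"
  have W: "openin (mtop N) W" "p \<in> W" "W \<subseteq> V" "W \<subseteq> U" "W \<subseteq> V \<inter> U" "W \<subseteq> fst ?d"
    using K.openin_U openin_U N.openin_chart[OF d(1)] VK(2) p d by (auto simp: W_def)
  let ?E = "C.coord_field p w"
  have E: "?E \<in> vector_fields N W" by (rule C.coord_field_in[OF p(1) W(1,6)])
  have ET: "?E q \<in> TN q" if "q \<in> W" for q by (rule N.vector_field_tangent[OF E that])
  have KE: "app (K b) ?E \<in> vector_fields N W" for b by (rule K.J_field[OF W(1,3) E])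
  define f where "f b q = S q $ b $ a" for b q
  have f: "smooth_fun N W (f b)" for b
    unfolding smooth_fun_def
  proof
    fix c assume c: "c \<in> charts N"
    have o: "open (snd c ` (fst c \<inter> W))" by (rule N.open_chart_image[OF c W(1)])
    have "smooth_on (snd c ` (fst c \<inter> W)) (S \<circ> chart_inv c)"
      by (rule smooth_on_subset[of "snd c ` (fst c \<inter> (V \<inter> U))"]) (use S(1) c W(5) in \<open>auto simp: smooth_fun_def\<close>)
    from smooth_on_nth[OF o smooth_on_nth[OF o this]]
    show "smooth_on (snd c ` (fst c \<inter> W)) (f b \<circ> chart_inv c)" by (simp add: f_def o_def)
  qed
  have eq: "app (J a) ?E q = (\<Sum>b\<in>UNIV. f b q *\<^sub>R app (K b) ?E q)" if "q \<in> W" for q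
    unfolding app_def f_def by (rule S(3)[OF subsetD[OF W(5) that] ET[OF that]])
  note Ds = C.D_sum[OF W(1,2) v finite_class.finite_UNIV, of f "\<lambda>b. app (K b) ?E", OF f KE]
  define k where "k b = K b p (?E p)" for b
  have DK: "D p v (app (K b) ?E) = K b p (D p v ?E) + (\<Sum>c\<in>UNIV. \<gamma> b c p v *\<^sub>R k c)" for b
    using \<gamma>[OF W(1,3) E W(2) v, of b] unfolding k_def diff_eq_eq by (simp only: add.commute)
  have DE: "D p v ?E \<in> TN p" by (rule C.D_in[OF W(1) E W(2) v])
  \<comment> \<open>The coefficient of \<open>k c\<close> in the error: the derivative of a rotation
    entry plus the connection forms weighted by the rotation.\<close>
  define h where "h c = dir_deriv N p v (f c) + (\<Sum>b\<in>UNIV. f b p * \<gamma> b c p v)" for c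
  have "D p v (app (J a) ?E) = D p v (\<lambda>q. \<Sum>b\<in>UNIV. f b q *\<^sub>R app (K b) ?E q)"
    by (rule C.D_cong[OF W(1) J_field[OF W(1,4) E] W(2) v conjunct1[OF Ds] eq])
  also have "\<dots> = (\<Sum>b\<in>UNIV. dir_deriv N p v (f b) *\<^sub>R app (K b) ?E p + f b p *\<^sub>R D p v (app (K b) ?E))"
    by (rule conjunct2[OF Ds])
  also have "\<dots> = (\<Sum>b\<in>UNIV. f b p *\<^sub>R K b p (D p v ?E)) + ((\<Sum>b\<in>UNIV. dir_deriv N p v (f b) *\<^sub>R k b) +
      (\<Sum>b\<in>UNIV. \<Sum>c\<in>UNIV. (f b p * \<gamma> b c p v) *\<^sub>R k c))"
    unfolding DK scaleR_add_right sum.distrib scaleR_sum_right scaleR_scaleR by (simp add: app_def k_def)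
  also have "(\<Sum>b\<in>UNIV. \<Sum>c\<in>UNIV. (f b p * \<gamma> b c p v) *\<^sub>R k c) = (\<Sum>c\<in>UNIV. (\<Sum>b\<in>UNIV. f b p * \<gamma> b c p v) *\<^sub>R k c)"
    unfolding scaleR_sum_left by (rule sum.swap)
  also have "(\<Sum>b\<in>UNIV. dir_deriv N p v (f b) *\<^sub>R k b) + \<dots> = (\<Sum>c\<in>UNIV. h c *\<^sub>R k c)"
    unfolding h_def scaleR_add_left sum.distrib ..
  also have "(\<Sum>b\<in>UNIV. f b p *\<^sub>R K b p (D p v ?E)) = J a p (D p v ?E)"
    unfolding f_def by (rule S(3)[OF subsetD[OF W(5,2)] DE, symmetric])
  also have "(\<Sum>c\<in>UNIV. h c *\<^sub>R k c) = (\<Sum>b\<in>UNIV. (\<Sum>c\<in>UNIV. h c * S p $ c $ b) *\<^sub>R J b p (?E p))"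
  proof -
    have pVU: "p \<in> V \<inter> U" using W(2,5) by blast
    have Jk: "J b p (?E p) = (\<Sum>c\<in>UNIV. (S p $ c $ b) *\<^sub>R k c)" for b
      unfolding k_def by (rule S(3)[OF pVU ET[OF W(2)]])
    have k: "k c = (\<Sum>b\<in>UNIV. (S p $ c $ b) *\<^sub>R J b p (?E p))" for c
      by (rule rotation_combination_invert[OF S(2)[OF pVU] Jk])
    have "(\<Sum>c\<in>UNIV. h c *\<^sub>R k c) = (\<Sum>c\<in>UNIV. \<Sum>b\<in>UNIV. (h c * S p $ c $ b) *\<^sub>R J b p (?E p))"
      by (subst k) (simp only: scaleR_sum_right scaleR_scaleR)
    also have "\<dots> = (\<Sum>b\<in>UNIV. (\<Sum>c\<in>UNIV. h c * S p $ c $ b) *\<^sub>R J b p (?E p))"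
      unfolding scaleR_sum_left by (rule sum.swap)
    finally show ?thesis .
  qed
  finally show ?thesis by (intro exI[of _ "\<lambda>b. \<Sum>c\<in>UNIV. h c * S p $ c $ b"])
qed

text \<open>\<open>D_J\<close> for a field with constant coordinates \<open>w\<close>, written out
  in the chart at \<open>p\<close>. The left-hand side is the covariant derivative of
  \<open>J a\<close> applied to that field, and its derivative part concerns only the matrix of
  \<open>J a\<close>; this form can be composed with the inclusion.\<close>

lemma J_coord_derivative:
  assumes p: "p \<in> topspace (mtop N)" "p \<in> U"
  shows "\<exists>\<epsilon>. lift N (chart_at N p) p (fderiv (\<lambda>y. Jc a (chart_at N p) y w) (snd (chart_at N p) p) u
      + C.\<Gamma> p u (Jc a (chart_at N p) (snd (chart_at N p) p) w)) =
    J a p (lift N (chart_at N p) p (C.\<Gamma> p u w)) + (\<Sum>b\<in>UNIV. \<epsilon> b *\<^sub>R J b p (lift N (chart_at N p) p w))"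
proof -
  let ?d = "chart_at N p"
  let ?y = "snd ?d p" and ?v = "lift N ?d p u"
  have d: "?d \<in> charts N" "p \<in> fst ?d" using N.chart_at[OF p(1)] by auto
  let ?W = "fst ?d \<inter> U" and ?A = "snd ?d ` (fst ?d \<inter> U)"
  have W: "openin (mtop N) ?W" "p \<in> ?W" using openin_U N.openin_chart[OF d(1)] p d by auto
  have A: "open ?A" "?y \<in> ?A" using N.open_chart_image[OF d(1) openin_U] W(2) by auto
  have v: "?v \<in> TN p" "?v ?d = u" using N.lift_in[OF d] N.lift_at[OF d] by auto
  note E = C.coord_field_in[OF p(1) W(1) Int_lower1, of w]
  have F: "(\<lambda>q. lift N ?d q (Jc a ?d (snd ?d q) w)) \<in> vector_fields N ?W"
    by (rule N.vector_field_lift[OF d(1) A(1) smooth_Jc[OF d(1)] W(1)]) auto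
  have eq: "app (J a) (C.coord_field p w) q = lift N ?d q (Jc a ?d (snd ?d q) w)" if q: "q \<in> ?W" for q
  proof -
    have q': "q \<in> fst ?d" "q \<in> U" using q by auto
    have "J a q (lift N ?d q w) \<in> TN q" by (rule J_point(2)[OF q'(2) N.lift_in[OF d(1) q'(1)]])
    from N.lift_eq[OF d(1) q'(1) this] show ?thesis
      using Jc_apply[OF d(1) q'(1) N.lift_in[OF d(1) q'(1)], of a w] N.lift_at[OF d(1) q'(1)]
      by (simp add: app_def C.coord_field_def)
  qed
  have De: "D p ?v (app (J a) (C.coord_field p w)) ?d =
      fderiv (\<lambda>y. Jc a ?d y w) ?y u + C.\<Gamma> p u (Jc a ?d ?y w)"
    using C.D_coord[OF p(1) A smooth_Jc[OF d(1)] v(1), of a w]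
      C.D_cong[OF W(1) J_field[OF W(1) Int_lower2 E] W(2) v(1) F eq] v(2) by simp
  obtain \<epsilon> where \<epsilon>: "D p ?v (app (J a) (C.coord_field p w)) =
    J a p (D p ?v (C.coord_field p w)) + (\<Sum>b\<in>UNIV. \<epsilon> b *\<^sub>R J b p (C.coord_field p w p))"
    using D_J[OF p v(1)] by blast
  have 1: "lift N ?d p (D p ?v (app (J a) (C.coord_field p w)) ?d) = D p ?v (app (J a) (C.coord_field p w))"
    by (rule N.lift_eq[OF d C.D_in[OF W(1) J_field[OF W(1) Int_lower2 E] W(2) v(1)]])
  have 2: "lift N ?d p (C.\<Gamma> p u w) = D p ?v (C.coord_field p w)"
    unfolding C.\<Gamma>_def by (rule N.lift_eq[OF d C.D_in[OF W(1) E W(2) v(1)]])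
  have 3: "C.coord_field p w p = lift N ?d p w" by (simp add: C.coord_field_def)
  show ?thesis
    unfolding 1[unfolded De] 2 using \<epsilon>[unfolded 3] by (intro exI[of _ \<epsilon>])
qed

text \<open>The image of \<open>X\<close> under the inclusion as a field along \<open>M\<close>:
  values in the coordinates of \<open>N\<close>, argument in the coordinates of
  \<open>M\<close>.\<close>

definition push :: "('p, real^'m) chart \<Rightarrow> ('p, real^'k) chart \<Rightarrow> ('p, real^'m) vfield \<Rightarrow> real^'m \<Rightarrow> real^'k" where
  "push c d X x = fderiv (transition c d) x (local_rep c X x)"

text \<open>The covariant derivative along the hypersurface of a tangent vector field, computed without
  extending the field to \<open>N\<close>.\<close>

definition cov where
  "cov c p X Y = lift N (chart_at N p) p
     (fderiv (push c (chart_at N p) Y) (snd c p) (X p c)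
      + C.\<Gamma> p (Di c (chart_at N p) p (X p c)) (push c (chart_at N p) Y (snd c p)))"

lemma smooth_push:
  assumes c: "c \<in> charts M" and d: "d \<in> charts N" and W: "openin (mtop M) W" and X: "X \<in> vector_fields M W"
  shows "smooth_on (snd c ` (fst c \<inter> (fst d \<inter> W))) (push c d X)"
proof -
  let ?A = "snd c ` (fst c \<inter> (fst d \<inter> W))"
  have "openin (mtop M) (fst d \<inter> W)" using openin_M_Int[OF W N.openin_chart[OF d]] by (simp add: Int_commute)
  then have A: "open ?A" by (rule M.open_chart_image[OF c])
  have "smooth_on ?A (local_rep c X)" by (rule smooth_on_subset[OF M.vector_field_smooth[OF X c]]) auto
  moreover have "smooth_on ?A (transition c d)" by (rule smooth_on_subset[OF smooth_inclusion[OF c d]]) auto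
  ultimately show ?thesis unfolding push_def by (intro smooth_on_derivative_compose[OF A A _ smooth_on_ident])
qed

text \<open>The derivative parts give the pushed bracket by \<open>bracket_pushforward\<close>, now
  applied to the inclusion, and the Christoffel terms cancel by symmetry.\<close>

lemma lie_bracket_cov:
  assumes W: "openin (mtop M) W" and XY: "X \<in> vector_fields M W" "Y \<in> vector_fields M W" and p: "p \<in> W"
    and c: "c \<in> charts M" "p \<in> fst c"
  shows "\<iota> p (lie_bracket M X Y p) = cov c p X Y - cov c p Y X"
proof -
  let ?d = "chart_at N p"
  have pN: "p \<in> topspace (mtop N)" using M.openin_topspace_fst[OF c] topspace_subset by blast
  have d: "?d \<in> charts N" "p \<in> fst ?d" using N.chart_at[OF pN] by auto
  let ?A = "snd c ` (fst c \<inter> (fst ?d \<inter> W))"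
  have "openin (mtop M) (fst ?d \<inter> W)" using openin_M_Int[OF W N.openin_chart[OF d(1)]] by (simp add: Int_commute)
  then have A: "open ?A" "snd c p \<in> ?A" using M.open_chart_image[OF c(1)] c d p by auto
  have sX: "smooth_on ?A (local_rep c X)" if "X \<in> vector_fields M W" for X
    by (rule smooth_on_subset[OF M.vector_field_smooth[OF that c(1)]]) auto
  have s\<phi>: "smooth_on ?A (transition c ?d)" by (rule smooth_on_subset[OF smooth_inclusion[OF c(1) d(1)]]) auto
  note b = bracket_pushforward[OF A s\<phi> sX[OF XY(1)] sX[OF XY(2)]]
  have lr: "local_rep c X (snd c p) = X p c" for X by (rule M.local_rep_apply[OF c])
  have B: "lie_bracket M X Y p \<in> TM p"
    by (rule M.vector_field_tangent[OF M.lie_bracket_in_vector_fields[OF W XY] p])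
  have "\<iota> p (lie_bracket M X Y p) = lift N ?d p (Di c ?d p (lie_bracket M X Y p c))"
    by (rule \<iota>_eq_lift[OF c d B])
  also have "Di c ?d p (lie_bracket M X Y p c) =
      fderiv (push c ?d Y) (snd c p) (X p c) - fderiv (push c ?d X) (snd c p) (Y p c)"
    using b c unfolding lr push_def[abs_def] by (simp add: lie_bracket_def)
  also have "\<dots> = (fderiv (push c ?d Y) (snd c p) (X p c) + C.\<Gamma> p (Di c ?d p (X p c)) (push c ?d Y (snd c p)))
      - (fderiv (push c ?d X) (snd c p) (Y p c) + C.\<Gamma> p (Di c ?d p (Y p c)) (push c ?d X (snd c p)))"
    unfolding push_def lr using C.\<Gamma>_symmetric[OF pN] by simp
  finally show ?thesis
    unfolding cov_def linear_diff[OF N.linear_lift[OF d]] .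
qed

text \<open>Pushing \<open>I a Y\<close> forward is applying the matrix \<open>Jc\<close> to the
  pushed \<open>Y\<close>. The Leibniz rule separates the derivative of \<open>Jc\<close> along the
  inclusion, which by the chain rule is a derivative on \<open>N\<close> in the direction of the
  pushed \<open>X\<close> and is thus covered by \<open>J_coord_derivative\<close>.\<close>

lemma cov_J:
  assumes W: "openin (mtop M) W" "W \<subseteq> MU" and X: "X \<in> vector_fields M W" and Y: "Y \<in> sections M W (QJ a)" and p: "p \<in> W"
    and c: "c \<in> charts M" "p \<in> fst c"
  shows "\<exists>\<epsilon>. cov c p X (app (IJ a) Y) = J a p (cov c p X Y) + (\<Sum>b\<in>UNIV. \<epsilon> b *\<^sub>R J b p (\<iota> p (Y p)))"
proof -
  let ?d = "chart_at N p" and ?\<phi> = "transition c (chart_at N p)"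
  let ?x = "snd c p" and ?y = "snd (chart_at N p) p"
  have YV: "Y \<in> vector_fields M W" and YQ: "\<And>q. q \<in> W \<Longrightarrow> Y q \<in> QJ a q" using Y by (auto simp: sections_def)
  have pU: "p \<in> U" and pM: "p \<in> topspace (mtop M)" using p W(2) by auto
  have pN: "p \<in> topspace (mtop N)" using pM topspace_subset by blast
  have d: "?d \<in> charts N" "p \<in> fst ?d" using N.chart_at[OF pN] by auto
  let ?A = "snd c ` (fst c \<inter> (fst ?d \<inter> W))"
  have "openin (mtop M) (fst ?d \<inter> W)" using openin_M_Int[OF W(1) N.openin_chart[OF d(1)]] by (simp add: Int_commute)
  then have A: "open ?A" "?x \<in> ?A" using M.open_chart_image[OF c(1)] c d p by auto
  have AU: "?A \<subseteq> snd c ` (fst c \<inter> (fst ?d \<inter> U))" using W(2) by blast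
  have Ad: "?A \<subseteq> snd c ` (fst c \<inter> fst ?d)" by blast
  have \<phi>x: "?\<phi> ?x = ?y" by (rule M.transition_apply[OF c])
  have sY: "smooth_on ?A (push c ?d Y)" by (rule smooth_push[OF c(1) d(1) W(1) YV])
  have push_p: "push c ?d Z (snd c q) = \<iota> q (Z q) ?d"
    if "Z q \<in> TM q" "q \<in> fst c" "q \<in> fst ?d" for Z q
    unfolding push_def \<iota>_apply[OF c(1) that(2) d(1) that(3,1)] M.local_rep_apply[OF c(1) that(2)] ..
  have pushI: "push c ?d (app (IJ a) Y) x = Jc a ?d (?\<phi> x) (push c ?d Y x)" if x: "x \<in> ?A" for x
  proof -
    obtain q where q: "q \<in> fst c" "q \<in> fst ?d" "q \<in> W" "x = snd c q" using x by blast
    have qU: "q \<in> MU" using q(3) W(2) by blast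
    obtain \<xi> where h: "hyperplane q \<xi>"
      by (rule hyperplane_at[OF qU])
    have YT: "Y q \<in> TM q" by (rule M.vector_field_tangent[OF YV q(3)])
    have YN: "\<iota> q (Y q) \<in> TN q" using \<iota>_in[OF _ YT] qU by blast
    have IT: "IJ a q (Y q) \<in> TM q" and II: "\<iota> q (IJ a q (Y q)) = J a q (\<iota> q (Y q))"
      using quat_hyperplane.I_in[OF h, of "Y q" a] quat_hyperplane.\<iota>_I[OF h, of "Y q" a] YQ[OF q(3)]
      unfolding Q_eq[OF h] by blast+
    have "push c ?d (app (IJ a) Y) x = J a q (\<iota> q (Y q)) ?d"
      using push_p[of "app (IJ a) Y", OF _ q(1,2)] IT II unfolding app_def q(4) by simp
    also have "\<dots> = Jc a ?d (snd ?d q) (\<iota> q (Y q) ?d)" by (rule Jc_apply[OF d(1) q(2) YN])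
    also have "\<dots> = Jc a ?d (?\<phi> x) (push c ?d Y x)"
      unfolding q(4) push_p[of Y q, OF YT q(1,2)] M.transition_apply[OF c(1) q(1)] ..
    finally show ?thesis .
  qed
  let ?u = "X p c" and ?w = "push c ?d Y ?x"
  let ?v = "Di c ?d p (X p c)"
  have linJc: "linear (Jc a ?d (?\<phi> x))" if "x \<in> ?A" for x
    using that linear_Jc[OF d(1)] AU by (auto simp: M.transition_apply[OF c(1)])
  have "fderiv (push c ?d (app (IJ a) Y)) ?x = fderiv (\<lambda>x. Jc a ?d (?\<phi> x) (push c ?d Y x)) ?x"
    by (rule frechet_derivative_cong_open[OF A pushI])
  moreover have "fderiv (\<lambda>x. Jc a ?d (?\<phi> x) (push c ?d Y x)) ?x ?u =
      fderiv (\<lambda>x. Jc a ?d (?\<phi> x) ?w) ?x ?u + Jc a ?d ?y (fderiv (push c ?d Y) ?x ?u)"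
    unfolding \<phi>x[symmetric]
    by (rule frechet_derivative_linear_family[OF A linJc smooth_Jc_along[OF c(1) d(1) A(1) AU smooth_on_const] sY])
  moreover have "fderiv (\<lambda>x. Jc a ?d (?\<phi> x) ?w) ?x ?u = fderiv (\<lambda>y. Jc a ?d y ?w) ?y ?v"
  proof -
    have y: "?y \<in> snd ?d ` (fst ?d \<inter> U)" using d(2) pU by blast
    have "((\<lambda>y. Jc a ?d y ?w) has_derivative (\<lambda>v. fderiv (\<lambda>y. Jc a ?d y ?w) ?y v)) (at (?\<phi> ?x))"
      unfolding \<phi>x by (rule smooth_on_has_derivative[OF smooth_Jc[OF d(1)] y])
    from diff_chain_at[OF Di_has_derivative[OF c(1) d(1) c(2) d(2)] this]
    have "((\<lambda>x. Jc a ?d (?\<phi> x) ?w) has_derivative (\<lambda>u. fderiv (\<lambda>y. Jc a ?d y ?w) ?y (Di c ?d p u))) (at ?x)"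
      by (simp only: o_def)
    from frechet_derivative_at[OF this, symmetric] show ?thesis by (rule fun_cong)
  qed
  ultimately have der: "fderiv (push c ?d (app (IJ a) Y)) ?x ?u =
      fderiv (\<lambda>y. Jc a ?d y ?w) ?y ?v + Jc a ?d ?y (fderiv (push c ?d Y) ?x ?u)"
    by (simp only:)
  have w': "push c ?d (app (IJ a) Y) ?x = Jc a ?d ?y ?w" unfolding pushI[OF A(2)] \<phi>x ..
  note ll = N.linear_lift[OF d]
  have lJ: "lift N ?d p (Jc a ?d ?y z) = J a p (lift N ?d p z)" for z
  proof -
    have z: "lift N ?d p z \<in> TN p" by (rule N.lift_in[OF d])
    have "Jc a ?d ?y z = J a p (lift N ?d p z) ?d" using Jc_apply[OF d z, of a] N.lift_at[OF d, of z] by simp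
    then show ?thesis using N.lift_eq[OF d J_point(2)[OF pU z]] by simp
  qed
  obtain \<epsilon> where \<epsilon>: "lift N ?d p (fderiv (\<lambda>y. Jc a ?d y ?w) ?y ?v + C.\<Gamma> p ?v (Jc a ?d ?y ?w)) =
      J a p (lift N ?d p (C.\<Gamma> p ?v ?w)) + (\<Sum>b\<in>UNIV. \<epsilon> b *\<^sub>R J b p (lift N ?d p ?w))"
    using J_coord_derivative[OF pN pU, of a ?w ?v] by (rule exE)
  have w: "lift N ?d p ?w = \<iota> p (Y p)"
  proof -
    have YT: "Y p \<in> TM p" by (rule M.vector_field_tangent[OF YV p])
    show ?thesis unfolding push_p[of Y p, OF YT c(2) d(2)] by (rule N.lift_eq[OF d \<iota>_in[OF pM YT]])
  qed
  let ?g = "fderiv (push c ?d Y) ?x ?u"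
  have "cov c p X (app (IJ a) Y) = lift N ?d p ((fderiv (\<lambda>y. Jc a ?d y ?w) ?y ?v + C.\<Gamma> p ?v (Jc a ?d ?y ?w))
      + Jc a ?d ?y ?g)"
    unfolding cov_def der w' by (simp only: add.assoc add.commute add.left_commute)
  also have "\<dots> = J a p (lift N ?d p (C.\<Gamma> p ?v ?w)) + (\<Sum>b\<in>UNIV. \<epsilon> b *\<^sub>R J b p (\<iota> p (Y p))) + J a p (lift N ?d p ?g)"
    unfolding linear_add[OF ll] lJ \<epsilon>[unfolded linear_add[OF ll] lJ] w by (rule refl)
  also have "\<dots> = J a p (cov c p X Y) + (\<Sum>b\<in>UNIV. \<epsilon> b *\<^sub>R J b p (\<iota> p (Y p)))"
  proof -
    have "J a p (cov c p X Y) = J a p (lift N ?d p ?g) + J a p (lift N ?d p (C.\<Gamma> p ?v ?w))"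
      unfolding cov_def linear_add[OF ll]
      by (rule linear_on_simps(1)[OF J_point(1)[OF pU] N.subspace_tangent[OF pN] N.lift_in[OF d] N.lift_in[OF d]])
    then show ?thesis by (simp only: add.assoc add.commute add.left_commute)
  qed
  finally show ?thesis by (intro exI[of _ \<epsilon>])
qed

end

section \<open>The integrability conditions for sections of Q\<close>

context quat_hypersurf
begin

lemma integrable_induced: "integrable_hyper_CR M MU (\<lambda>a. QJ a) (\<lambda>a. IJ a)"
  unfolding integrable_hyper_CR_def Let_def
proof (intro allI impI ballI conjI)
  fix W X Y a
  assume "openin (mtop M) W \<and> W \<subseteq> MU"
    and X: "X \<in> sections M W (Qint (\<lambda>a. QJ a))" and Y: "Y \<in> sections M W (Qint (\<lambda>a. QJ a))"
  then have W: "openin (mtop M) W" "W \<subseteq> MU" by auto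
  have sec: "Z \<in> sections M W (QJ a)" if "Z \<in> sections M W (Qint (\<lambda>a. QJ a))" for Z
    using that exhaust_3[of a] by (auto simp: sections_def Qint_def)
  let ?X = "app (IJ a) X" and ?Y = "app (IJ a) Y"
  have V: "X \<in> vector_fields M W" "Y \<in> vector_fields M W" using X Y by (auto simp: sections_def)
  have V': "?X \<in> vector_fields M W" "?Y \<in> vector_fields M W"
    using app_IJ_section[OF W sec[OF X]] app_IJ_section[OF W sec[OF Y]] by (auto simp: sections_def)
  note br = M.lie_bracket_in_vector_fields[OF W(1)]
  let ?Z = "lie_bracket M X Y - lie_bracket M ?X ?Y"
  have Z: "?Z \<in> vector_fields M W" by (rule M.vector_field_diff[OF W(1) br[OF V] br[OF V']])
  have pt: "?Z p \<in> QJ a p \<and> IJ a p (?Z p) - lie_bracket M X ?Y p - lie_bracket M ?X Y p \<in> QJ 1 p \<inter> QJ 2 p \<inter> QJ 3 p"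
    if p: "p \<in> W" for p
  proof -
    have pU: "p \<in> MU" using p W by blast
    then have pM: "p \<in> topspace (mtop M)" "p \<in> topspace (mtop N)" using topspace_subset by auto
    obtain c where c: "c \<in> charts M" "p \<in> fst c" using M.exists_chart[OF pM(1)] by blast
    have d: "chart_at N p \<in> charts N" "p \<in> fst (chart_at N p)" using N.chart_at[OF pM(2)] by auto
    obtain \<xi> where q: "hyperplane p \<xi>"
      by (rule hyperplane_at[OF pU])
    interpret h: quat_hyperplane "TM p" "\<iota> p" "TN p" "\<lambda>a. J a p" \<xi> by (rule q)
    have E: "cov c p A B \<in> TN p" for A B unfolding cov_def by (rule N.lift_in[OF d])
    have T: "lie_bracket M A B p \<in> TM p"
      if "A \<in> vector_fields M W" "B \<in> vector_fields M W" for A B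
      by (rule M.vector_field_tangent[OF br[OF that] p])
    have H: "\<iota> p (A p) \<in> h.H" if A: "A \<in> sections M W (Qint (\<lambda>a. QJ a))" for A
    proof -
      have "A p \<in> QJ 1 p \<inter> QJ 2 p \<inter> QJ 3 p" using A p by (auto simp: sections_def Qint_def)
      moreover have "A p \<in> TM p" using A p by (auto simp: sections_def M.vector_field_tangent)
      ultimately show ?thesis using h.\<iota>_in_H_iff[of "A p"] unfolding Q_eq[OF q] by blast
    qed
    have der: "\<exists>e\<in>h.H. cov c p A (app (IJ a) B) = J a p (cov c p A B) + e"
      if A: "A \<in> vector_fields M W" and B: "B \<in> sections M W (Qint (\<lambda>a. QJ a))" for A B
    proof -
      obtain \<epsilon> where "cov c p A (app (IJ a) B) = J a p (cov c p A B) + (\<Sum>b\<in>UNIV. \<epsilon> b *\<^sub>R J b p (\<iota> p (B p)))"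
        using cov_J[OF W A sec[OF B] p c] by (rule exE)
      then show ?thesis using h.sum_J_in_H[OF H[OF B]] by (rule bexI)
    qed
    \<comment> \<open>In all four cases \<open>I a\<close> is applied to \<open>X\<close> or
      \<open>Y\<close>, which lie in \<open>Q\<close>, so the error lies in \<open>H\<close>; the
      direction may be any field tangent to \<open>M\<close>, in particular \<open>?X\<close> or
      \<open>?Y\<close>.\<close>
    obtain e1 where e1: "e1 \<in> h.H" "cov c p X ?Y = J a p (cov c p X Y) + e1" by (rule bexE[OF der[OF V(1) Y]])
    obtain e2 where e2: "e2 \<in> h.H" "cov c p ?X ?Y = J a p (cov c p ?X Y) + e2" by (rule bexE[OF der[OF V'(1) Y]])
    obtain e3 where e3: "e3 \<in> h.H" "cov c p Y ?X = J a p (cov c p Y X) + e3" by (rule bexE[OF der[OF V(2) X]])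
    obtain e4 where e4: "e4 \<in> h.H" "cov c p ?Y ?X = J a p (cov c p ?Y X) + e4" by (rule bexE[OF der[OF V'(2) X]])
    note lb = lie_bracket_cov[OF W(1) _ _ p c]
    have Zp: "?Z p = lie_bracket M X Y p - lie_bracket M ?X ?Y p" by (rule fun_diff_def[THEN fun_cong])
    have ZT: "?Z p \<in> TM p" by (rule M.vector_field_tangent[OF Z p])
    have "\<iota> p (?Z p) = \<iota> p (lie_bracket M X Y p) - \<iota> p (lie_bracket M ?X ?Y p)"
      unfolding Zp by (rule h.\<iota>_simps(4)[OF T[OF V] T[OF V']])
    then have \<iota>Z: "\<iota> p (?Z p) = (cov c p X Y - cov c p Y X) - (cov c p ?X ?Y - cov c p ?Y ?X)"
      unfolding lb[OF V] lb[OF V'] .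
    note alg = h.integrability_algebra[OF ZT T[OF V(1) V'(2)] T[OF V'(1) V(2)] E E E E e1(1) e2(1) e3(1) e4(1)
        \<iota>Z lb[OF V(1) V'(2)] lb[OF V'(1) V(2)] e1(2) e2(2) e3(2) e4(2)]
    show ?thesis using alg unfolding Q_eq[OF q] by (rule conjI)
  qed
  show Zsec: "?Z \<in> sections M W (QJ a)" using Z pt unfolding sections_def by blast
  have "app (IJ a) ?Z \<in> vector_fields M W" using app_IJ_section[OF W Zsec] by (simp add: sections_def)
  then have "app (IJ a) ?Z - lie_bracket M X ?Y - lie_bracket M ?X Y \<in> vector_fields M W"
    by (intro M.vector_field_diff[OF W(1)] br V V')
  moreover have "(app (IJ a) ?Z - lie_bracket M X ?Y - lie_bracket M ?X Y) p \<in> Qint (\<lambda>a. QJ a) p" if "p \<in> W" for p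
  proof -
    have "(app (IJ a) ?Z - lie_bracket M X ?Y - lie_bracket M ?X Y) p =
        IJ a p (?Z p) - lie_bracket M X ?Y p - lie_bracket M ?X Y p"
      unfolding fun_diff_def app_def ..
    then show ?thesis using conjunct2[OF pt[OF that]] unfolding Qint_def by (simp only:)
  qed
  ultimately show "app (IJ a) ?Z - lie_bracket M X ?Y - lie_bracket M ?X Y \<in> sections M W (Qint (\<lambda>a. QJ a))"
    unfolding sections_def by blast
qed

end

section \<open>Overlaps\<close>

context quat_hyperplane
begin

text \<open>The imaginary quaternion with coefficients \<open>z\<close> squares to minus the sum of
  the squares of its coefficients. Applying it to \<open>w = 0\<close> once more therefore gives
  this multiple of \<open>e\<close>, which must vanish.\<close>

lemma J_independent:
  fixes z :: "3 \<Rightarrow> real"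
  assumes e: "e \<in> E" "e \<noteq> 0" and z: "(\<Sum>b\<in>UNIV. z b *\<^sub>R J b e) = 0"
  shows "z b = 0"
proof -
  define w where "w = z 1 *\<^sub>R J 1 e + (z 2 *\<^sub>R J 2 e + z 3 *\<^sub>R J 3 e)"
  have w: "w = 0" using z by (simp add: w_def sum_3 add.assoc)
  have J0: "J a 0 = 0" for a using linear_on_simps(2)[OF lin_J subspace_E E_closed(1), where r = 0] by simp
  have "z 1 *\<^sub>R J 1 w + (z 2 *\<^sub>R J 2 w + z 3 *\<^sub>R J 3 w) = - ((z 1 * z 1 + z 2 * z 2 + z 3 * z 3) *\<^sub>R e)"
    using e(1) by (simp add: w_def scaleR_add_right scaleR_add_left algebra_simps)
  then have "z 1 * z 1 + z 2 * z 2 + z 3 * z 3 = 0" using e(2) by (simp add: w J0)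
  then have "z 1 = 0 \<and> z 2 = 0 \<and> z 3 = 0"
    by (metis add_nonneg_eq_0_iff mult_eq_0_iff zero_le_square add_nonneg_nonneg)
  then show ?thesis using exhaust_3[of b] by auto
qed

end

section \<open>Smooth rotations between compatible triples\<close>

lemma rotation_transpose_mult:
  assumes "rotation_matrix (A :: real^'n^'n)" "rotation_matrix B"
  shows "rotation_matrix (transpose A ** B)"
  using assms by (simp add: rotation_matrix_def orthogonal_matrix_mul orthogonal_matrix_transpose det_mul)

lemma rotation_combination_compose:
  fixes A B :: "real^'n^'n" and j k :: "'n \<Rightarrow> 'b::real_vector"
  assumes "rotation_matrix A" "\<And>a. j a = (\<Sum>b\<in>UNIV. (A $ b $ a) *\<^sub>R k b)" "\<And>a. j' a = (\<Sum>b\<in>UNIV. (B $ b $ a) *\<^sub>R k b)"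
  shows "j' a = (\<Sum>b\<in>UNIV. ((transpose A ** B) $ b $ a) *\<^sub>R j b)"
proof -
  have "j' a = (\<Sum>b\<in>UNIV. \<Sum>c\<in>UNIV. (A $ b $ c * B $ b $ a) *\<^sub>R j c)"
    unfolding assms(3) rotation_combination_invert[of A j k, OF assms(1,2)] scaleR_sum_right scaleR_scaleR
    by (simp only: mult.commute)
  also have "\<dots> = (\<Sum>c\<in>UNIV. (\<Sum>b\<in>UNIV. A $ b $ c * B $ b $ a) *\<^sub>R j c)"
    unfolding scaleR_sum_left by (rule sum.swap)
  finally show ?thesis by (simp add: matrix_matrix_mult_def transpose_def)
qed

definition frame_change where
  "frame_change N J J' p S \<longleftrightarrow> rotation_matrix S \<and>
     (\<forall>a. \<forall>v\<in>tangent_space N p. J' a p v = (\<Sum>b\<in>UNIV. (S $ b $ a) *\<^sub>R J b p v))"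
  for N :: "('p, 'e::euclidean_space) manifold" and J J' :: "3 \<Rightarrow> ('p, 'e) endo" and S :: "real^3^3"

context quat_hypersurf
begin

text \<open>The \<open>J b e\<close> are linearly independent for a nonzero \<open>e\<close>, so
  their coefficients are determined. This is what lets local rotations be glued.\<close>

lemma frame_change_unique:
  assumes p: "p \<in> MU" and S: "frame_change N J J' p S" "frame_change N J J' p S'"
  shows "S = S'"
proof -
  obtain \<xi> where q: "hyperplane p \<xi>"
    by (rule hyperplane_at[OF p])
  interpret h: quat_hyperplane "TM p" "\<iota> p" "TN p" "\<lambda>a. J a p" \<xi> by (rule q)
  obtain e where e: "e \<in> TN p" "\<xi> e \<noteq> 0" using h.\<xi>_nonzero by blast
  have e0: "e \<noteq> 0" using e linear_on_simps(2)[OF h.lin_\<xi> h.subspace_E h.E_closed(1), where r = 0] by auto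
  have "S $ b $ a - S' $ b $ a = 0" for a b
  proof (rule h.J_independent[where z = "\<lambda>b. S $ b $ a - S' $ b $ a", OF e(1) e0])
    have "(\<Sum>b\<in>UNIV. (S $ b $ a) *\<^sub>R J b p e) = (\<Sum>b\<in>UNIV. (S' $ b $ a) *\<^sub>R J b p e)"
      using bspec[OF spec[OF conjunct2[OF S(1)[unfolded frame_change_def]]] e(1)]
        bspec[OF spec[OF conjunct2[OF S(2)[unfolded frame_change_def]]] e(1)] by (rule trans[OF sym])
    then show "(\<Sum>b\<in>UNIV. (S $ b $ a - S' $ b $ a) *\<^sub>R J b p e) = 0"
      unfolding scaleR_diff_left sum_subtractf by (simp only: diff_self)
  qed
  then show ?thesis by (simp add: vec_eq_iff)
qed

text \<open>Compatibility is defined by comparison with the members of \<open>\<T>\<close>, so two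
  compatible triples meet through a member \<open>K\<close> around \<open>p\<close>. The domain of
  \<open>K\<close> limits the result to a neighbourhood.\<close>

lemma local_frame_change:
  assumes U': "openin (mtop N) U'" "\<And>V K. (V, K) \<in> \<T> \<Longrightarrow> SO3_related N V K U' J'"
    and p: "p \<in> MU" "p \<in> U'"
  shows "\<exists>d V S. d \<in> charts N \<and> p \<in> fst d \<and> openin (mtop N) V \<and> p \<in> V \<and> V \<subseteq> U \<inter> U' \<inter> fst d \<and>
    smooth_on (snd d ` (fst d \<inter> V)) (S \<circ> chart_inv d) \<and> (\<forall>q\<in>V. frame_change N J J' q (S q))"
proof -
  have pN: "p \<in> topspace (mtop N)" using p topspace_subset by blast
  then have "p \<in> (\<Union>(V, K)\<in>\<T>. V)" unfolding cover .
  then obtain V K where VK: "(V, K) \<in> \<T>" "p \<in> V" by auto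
  obtain d where d: "d \<in> charts N" "p \<in> fst d" using N.exists_chart[OF pN] by blast
  obtain A :: "'p \<Rightarrow> real^3^3" where A: "smooth_fun N (V \<inter> U) A"
    "\<And>q. q \<in> V \<inter> U \<Longrightarrow> rotation_matrix (A q)"
    "\<And>q a v. q \<in> V \<inter> U \<Longrightarrow> v \<in> TN q \<Longrightarrow> J a q v = (\<Sum>b\<in>UNIV. (A q $ b $ a) *\<^sub>R K b q v)"
    by (rule SO3_relatedE[OF related[OF VK(1)]]) (rule that)
  obtain B :: "'p \<Rightarrow> real^3^3" where B: "smooth_fun N (V \<inter> U') B"
    "\<And>q. q \<in> V \<inter> U' \<Longrightarrow> rotation_matrix (B q)"
    "\<And>q a v. q \<in> V \<inter> U' \<Longrightarrow> v \<in> TN q \<Longrightarrow> J' a q v = (\<Sum>b\<in>UNIV. (B q $ b $ a) *\<^sub>R K b q v)"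
    by (rule SO3_relatedE[OF U'(2)[OF VK(1)]]) (rule that)
  \<comment> \<open>\<open>J\<close> arises from \<open>K\<close> by \<open>A\<close> and
    \<open>J'\<close> from \<open>K\<close> by \<open>B\<close>; the passage from \<open>J\<close>
    to \<open>J'\<close> is the inverse of \<open>A\<close>, its transpose, times
    \<open>B\<close>.\<close>
  define S where "S q = transpose (A q) ** B q" for q
  define W where "W = V \<inter> U \<inter> U' \<inter> fst d"
  have "openin (mtop N) V" using triples[OF VK(1)] by (simp add: local_quaternionic_triple_def)
  then have W: "openin (mtop N) W" "p \<in> W" "W \<subseteq> U \<inter> U' \<inter> fst d" "W \<subseteq> V \<inter> U" "W \<subseteq> V \<inter> U'"
    using openin_U U'(1) N.openin_chart[OF d(1)] VK(2) p d by (auto simp: W_def)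
  have opn: "open (snd d ` (fst d \<inter> W))" by (rule N.open_chart_image[OF d(1) W(1)])
  have sm: "smooth_on (snd d ` (fst d \<inter> W)) (\<lambda>x. F (chart_inv d x) $ i $ j)"
    if "smooth_fun N X F" "W \<subseteq> X" for F :: "'p \<Rightarrow> real^3^3" and X i j
  proof -
    have "smooth_on (snd d ` (fst d \<inter> W)) (F \<circ> chart_inv d)"
      by (rule smooth_on_subset[of "snd d ` (fst d \<inter> X)"]) (use that d(1) in \<open>auto simp: smooth_fun_def\<close>)
    from smooth_on_nth[OF opn smooth_on_nth[OF opn this]] show ?thesis by (simp add: o_def)
  qed
  have "smooth_on (snd d ` (fst d \<inter> W)) (S \<circ> chart_inv d)"
  proof (intro smooth_on_vec[OF opn])
    fix i j
    have "smooth_on (snd d ` (fst d \<inter> W)) (\<lambda>x. \<Sum>k\<in>UNIV. A (chart_inv d x) $ k $ i * B (chart_inv d x) $ k $ j)"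
      by (intro smooth_on_sum[OF opn] smooth_on_mult[OF opn] sm[OF A(1) W(4)] sm[OF B(1) W(5)])
    then show "smooth_on (snd d ` (fst d \<inter> W)) (\<lambda>x. (S \<circ> chart_inv d) x $ i $ j)"
      by (simp add: S_def o_def matrix_matrix_mult_def transpose_def)
  qed
  moreover have "frame_change N J J' q (S q)" if "q \<in> W" for q
    unfolding frame_change_def
  proof (intro conjI allI ballI)
    have q: "q \<in> V \<inter> U" "q \<in> V \<inter> U'" using that W(4,5) by auto
    show "rotation_matrix (S q)"
      unfolding S_def by (rule rotation_transpose_mult[OF A(2)[OF q(1)] B(2)[OF q(2)]])
    show "J' a q v = (\<Sum>b\<in>UNIV. (S q $ b $ a) *\<^sub>R J b q v)" if v: "v \<in> TN q" for a v
      unfolding S_def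
      by (rule rotation_combination_compose[of "A q" "\<lambda>a. J a q v" "\<lambda>b. K b q v" "\<lambda>a. J' a q v",
            OF A(2)[OF q(1)] A(3)[OF q(1) v] B(3)[OF q(2) v]])
  qed
  ultimately show ?thesis using d W by blast
qed

lemma smooth_frame_change:
  assumes U': "openin (mtop N) U'" "\<And>V K. (V, K) \<in> \<T> \<Longrightarrow> SO3_related N V K U' J'"
  shows "\<exists>S. smooth_fun M (MU \<inter> U') S \<and> (\<forall>p\<in>MU \<inter> U'. frame_change N J J' p (S p))"
proof -
  \<comment> \<open>A choice at each point separately; by uniqueness it agrees on \<open>M\<close>
    with the smooth local rotations and inherits their smoothness along the inclusion.\<close>
  define S where "S p = (SOME S. frame_change N J J' p S)" for p
  have S: "frame_change N J J' p (S p)" if p: "p \<in> MU \<inter> U'" for p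
  proof -
    have "\<exists>S. frame_change N J J' p S" using local_frame_change[OF U', of p] p by blast
    then show ?thesis unfolding S_def by (rule someI_ex)
  qed
  have "smooth_fun M (MU \<inter> U') S"
  proof (rule M.smooth_funI)
    show "openin (mtop M) (MU \<inter> U')" by (rule openin_M_Int[OF openin_MU U'(1)])
    fix p assume p: "p \<in> MU \<inter> U'"
    then have "p \<in> topspace (mtop M)" by blast
    then obtain c where c: "c \<in> charts M" "p \<in> fst c" using M.exists_chart by blast
    obtain d V S0 where d: "d \<in> charts N" "p \<in> fst d" and V: "openin (mtop N) V" "p \<in> V" "V \<subseteq> U \<inter> U' \<inter> fst d"
      and sS0: "smooth_on (snd d ` (fst d \<inter> V)) (S0 \<circ> chart_inv d)" and S0: "\<And>q. q \<in> V \<Longrightarrow> frame_change N J J' q (S0 q)"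
      using local_frame_change[OF U', of p] p by blast
    let ?B = "snd c ` (fst c \<inter> (fst c \<inter> V))"
    have B: "open ?B" "snd c p \<in> ?B"
      using M.open_chart_image[OF c(1) openin_M_Int[OF M.openin_chart[OF c(1)] V(1)]] c V(2) by auto
    have Bq: "\<exists>q. q \<in> fst c \<and> q \<in> fst d \<and> q \<in> V \<and> x = snd c q" if "x \<in> ?B" for x using that V(3) by blast
    have "smooth_on ?B (\<lambda>x. (S0 \<circ> chart_inv d) (transition c d x))"
    proof (rule smooth_on_compose[OF B(1) N.open_chart_image[OF d(1) V(1)] _ sS0])
      show "smooth_on ?B (transition c d)"
        by (rule smooth_on_subset[OF smooth_inclusion[OF c(1) d(1)]]) (use V(3) in blast)
      show "transition c d x \<in> snd d ` (fst d \<inter> V)" if x: "x \<in> ?B" for x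
        using Bq[OF x] M.transition_apply[OF c(1), of _ d] by auto
    qed
    moreover have "(S \<circ> chart_inv c) x = (S0 \<circ> chart_inv d) (transition c d x)" if x: "x \<in> ?B" for x
    proof -
      obtain q where q: "q \<in> fst c" "q \<in> fst d" "q \<in> V" "x = snd c q" using Bq[OF x] by blast
      have qU: "q \<in> MU" "q \<in> MU \<inter> U'" using q(3) V(3) M.openin_topspace_fst[OF c(1) q(1)] by auto
      have "S q = S0 q" by (rule frame_change_unique[OF qU(1) S[OF qU(2)] S0[OF q(3)]])
      then show ?thesis
        unfolding q(4) M.transition_apply[OF c(1) q(1)] o_def M.chart_inv_chart[OF c(1) q(1)] N.chart_inv_chart[OF d(1) q(2)] .
    qed
    ultimately have "smooth_on ?B (S \<circ> chart_inv c)" using smooth_on_eq[OF _ B(1)] by blast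
    then show "\<exists>c A. c \<in> charts M \<and> p \<in> fst c \<and> open A \<and> snd c p \<in> A \<and> smooth_on A (S \<circ> chart_inv c)"
      using c B by blast
  qed
  then show ?thesis using S by blast
qed

end

text \<open>With the coefficients of \<open>J' a\<close> in the \<open>a\<close>-th column of
  \<open>S\<close>, the combination \<open>\<Sum> v_a J'_a\<close> equals
  \<open>\<Sum> (S *v v)_b J_b\<close>, and these combinations determine \<open>Q_vec\<close> and
  \<open>I_vec\<close>.\<close>

lemma frame_change_vec:
  assumes "hypersurf_triple M N U J" "hypersurf_triple M N U' J'" and p: "p \<in> topspace (mtop M)" "p \<in> U" "p \<in> U'"
    and S: "frame_change N J J' p S"
  shows "Q_vec M (\<lambda>a. induced_Q M N (J' a)) (\<lambda>a. induced_I M N (J' a)) v p =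
      Q_vec M (\<lambda>a. induced_Q M N (J a)) (\<lambda>a. induced_I M N (J a)) (S *v v) p" (is "?Q' = ?Q")
    and "w \<in> Q_vec M (\<lambda>a. induced_Q M N (J' a)) (\<lambda>a. induced_I M N (J' a)) v p \<Longrightarrow>
      I_vec M (\<lambda>a. induced_Q M N (J' a)) (\<lambda>a. induced_I M N (J' a)) v p w =
      I_vec M (\<lambda>a. induced_Q M N (J a)) (\<lambda>a. induced_I M N (J a)) (S *v v) p w"
proof -
  interpret A: hypersurf_triple M N U J by fact
  interpret B: hypersurf_triple M N U' J' by fact
  have pA: "p \<in> A.MU" and pB: "p \<in> B.MU" using p by auto
  have eq: "(\<Sum>a\<in>UNIV. (v $ a) *\<^sub>R J' a p e) = (\<Sum>a\<in>UNIV. ((S *v v) $ a) *\<^sub>R J a p e)"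
    if e: "e \<in> tangent_space N p" for e
  proof -
    have J': "J' a p e = (\<Sum>b\<in>UNIV. (S $ b $ a) *\<^sub>R J b p e)" for a
      by (rule bspec[OF spec[OF conjunct2[OF S[unfolded frame_change_def]]] e])
    have "(\<Sum>a\<in>UNIV. (v $ a) *\<^sub>R J' a p e) = (\<Sum>a\<in>UNIV. \<Sum>b\<in>UNIV. (S $ b $ a * v $ a) *\<^sub>R J b p e)"
      unfolding J' scaleR_sum_right scaleR_scaleR by (simp only: mult.commute)
    also have "\<dots> = (\<Sum>b\<in>UNIV. (\<Sum>a\<in>UNIV. S $ b $ a * v $ a) *\<^sub>R J b p e)"
      unfolding scaleR_sum_left by (rule sum.swap)
    finally show ?thesis by (simp add: matrix_vector_mult_def)
  qed
  have eq': "(\<Sum>a\<in>UNIV. (v $ a) *\<^sub>R J' a p (A.\<iota> p u)) = (\<Sum>a\<in>UNIV. ((S *v v) $ a) *\<^sub>R J a p (A.\<iota> p u))"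
    if "u \<in> tangent_space M p" for u
    by (rule eq[OF A.\<iota>_in[OF p(1) that]])
  show Q: "?Q' = ?Q"
    unfolding A.Q_vec_induced[OF pA] B.Q_vec_induced[OF pB] by (rule Collect_cong) (use eq' in \<open>auto simp only:\<close>)
  assume w: "w \<in> ?Q'"
  have wT: "w \<in> tangent_space M p" using w unfolding B.Q_vec_induced[OF pB] by blast
  show "I_vec M (\<lambda>a. induced_Q M N (J' a)) (\<lambda>a. induced_I M N (J' a)) v p w =
      I_vec M (\<lambda>a. induced_Q M N (J a)) (\<lambda>a. induced_I M N (J a)) (S *v v) p w"
    unfolding A.I_vec_induced[OF pA w[unfolded Q]] B.I_vec_induced[OF pB w] eq'[OF wT] ..
qed

section \<open>Assembly of the quaternionic CR structure\<close>

lemma hypersurface_quat_hypersurf: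
  fixes M :: "('p, real^'m) manifold" and N :: "('p, real^'k) manifold"
  assumes "quaternionic_manifold N \<T>" "hypersurface M N"
  obtains D where "\<And>U J. (U, J) \<in> compatible_triples N \<T> \<Longrightarrow> quat_hypersurf M N U J D \<T>"
proof -
  have "\<exists>D. affine_connection N D \<and> torsion_free N D \<and> (\<forall>(U, J)\<in>\<T>. preserves_triple N D U J)"
    using assms(1) unfolding quaternionic_manifold_def by (elim conjE)
  then obtain D where D: "affine_connection N D" "torsion_free N D" "\<forall>(U, J)\<in>\<T>. preserves_triple N D U J"
    by (elim exE conjE)
  have N: "smooth_manifold N" "\<forall>(U, J)\<in>\<T>. local_quaternionic_triple N U J" "(\<Union>(U, J)\<in>\<T>. U) = topspace (mtop N)"
    using assms(1) unfolding quaternionic_manifold_def by blast+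
  have M: "smooth_manifold M" using assms(2) unfolding hypersurface_def by (elim conjE)
  show thesis
  proof (rule that)
    fix U J assume UJ: "(U, J) \<in> compatible_triples N \<T>"
    then have t: "local_quaternionic_triple N U J" "\<And>V K. (V, K) \<in> \<T> \<Longrightarrow> SO3_related N V K U J"
      by (auto simp: compatible_triples_def)
    show "quat_hypersurf M N U J D \<T>"
      using N(2) D(3) by unfold_locales (auto intro: M N(1) assms(2) t D(1,2) simp: N(3))
  qed
qed

lemma subset_compatible_triples:
  assumes "quaternionic_manifold N \<T>"
  shows "\<T> \<subseteq> compatible_triples N \<T>"
  using assms unfolding quaternionic_manifold_def compatible_triples_def by blast

theorem mainTheorem4:
  fixes N :: "('p, real^'k) manifold"
    and \<T> :: "('p set \<times> (3 \<Rightarrow> ('p, real^'k) endo)) set"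
    and M :: "('p, real^'m) manifold"
    and n :: nat
  assumes "CARD('k) = 4 * n + 4"
    and "CARD('m) = 4 * n + 3"
    and "quaternionic_manifold N \<T>"
    and "hypersurface M N"
    and "connected_space (mtop M)"
    and "orientable M"
  shows "quaternionic_CR_structure M
           {(topspace (mtop M) \<inter> U, \<lambda>a. induced_Q M N (J a), \<lambda>a. induced_I M N (J a)) | U J.
              (U, J) \<in> compatible_triples N \<T> \<and> topspace (mtop M) \<inter> U \<noteq> {}} \<and>
         (\<forall>(U, J) \<in> compatible_triples N \<T>. topspace (mtop M) \<inter> U \<noteq> {} \<longrightarrow>
           integrable_hyper_CR M (topspace (mtop M) \<inter> U)
             (\<lambda>a. induced_Q M N (J a)) (\<lambda>a. induced_I M N (J a)))"
proof -
  obtain D where q: "\<And>U J. (U, J) \<in> compatible_triples N \<T> \<Longrightarrow> quat_hypersurf M N U J D \<T>"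
    by (rule hypersurface_quat_hypersurf[OF assms(3,4)]) (rule that)
  have t: "hypersurf_triple M N U J" if "(U, J) \<in> compatible_triples N \<T>" for U J
    using q[OF that] by (rule quat_hypersurf.axioms(1))
  have topM: "topspace (mtop M) \<subseteq> topspace (mtop N)"
    using assms(4) unfolding hypersurface_def by (elim conjE)
  have integrable: "integrable_hyper_CR M (topspace (mtop M) \<inter> U) (\<lambda>a. induced_Q M N (J a)) (\<lambda>a. induced_I M N (J a))"
    if "(U, J) \<in> compatible_triples N \<T>" for U J
    by (rule quat_hypersurf.integrable_induced[OF q[OF that]])
  have hyper: "hyper_CR M (topspace (mtop M) \<inter> U) (\<lambda>a. induced_Q M N (J a)) (\<lambda>a. induced_I M N (J a))"
    if "(U, J) \<in> compatible_triples N \<T>" for U J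
    unfolding hyper_CR_def
    using hypersurf_triple.almost_hyper_CR_induced[OF t[OF that] assms(2)] integrable[OF that] by (rule conjI)
  have "quaternionic_CR_structure M
      {(topspace (mtop M) \<inter> U, \<lambda>a. induced_Q M N (J a), \<lambda>a. induced_I M N (J a)) | U J.
        (U, J) \<in> compatible_triples N \<T> \<and> topspace (mtop M) \<inter> U \<noteq> {}}" (is "quaternionic_CR_structure M ?C")
    unfolding quaternionic_CR_structure_def
  proof (intro conjI)
    show "\<forall>(U, Q, I)\<in>?C. openin (mtop M) U \<and> hyper_CR M U Q I"
      using hyper hypersurf_triple.openin_MU[OF t] by auto
    \<comment> \<open>The members of \<open>\<T>\<close> are themselves compatible triples, and
      their domains already cover \<open>N\<close>.\<close>
    have ex: "\<exists>U J. (U, J) \<in> compatible_triples N \<T> \<and> p \<in> U" if p: "p \<in> topspace (mtop M)" for p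
    proof -
      have "(\<Union>(U, J)\<in>\<T>. U) = topspace (mtop N)" using assms(3) unfolding quaternionic_manifold_def by (elim conjE)
      then have "p \<in> (\<Union>(U, J)\<in>\<T>. U)" using p topM by blast
      then show ?thesis using subset_compatible_triples[OF assms(3)] by blast
    qed
    show "(\<Union>(U, Q, I)\<in>?C. U) = topspace (mtop M)"
    proof (rule equalityI)
      show "(\<Union>(U, Q, I)\<in>?C. U) \<subseteq> topspace (mtop M)" by auto
      show "topspace (mtop M) \<subseteq> (\<Union>(U, Q, I)\<in>?C. U)"
      proof
        fix p assume p: "p \<in> topspace (mtop M)"
        obtain U J where UJ: "(U, J) \<in> compatible_triples N \<T>" "p \<in> U" using ex[OF p] by blast
        then have "(topspace (mtop M) \<inter> U, \<lambda>a. induced_Q M N (J a), \<lambda>a. induced_I M N (J a)) \<in> ?C"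
          using p by blast
        then show "p \<in> (\<Union>(U, Q, I)\<in>?C. U)" by (rule UN_I) (use p UJ(2) in simp)
      qed
    qed
    have overlap: "\<exists>S :: 'p \<Rightarrow> real^3^3. smooth_fun M (V \<inter> V') S \<and>
           (\<forall>p\<in>V \<inter> V'. rotation_matrix (S p) \<and>
              (\<forall>v\<in>sphere 0 1.
                 Q_vec M Q' I' v p = Q_vec M Q I (S p *v v) p \<and>
                 (\<forall>w\<in>Q_vec M Q' I' v p. I_vec M Q' I' v p w = I_vec M Q I (S p *v v) p w)))"
      if VV': "(V, Q, I) \<in> ?C" "(V', Q', I') \<in> ?C" for V Q I V' Q' I'
    proof -
      from VV'(1) obtain U J where U: "(U, J) \<in> compatible_triples N \<T>" "V = topspace (mtop M) \<inter> U"
        "Q = (\<lambda>a. induced_Q M N (J a))" "I = (\<lambda>a. induced_I M N (J a))" by blast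
      from VV'(2) obtain U' J' where U': "(U', J') \<in> compatible_triples N \<T>" "V' = topspace (mtop M) \<inter> U'"
        "Q' = (\<lambda>a. induced_Q M N (J' a))" "I' = (\<lambda>a. induced_I M N (J' a))" by blast
      have U'': "openin (mtop N) U'" "\<And>V K. (V, K) \<in> \<T> \<Longrightarrow> SO3_related N V K U' J'"
        using U'(1) by (auto simp: compatible_triples_def local_quaternionic_triple_def)
      obtain S where S: "smooth_fun M (topspace (mtop M) \<inter> U \<inter> U') S"
        "\<And>p. p \<in> topspace (mtop M) \<inter> U \<inter> U' \<Longrightarrow> frame_change N J J' p (S p)"
        using quat_hypersurf.smooth_frame_change[OF q[OF U(1)] U''] by blast
      have VV: "V \<inter> V' = topspace (mtop M) \<inter> U \<inter> U'" unfolding U(2) U'(2) by blast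
      show ?thesis
      proof (intro exI[of _ S] conjI ballI)
        show "smooth_fun M (V \<inter> V') S" unfolding VV by (rule S(1))
      next
        fix p assume "p \<in> V \<inter> V'"
        then have p: "p \<in> topspace (mtop M) \<inter> U \<inter> U'" unfolding VV .
        then have p': "p \<in> topspace (mtop M)" "p \<in> U" "p \<in> U'" by auto
        note fc = frame_change_vec[OF t[OF U(1)] t[OF U'(1)] p' S(2)[OF p]]
        show "rotation_matrix (S p)" using S(2)[OF p] by (simp add: frame_change_def)
        fix v
        show "Q_vec M Q' I' v p = Q_vec M Q I (S p *v v) p" unfolding U(3,4) U'(3,4) by (rule fc(1))
        fix w assume "w \<in> Q_vec M Q' I' v p"
        then show "I_vec M Q' I' v p w = I_vec M Q I (S p *v v) p w" unfolding U(3,4) U'(3,4) by (rule fc(2))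
      qed
    qed
    show "\<forall>(U, Q, I)\<in>?C. \<forall>(U', Q', I')\<in>?C. U \<inter> U' \<noteq> {} \<longrightarrow>
        (\<exists>S :: 'p \<Rightarrow> real^3^3. smooth_fun M (U \<inter> U') S \<and>
           (\<forall>p\<in>U \<inter> U'. rotation_matrix (S p) \<and>
              (\<forall>v\<in>sphere 0 1.
                 Q_vec M Q' I' v p = Q_vec M Q I (S p *v v) p \<and>
                 (\<forall>w\<in>Q_vec M Q' I' v p. I_vec M Q' I' v p w = I_vec M Q I (S p *v v) p w))))"
      by (intro ballI case_prodI2 impI, rule overlap) (simp_all only:)
  qed
  then show ?thesis using integrable by blast
qed

end
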